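(* Let $R$ be a ring and let $\mathcal{S}$ be a class of right $R$-modules that are Mittag-Leffler with respect to a class $\mathcal{Q}$ of left $R$-modules with $\mathcal{Q}\subseteq\mathcal{S}^{\intercal}$, where $\mathcal{S}^{\intercal}=\{X\in R\text{-}\mathrm{Mod}\mid\mathrm{Tor}^R_1(S,X)=0\text{ for all }S\in\mathcal{S}\}$. Then any module isomorphic to a direct summand of an $(\mathcal{S}\cup\mathrm{Add}\,R)$-filtered module is $\mathcal{Q}$-Mittag-Leffler.
   Context: $\mathrm{Add}\,R$ is the class of modules isomorphic to direct summands of direct sums of copies of the right module $R$ (i.e. projective right $R$-modules). A right module $M$ is $\mathcal{Q}$-Mittag-Leffler (Mittag-Leffler with respect to $\mathcal{Q}$) if for every family $\{Q_i\}_{i\in I}$ of modules in $\mathcal{Q}$ the canonical map $M\otimes_R\prod_{i\in I}Q_i\to\prod_{i\in I}(M\otimes_RQ_i)$ is injective. For a class $\mathcal{C}$ of right modules, $M$ is $\mathcal{C}$-filtered if there are an ordinal $\tau$ and an increasing chain $(M_\alpha\mid\alpha\le\tau)$ of submodules of $M$ with $M_0=0$, $M_\tau=M$, $M_\alpha=\bigcup_{\beta<\alpha}M_\beta$ for all limit ordinals $\alpha\le\tau$, and $M_{\alpha+1}/M_\alpha\in\mathcal{C}$ for all $\alpha<\tau$ (up to isomorphism). *)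

theory Defs
  imports "HOL-Algebra.Algebra"
begin

section \<open>Modules over a not necessarily commutative ring\<close>

text \<open>
  The library locale for modules requires a commutative ring, so left and right modules are
  introduced here. Both use the library's module record, of which only the additive structure and
  the scalar action are relevant; its fields \<open>mult\<close> and \<open>one\<close> carry no information. For a right
  module, \<open>r \<odot>\<^bsub>M\<^esub> x\<close> denotes the product of x by r from the right, usually written x r; this is
  why \<open>r \<otimes> s\<close> acts by first r, then s.
\<close>

locale left_module = R?: ring R + M?: abelian_group M
  for R :: "('r, 'u) ring_scheme" (structure) and M :: "('r, 'm) module" (structure) +
  assumes smult_closed:
      "\<lbrakk> r \<in> carrier R; x \<in> carrier M \<rbrakk> \<Longrightarrow> r \<odot>\<^bsub>M\<^esub> x \<in> carrier M"
    and smult_l_distr: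
      "\<lbrakk> r \<in> carrier R; s \<in> carrier R; x \<in> carrier M \<rbrakk> \<Longrightarrow>
       (r \<oplus>\<^bsub>R\<^esub> s) \<odot>\<^bsub>M\<^esub> x = r \<odot>\<^bsub>M\<^esub> x \<oplus>\<^bsub>M\<^esub> s \<odot>\<^bsub>M\<^esub> x"
    and smult_r_distr:
      "\<lbrakk> r \<in> carrier R; x \<in> carrier M; y \<in> carrier M \<rbrakk> \<Longrightarrow>
       r \<odot>\<^bsub>M\<^esub> (x \<oplus>\<^bsub>M\<^esub> y) = r \<odot>\<^bsub>M\<^esub> x \<oplus>\<^bsub>M\<^esub> r \<odot>\<^bsub>M\<^esub> y"
    and smult_assoc:
      "\<lbrakk> r \<in> carrier R; s \<in> carrier R; x \<in> carrier M \<rbrakk> \<Longrightarrow>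
       (r \<otimes>\<^bsub>R\<^esub> s) \<odot>\<^bsub>M\<^esub> x = r \<odot>\<^bsub>M\<^esub> (s \<odot>\<^bsub>M\<^esub> x)"
    and smult_one: "x \<in> carrier M \<Longrightarrow> \<one>\<^bsub>R\<^esub> \<odot>\<^bsub>M\<^esub> x = x"

locale right_module = R?: ring R + M?: abelian_group M
  for R :: "('r, 'u) ring_scheme" (structure) and M :: "('r, 'm) module" (structure) +
  assumes smult_closed:
      "\<lbrakk> r \<in> carrier R; x \<in> carrier M \<rbrakk> \<Longrightarrow> r \<odot>\<^bsub>M\<^esub> x \<in> carrier M"
    and smult_l_distr:
      "\<lbrakk> r \<in> carrier R; s \<in> carrier R; x \<in> carrier M \<rbrakk> \<Longrightarrow>
       (r \<oplus>\<^bsub>R\<^esub> s) \<odot>\<^bsub>M\<^esub> x = r \<odot>\<^bsub>M\<^esub> x \<oplus>\<^bsub>M\<^esub> s \<odot>\<^bsub>M\<^esub> x"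
    and smult_r_distr:
      "\<lbrakk> r \<in> carrier R; x \<in> carrier M; y \<in> carrier M \<rbrakk> \<Longrightarrow>
       r \<odot>\<^bsub>M\<^esub> (x \<oplus>\<^bsub>M\<^esub> y) = r \<odot>\<^bsub>M\<^esub> x \<oplus>\<^bsub>M\<^esub> r \<odot>\<^bsub>M\<^esub> y"
    and smult_assoc:
      "\<lbrakk> r \<in> carrier R; s \<in> carrier R; x \<in> carrier M \<rbrakk> \<Longrightarrow>
       (r \<otimes>\<^bsub>R\<^esub> s) \<odot>\<^bsub>M\<^esub> x = s \<odot>\<^bsub>M\<^esub> (r \<odot>\<^bsub>M\<^esub> x)"
    and smult_one: "x \<in> carrier M \<Longrightarrow> \<one>\<^bsub>R\<^esub> \<odot>\<^bsub>M\<^esub> x = x"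

definition mod_hom :: "('r, 'u) ring_scheme \<Rightarrow> ('r, 'm) module \<Rightarrow> ('r, 'n) module \<Rightarrow> ('m \<Rightarrow> 'n) set"
  where "mod_hom R M N = {f \<in> carrier M \<rightarrow> carrier N.
    (\<forall>x\<in>carrier M. \<forall>y\<in>carrier M. f (x \<oplus>\<^bsub>M\<^esub> y) = f x \<oplus>\<^bsub>N\<^esub> f y) \<and>
    (\<forall>r\<in>carrier R. \<forall>x\<in>carrier M. f (r \<odot>\<^bsub>M\<^esub> x) = r \<odot>\<^bsub>N\<^esub> f x)}"

definition mod_iso :: "('r, 'u) ring_scheme \<Rightarrow> ('r, 'm) module \<Rightarrow> ('r, 'n) module \<Rightarrow> bool"
  where "mod_iso R M N \<longleftrightarrow> (\<exists>f\<in>mod_hom R M N. bij_betw f (carrier M) (carrier N))"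

definition direct_summand :: "('r, 'u) ring_scheme \<Rightarrow> 'm set \<Rightarrow> ('r, 'm) module \<Rightarrow> bool"
  where "direct_summand R A M \<longleftrightarrow> submodule A R M \<and>
    (\<exists>B. submodule B R M \<and> A \<inter> B = {\<zero>\<^bsub>M\<^esub>} \<and> A <+>\<^bsub>M\<^esub> B = carrier M)"

definition iso_to_direct_summand ::
    "('r, 'u) ring_scheme \<Rightarrow> ('r, 'n) module \<Rightarrow> ('r, 'm) module \<Rightarrow> bool"
  where "iso_to_direct_summand R N M \<longleftrightarrow>
    (\<exists>A. direct_summand R A M \<and> mod_iso R N (M\<lparr>carrier := A\<rparr>))"

definition quotient_module :: "('r, 'm) module \<Rightarrow> 'm set \<Rightarrow> ('r, 'm set) module"
  where "quotient_module M N =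
    \<lparr>carrier = a_rcosets\<^bsub>M\<^esub> N, monoid.mult = undefined, one = undefined,
     ring.zero = N, ring.add = set_add M,
     module.smult = (\<lambda>r C. \<Union>x\<in>C. N +>\<^bsub>M\<^esub> (r \<odot>\<^bsub>M\<^esub> x))\<rparr>"

definition product_module :: "'i set \<Rightarrow> ('i \<Rightarrow> ('r, 'm) module) \<Rightarrow> ('r, 'i \<Rightarrow> 'm) module"
  where "product_module I Q =
    \<lparr>carrier = (\<Pi>\<^sub>E i\<in>I. carrier (Q i)), monoid.mult = undefined, one = undefined,
     ring.zero = (\<lambda>i\<in>I. \<zero>\<^bsub>Q i\<^esub>), ring.add = (\<lambda>f g. \<lambda>i\<in>I. f i \<oplus>\<^bsub>Q i\<^esub> g i),
     module.smult = (\<lambda>r f. \<lambda>i\<in>I. r \<odot>\<^bsub>Q i\<^esub> f i)\<rparr>"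

definition direct_sum_module :: "'i set \<Rightarrow> ('i \<Rightarrow> ('r, 'm) module) \<Rightarrow> ('r, 'i \<Rightarrow> 'm) module"
  where "direct_sum_module I Q = (product_module I Q)
    \<lparr>carrier := {f \<in> \<Pi>\<^sub>E i\<in>I. carrier (Q i). finite {i\<in>I. f i \<noteq> \<zero>\<^bsub>Q i\<^esub>}}\<rparr>"

definition regular_right_module :: "('r, 'u) ring_scheme \<Rightarrow> ('r, 'r) module"
  where "regular_right_module R =
    \<lparr>carrier = carrier R, monoid.mult = undefined, one = undefined,
     ring.zero = \<zero>\<^bsub>R\<^esub>, ring.add = add R, module.smult = (\<lambda>r x. x \<otimes>\<^bsub>R\<^esub> r)\<rparr>"

definition free_right_module :: "('r, 'u) ring_scheme \<Rightarrow> 'x set \<Rightarrow> ('r, 'x \<Rightarrow> 'r) module"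
  where "free_right_module R Y = direct_sum_module Y (\<lambda>_. regular_right_module R)"

text \<open>
  The members of Add R whose elements are of type \<open>'s\<close>; the type argument is the type in which the
  index sets of the direct sums range.
\<close>

definition Add_class :: "'x itself \<Rightarrow> ('r, 'u) ring_scheme \<Rightarrow> ('r, 's) module set"
  where "Add_class ty R = {N. right_module R N \<and>
    (\<exists>Y :: 'x set. iso_to_direct_summand R N (free_right_module R Y))}"


section \<open>Tensor products\<close>

definition tensor_relations ::
    "('r, 'u) ring_scheme \<Rightarrow> ('r, 'm) module \<Rightarrow> ('r, 'q) module \<Rightarrow> ('m \<times> 'q \<Rightarrow>\<^sub>0 int) set"
  where "tensor_relations R M Q =
    {frag_of (x \<oplus>\<^bsub>M\<^esub> x', q) - frag_of (x, q) - frag_of (x', q) | x x' q.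
       x \<in> carrier M \<and> x' \<in> carrier M \<and> q \<in> carrier Q} \<union>
    {frag_of (x, q \<oplus>\<^bsub>Q\<^esub> q') - frag_of (x, q) - frag_of (x, q') | x q q'.
       x \<in> carrier M \<and> q \<in> carrier Q \<and> q' \<in> carrier Q} \<union>
    {frag_of (r \<odot>\<^bsub>M\<^esub> x, q) - frag_of (x, r \<odot>\<^bsub>Q\<^esub> q) | r x q.
       r \<in> carrier R \<and> x \<in> carrier M \<and> q \<in> carrier Q}"

definition tensor_kernel ::
    "('r, 'u) ring_scheme \<Rightarrow> ('r, 'm) module \<Rightarrow> ('r, 'q) module \<Rightarrow> ('m \<times> 'q \<Rightarrow>\<^sub>0 int) set"
  where "tensor_kernel R M Q =
    generate (free_Abelian_group (carrier M \<times> carrier Q)) (tensor_relations R M Q)"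

text \<open>
  The tensor product of a right module M and a left module Q, as an abelian group (in
  multiplicative notation).
\<close>

definition tensor ::
    "('r, 'u) ring_scheme \<Rightarrow> ('r, 'm) module \<Rightarrow> ('r, 'q) module \<Rightarrow> ('m \<times> 'q \<Rightarrow>\<^sub>0 int) set monoid"
  where "tensor R M Q =
    free_Abelian_group (carrier M \<times> carrier Q) Mod tensor_kernel R M Q"

text \<open>
  The homomorphism induced by \<open>f : M \<rightarrow> M'\<close> and \<open>g : Q \<rightarrow> Q'\<close>, which sends the class of (x, q) to
  the class of (f x, g q). Only the codomains \<open>M'\<close> and \<open>Q'\<close> enter as arguments.
\<close>

definition tensor_map ::
    "('r, 'u) ring_scheme \<Rightarrow> ('r, 'm1) module \<Rightarrow> ('r, 'q1) module \<Rightarrow> ('m \<Rightarrow> 'm1) \<Rightarrow> ('q \<Rightarrow> 'q1) \<Rightarrow>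
     ('m \<times> 'q \<Rightarrow>\<^sub>0 int) set \<Rightarrow> ('m1 \<times> 'q1 \<Rightarrow>\<^sub>0 int) set"
  where "tensor_map R M' Q' f g C =
    the_elem ((\<lambda>c. tensor_kernel R M' Q' #>\<^bsub>free_Abelian_group (carrier M' \<times> carrier Q')\<^esub>
                     frag_extend (\<lambda>(x, q). frag_of (f x, g q)) c) ` C)"


section \<open>Mittag-Leffler modules\<close>

definition tensor_product_map ::
    "('r, 'u) ring_scheme \<Rightarrow> ('r, 'm) module \<Rightarrow> 'i set \<Rightarrow> ('i \<Rightarrow> ('r, 'q) module) \<Rightarrow>
     ('m \<times> ('i \<Rightarrow> 'q) \<Rightarrow>\<^sub>0 int) set \<Rightarrow> ('i \<Rightarrow> ('m \<times> 'q \<Rightarrow>\<^sub>0 int) set)"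
  where "tensor_product_map R M I Q t = (\<lambda>i\<in>I. tensor_map R M (Q i) (\<lambda>x. x) (\<lambda>q. q i) t)"

text \<open>The type argument is the type in which the index sets of the families range.\<close>

definition mittag_leffler ::
    "'i itself \<Rightarrow> ('r, 'u) ring_scheme \<Rightarrow> ('r, 'q) module set \<Rightarrow> ('r, 'm) module \<Rightarrow> bool"
  where "mittag_leffler ty R \<Q> M \<longleftrightarrow> right_module R M \<and>
    (\<forall>(I :: 'i set) Q. (\<forall>i\<in>I. Q i \<in> \<Q>) \<longrightarrow>
       inj_on (tensor_product_map R M I Q) (carrier (tensor R M (product_module I Q))))"


section \<open>Tor\<close>

text \<open>
  \<open>Tor\<^sub>1(S, Y)\<close> is the homology in degree 1 of \<open>F \<otimes> Y\<close>, where F is the standard free resolution of S: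
  \<open>F\<^sub>0\<close> is free on the set of all elements of S, and each further \<open>F\<^sub>n\<^sub>+\<^sub>1\<close> is free on the set of all
  elements of the preceding kernel.
\<close>

definition free_eval :: "('r, 'm) module \<Rightarrow> 'm set \<Rightarrow> ('m \<Rightarrow> 'r) \<Rightarrow> 'm"
  where "free_eval M U f = gfinprod (add_monoid M) (\<lambda>u. f u \<odot>\<^bsub>M\<^esub> u) U"

definition res_F0 :: "('r, 'u) ring_scheme \<Rightarrow> ('r, 's) module \<Rightarrow> ('r, 's \<Rightarrow> 'r) module"
  where "res_F0 R S = free_right_module R (carrier S)"

definition res_K0 :: "('r, 'u) ring_scheme \<Rightarrow> ('r, 's) module \<Rightarrow> ('s \<Rightarrow> 'r) set"
  where "res_K0 R S = a_kernel (res_F0 R S) S (free_eval S (carrier S))"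

definition res_F1 :: "('r, 'u) ring_scheme \<Rightarrow> ('r, 's) module \<Rightarrow> ('r, ('s \<Rightarrow> 'r) \<Rightarrow> 'r) module"
  where "res_F1 R S = free_right_module R (res_K0 R S)"

definition res_d1 :: "('r, 'u) ring_scheme \<Rightarrow> ('r, 's) module \<Rightarrow> (('s \<Rightarrow> 'r) \<Rightarrow> 'r) \<Rightarrow> ('s \<Rightarrow> 'r)"
  where "res_d1 R S = free_eval (res_F0 R S) (res_K0 R S)"

definition res_K1 :: "('r, 'u) ring_scheme \<Rightarrow> ('r, 's) module \<Rightarrow> (('s \<Rightarrow> 'r) \<Rightarrow> 'r) set"
  where "res_K1 R S = a_kernel (res_F1 R S) (res_F0 R S) (res_d1 R S)"

definition res_F2 ::
    "('r, 'u) ring_scheme \<Rightarrow> ('r, 's) module \<Rightarrow> ('r, (('s \<Rightarrow> 'r) \<Rightarrow> 'r) \<Rightarrow> 'r) module"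
  where "res_F2 R S = free_right_module R (res_K1 R S)"

definition res_d2 ::
    "('r, 'u) ring_scheme \<Rightarrow> ('r, 's) module \<Rightarrow> ((('s \<Rightarrow> 'r) \<Rightarrow> 'r) \<Rightarrow> 'r) \<Rightarrow> (('s \<Rightarrow> 'r) \<Rightarrow> 'r)"
  where "res_d2 R S = free_eval (res_F1 R S) (res_K1 R S)"

definition Tor1 ::
    "('r, 'u) ring_scheme \<Rightarrow> ('r, 's) module \<Rightarrow> ('r, 'q) module \<Rightarrow>
     ((('s \<Rightarrow> 'r) \<Rightarrow> 'r) \<times> 'q \<Rightarrow>\<^sub>0 int) set set monoid"
  where "Tor1 R S Y =
    (let cycles = kernel (tensor R (res_F1 R S) Y) (tensor R (res_F0 R S) Y)
                    (tensor_map R (res_F0 R S) Y (res_d1 R S) (\<lambda>x. x));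
         boundaries = tensor_map R (res_F1 R S) Y (res_d2 R S) (\<lambda>x. x) `
                        carrier (tensor R (res_F2 R S) Y)
     in (tensor R (res_F1 R S) Y)\<lparr>carrier := cycles\<rparr> Mod boundaries)"

definition Tor1_perp :: "('r, 'u) ring_scheme \<Rightarrow> ('r, 's) module set \<Rightarrow> ('r, 'q) module set"
  where "Tor1_perp R \<S> = {Y. left_module R Y \<and> (\<forall>S\<in>\<S>. trivial_group (Tor1 R S Y))}"


section \<open>Filtered modules\<close>

text \<open>
  An ordinal \<open>\<tau>\<close> is represented by an element of a well-ordered type \<open>'o\<close>, standing for the order
  type of the elements below it; the type argument is this \<open>'o\<close>. Zero does not count as a limit ordinal.
\<close>

definition ord_succ :: "'o :: wellorder \<Rightarrow> 'o"
  where "ord_succ \<alpha> = (LEAST \<beta>. \<alpha> < \<beta>)"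

definition ord_limit :: "'o :: wellorder \<Rightarrow> bool"
  where "ord_limit \<alpha> \<longleftrightarrow> (\<exists>\<beta>. \<beta> < \<alpha>) \<and> (\<forall>\<beta><\<alpha>. ord_succ \<beta> < \<alpha>)"

definition filtered ::
    "'o :: wellorder itself \<Rightarrow> ('r, 'u) ring_scheme \<Rightarrow> ('r, 's) module set \<Rightarrow> ('r, 'm) module \<Rightarrow> bool"
  where "filtered ty R \<C> M \<longleftrightarrow> right_module R M \<and>
    (\<exists>(\<tau> :: 'o) N.
       (\<forall>\<alpha>\<le>\<tau>. submodule (N \<alpha>) R M) \<and>
       (\<forall>\<alpha> \<beta>. \<alpha> \<le> \<beta> \<and> \<beta> \<le> \<tau> \<longrightarrow> N \<alpha> \<subseteq> N \<beta>) \<and>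
       N (LEAST \<alpha>. True) = {\<zero>\<^bsub>M\<^esub>} \<and>
       N \<tau> = carrier M \<and>
       (\<forall>\<alpha>\<le>\<tau>. ord_limit \<alpha> \<longrightarrow> N \<alpha> = (\<Union>\<beta>\<in>{..<\<alpha>}. N \<beta>)) \<and>
       (\<forall>\<alpha><\<tau>. \<exists>C\<in>\<C>. mod_iso R (quotient_module (M\<lparr>carrier := N (ord_succ \<alpha>)\<rparr>) (N \<alpha>)) C))"

end

theory Submission
  imports Defs
begin

text \<open>
  For an extension of A by C inside a module B with Tor vanishing on C, tensoring with a module Q of
  the class keeps A \<open>\<rightarrow>\<close> B injective. The Mittag-Leffler property then passes from A and C to B: an
  element killed by all projections dies over C, hence comes from A, where it is again killed by all
  projections. The injectivity also lets it pass through unions of chains, since a relation over the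
  union already holds at some stage. Free modules are Mittag-Leffler because their coordinates
  commute with products, and the property is inherited by retracts.

  Tensors are handled as formal sums c, and c vanishes in \<open>M \<otimes> Q\<close> iff it lies in the kernel of the
  presentation that defines the tensor product.
\<close>

section \<open>Modules and homomorphisms\<close>

text \<open>Two features of the hypotheses shape the argument. Tor is assumed to vanish on each
  member of the class, and this does not give vanishing on products, so injectivity of A \<otimes> Q
  \<rightarrow> B \<otimes> Q is invoked one factor at a time; the return to the product is made by
  the Mittag-Leffler property of the smaller module. Moreover \<open>Tor1\<close> is the homology of
  one particular resolution, so its vanishing has to be carried over to an arbitrary extension of C
  by A. No long exact sequence is set up for this: triviality of \<open>Tor1\<close> gives
  injectivity for the inclusion of \<open>res_K0\<close> in \<open>res_F0\<close>, and a lift of the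
  augmentation \<open>res_F0\<close> \<rightarrow> C to B transports it to A and B. A projective C
  goes through the same transport with C as its own presentation, a section of B \<rightarrow> C as
  the lift, and zero as the kernel. Formal sums suit this because a submodule differs from its
  ambient module in the carrier only: a sum over A is literally a sum over B, and merely the
  available relations change. Injectivity thus becomes an implication between two memberships of the
  same c.\<close>

lemma (in abelian_group) diff_add_diff_cancel:
  assumes "x \<in> carrier G" "y \<in> carrier G" "z \<in> carrier G"
  shows "(x \<ominus> y) \<oplus> (y \<ominus> z) = x \<ominus> z"
  using assms by (simp add: a_minus_def a_assoc r_neg1)

lemma (in abelian_group) diff_add_diff:
  assumes "x \<in> carrier G" "y \<in> carrier G" "z \<in> carrier G" "w \<in> carrier G"
  shows "(x \<ominus> y) \<oplus> (z \<ominus> w) = (x \<oplus> z) \<ominus> (y \<oplus> w)"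
  using assms by (simp add: a_minus_def minus_add a_ac)

lemma (in abelian_group) diff_self: "x \<in> carrier G \<Longrightarrow> x \<ominus> x = \<zero>"
  by (simp add: a_minus_def r_neg)

lemma (in right_module) smult_zero [simp]:
  assumes "r \<in> carrier R" shows "r \<odot>\<^bsub>M\<^esub> \<zero>\<^bsub>M\<^esub> = \<zero>\<^bsub>M\<^esub>"
proof -
  have "r \<odot>\<^bsub>M\<^esub> \<zero>\<^bsub>M\<^esub> \<oplus>\<^bsub>M\<^esub> r \<odot>\<^bsub>M\<^esub> \<zero>\<^bsub>M\<^esub> = r \<odot>\<^bsub>M\<^esub> \<zero>\<^bsub>M\<^esub>"
    using smult_r_distr[OF assms M.zero_closed M.zero_closed] by simp
  then show ?thesis
    using smult_closed[OF assms M.zero_closed] by (metis M.add.r_cancel_one)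
qed

lemma (in right_module) zero_smult [simp]:
  assumes "x \<in> carrier M" shows "\<zero>\<^bsub>R\<^esub> \<odot>\<^bsub>M\<^esub> x = \<zero>\<^bsub>M\<^esub>"
proof -
  have "\<zero>\<^bsub>R\<^esub> \<odot>\<^bsub>M\<^esub> x \<oplus>\<^bsub>M\<^esub> \<zero>\<^bsub>R\<^esub> \<odot>\<^bsub>M\<^esub> x = \<zero>\<^bsub>R\<^esub> \<odot>\<^bsub>M\<^esub> x"
    using smult_l_distr[OF R.zero_closed R.zero_closed assms] by simp
  then show ?thesis
    using smult_closed[OF R.zero_closed assms] by (metis M.add.r_cancel_one)
qed

lemma (in right_module) smult_minus:
  assumes "r \<in> carrier R" "x \<in> carrier M"
  shows "r \<odot>\<^bsub>M\<^esub> (\<ominus>\<^bsub>M\<^esub> x) = \<ominus>\<^bsub>M\<^esub> (r \<odot>\<^bsub>M\<^esub> x)"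
proof -
  have "r \<odot>\<^bsub>M\<^esub> (\<ominus>\<^bsub>M\<^esub> x) \<oplus>\<^bsub>M\<^esub> r \<odot>\<^bsub>M\<^esub> x = \<zero>\<^bsub>M\<^esub>"
    using smult_r_distr[OF assms(1) M.a_inv_closed[OF assms(2)] assms(2)] assms by (simp add: M.l_neg)
  then show ?thesis
    using M.minus_equality smult_closed assms by simp
qed

lemma (in right_module) smult_diff:
  assumes "r \<in> carrier R" "x \<in> carrier M" "y \<in> carrier M"
  shows "r \<odot>\<^bsub>M\<^esub> (x \<ominus>\<^bsub>M\<^esub> y) = r \<odot>\<^bsub>M\<^esub> x \<ominus>\<^bsub>M\<^esub> r \<odot>\<^bsub>M\<^esub> y"
  using assms by (simp add: a_minus_def smult_r_distr smult_minus)

lemma (in left_module) zero_smult [simp]: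
  assumes "x \<in> carrier M" shows "\<zero>\<^bsub>R\<^esub> \<odot>\<^bsub>M\<^esub> x = \<zero>\<^bsub>M\<^esub>"
proof -
  have "\<zero>\<^bsub>R\<^esub> \<odot>\<^bsub>M\<^esub> x \<oplus>\<^bsub>M\<^esub> \<zero>\<^bsub>R\<^esub> \<odot>\<^bsub>M\<^esub> x = \<zero>\<^bsub>R\<^esub> \<odot>\<^bsub>M\<^esub> x"
    using smult_l_distr[OF R.zero_closed R.zero_closed assms] by simp
  then show ?thesis
    using smult_closed[OF R.zero_closed assms] by (metis M.add.r_cancel_one)
qed

lemma right_module_ring: "right_module R M \<Longrightarrow> ring R"
  by (rule right_module.axioms)

lemma right_module_abelian_group: "right_module R M \<Longrightarrow> abelian_group M"
  by (rule right_module.axioms)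

lemma right_module_minus_zero: "right_module R M \<Longrightarrow> \<ominus>\<^bsub>M\<^esub> \<zero>\<^bsub>M\<^esub> = \<zero>\<^bsub>M\<^esub>"
  by (metis abelian_group.minus_equality abelian_group.axioms(1) abelian_monoid.l_zero
      abelian_monoid.zero_closed right_module_abelian_group)

lemma left_module_abelian_group: "left_module R M \<Longrightarrow> abelian_group M"
  by (rule left_module.axioms)

lemma submodule_subset: "submodule A R M \<Longrightarrow> A \<subseteq> carrier M"
  using subgroup.subset submodule.axioms(1) by fastforce

lemma submodule_zero: "submodule A R M \<Longrightarrow> \<zero>\<^bsub>M\<^esub> \<in> A"
  using subgroup.one_closed submodule.axioms(1) by fastforce

lemma submodule_add: "submodule A R M \<Longrightarrow> x \<in> A \<Longrightarrow> y \<in> A \<Longrightarrow> x \<oplus>\<^bsub>M\<^esub> y \<in> A"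
  using subgroup.m_closed submodule.axioms(1) by fastforce

lemma submodule_minus: "submodule A R M \<Longrightarrow> x \<in> A \<Longrightarrow> \<ominus>\<^bsub>M\<^esub> x \<in> A"
  unfolding a_inv_def by (rule subgroup.m_inv_closed, rule submodule.axioms(1))

lemma submodule_diff: "submodule A R M \<Longrightarrow> x \<in> A \<Longrightarrow> y \<in> A \<Longrightarrow> x \<ominus>\<^bsub>M\<^esub> y \<in> A"
  by (simp add: a_minus_def submodule_add submodule_minus)

lemma submodule_smult: "submodule A R M \<Longrightarrow> r \<in> carrier R \<Longrightarrow> x \<in> A \<Longrightarrow> r \<odot>\<^bsub>M\<^esub> x \<in> A"
  by (rule submodule.smult_closed)

text \<open>The library's \<open>submodule\<close> speaks only of an additive subgroup closed under
  the scalar action, so it is meaningful for right modules over any ring.\<close>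

lemma (in right_module) submoduleI:
  assumes "H \<subseteq> carrier M" "\<zero>\<^bsub>M\<^esub> \<in> H"
    and "\<And>a b. \<lbrakk>a \<in> H; b \<in> H\<rbrakk> \<Longrightarrow> a \<oplus>\<^bsub>M\<^esub> b \<in> H"
    and "\<And>a. a \<in> H \<Longrightarrow> \<ominus>\<^bsub>M\<^esub> a \<in> H"
    and "\<And>a x. \<lbrakk>a \<in> carrier R; x \<in> H\<rbrakk> \<Longrightarrow> a \<odot>\<^bsub>M\<^esub> x \<in> H"
  shows "submodule H R M"
  using assms by (intro submodule.intro subgroup.intro) (simp_all add: submodule_axioms_def a_inv_def)

lemma (in right_module) right_module_submodule:
  assumes "submodule A R M" shows "right_module R (M\<lparr>carrier := A\<rparr>)"
proof -
  have "abelian_group (M\<lparr>carrier := A\<rparr>)"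
    using assms submodule_subset[OF assms]
    by (intro abelian_groupI)
      (auto simp: submodule_add submodule_zero subset_iff M.a_ac
        intro!: bexI[OF _ submodule_minus[OF assms]] M.r_neg)
  moreover have "A \<subseteq> carrier M" by (rule submodule_subset[OF assms])
  ultimately show ?thesis
    using submodule_smult[OF assms] R.ring_axioms smult_l_distr smult_r_distr smult_assoc smult_one
    by (auto intro!: right_module.intro right_module_axioms.intro simp: subset_iff)
qed

lemma mod_homI:
  assumes "\<And>x. x \<in> carrier M \<Longrightarrow> f x \<in> carrier N"
    and "\<And>x y. x \<in> carrier M \<Longrightarrow> y \<in> carrier M \<Longrightarrow> f (x \<oplus>\<^bsub>M\<^esub> y) = f x \<oplus>\<^bsub>N\<^esub> f y"
    and "\<And>r x. r \<in> carrier R \<Longrightarrow> x \<in> carrier M \<Longrightarrow> f (r \<odot>\<^bsub>M\<^esub> x) = r \<odot>\<^bsub>N\<^esub> f x"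
  shows "f \<in> mod_hom R M N"
  using assms by (simp add: mod_hom_def)

lemma mod_hom_closed: "f \<in> mod_hom R M N \<Longrightarrow> x \<in> carrier M \<Longrightarrow> f x \<in> carrier N"
  by (auto simp: mod_hom_def)

lemma mod_hom_add:
  "f \<in> mod_hom R M N \<Longrightarrow> x \<in> carrier M \<Longrightarrow> y \<in> carrier M \<Longrightarrow> f (x \<oplus>\<^bsub>M\<^esub> y) = f x \<oplus>\<^bsub>N\<^esub> f y"
  by (auto simp: mod_hom_def)

lemma mod_hom_smult:
  "f \<in> mod_hom R M N \<Longrightarrow> r \<in> carrier R \<Longrightarrow> x \<in> carrier M \<Longrightarrow> f (r \<odot>\<^bsub>M\<^esub> x) = r \<odot>\<^bsub>N\<^esub> f x"
  by (auto simp: mod_hom_def)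

lemma mod_hom_group_hom:
  assumes "f \<in> mod_hom R M N" "abelian_group M" "abelian_group N"
  shows "group_hom (add_monoid M) (add_monoid N) f"
  using assms
  by (auto simp: group_hom_def group_hom_axioms_def hom_def mod_hom_def abelian_group.a_group)

lemma mod_hom_zero:
  assumes "f \<in> mod_hom R M N" "abelian_group M" "abelian_group N"
  shows "f \<zero>\<^bsub>M\<^esub> = \<zero>\<^bsub>N\<^esub>"
  using group_hom.hom_one[OF mod_hom_group_hom[OF assms]] by simp

lemma mod_hom_minus:
  assumes "f \<in> mod_hom R M N" "abelian_group M" "abelian_group N" "x \<in> carrier M"
  shows "f (\<ominus>\<^bsub>M\<^esub> x) = \<ominus>\<^bsub>N\<^esub> f x"
  using group_hom.hom_inv[OF mod_hom_group_hom[OF assms(1-3)]] assms(4) by (simp add: a_inv_def)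

lemma mod_hom_diff:
  assumes "f \<in> mod_hom R M N" "abelian_group M" "abelian_group N" "x \<in> carrier M" "y \<in> carrier M"
  shows "f (x \<ominus>\<^bsub>M\<^esub> y) = f x \<ominus>\<^bsub>N\<^esub> f y"
  using assms by (simp add: a_minus_def mod_hom_add mod_hom_minus[OF assms(1-3)]
      abelian_group.a_inv_closed)

lemma mod_hom_id: "(\<lambda>x. x) \<in> mod_hom R M M"
  by (simp add: mod_hom_def)

lemma mod_hom_compose:
  "f \<in> mod_hom R M N \<Longrightarrow> g \<in> mod_hom R N L \<Longrightarrow> (\<lambda>x. g (f x)) \<in> mod_hom R M L"
  by (auto simp: mod_hom_def Pi_def)

lemma mod_hom_inclusion: "A \<subseteq> carrier M \<Longrightarrow> (\<lambda>x. x) \<in> mod_hom R (M\<lparr>carrier := A\<rparr>) M"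
  by (auto simp: mod_hom_def)

lemma mod_hom_into:
  "f \<in> mod_hom R M N \<Longrightarrow> f ` carrier M \<subseteq> A \<Longrightarrow> f \<in> mod_hom R M (N\<lparr>carrier := A\<rparr>)"
  by (auto simp: mod_hom_def)

text \<open>Covers kernels, with A the zero submodule, as well as pullbacks of a submodule along a
  presentation.\<close>

lemma submodule_vimage:
  assumes f: "f \<in> mod_hom R M N" and M: "right_module R M" and N: "right_module R N"
    and A: "submodule A R N"
  shows "submodule {x \<in> carrier M. f x \<in> A} R M"
proof -
  interpret M: right_module R M by (rule M)
  interpret N: right_module R N by (rule N)
  show ?thesis
    using A by (intro M.submoduleI)
     (auto simp: mod_hom_add[OF f] mod_hom_smult[OF f] mod_hom_minus[OF f M.M.abelian_group_axioms N.M.abelian_group_axioms] mod_hom_zero[OF f M.M.abelian_group_axioms N.M.abelian_group_axioms] submodule_zero submodule_add submodule_minus submodule_smult M.smult_closed)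
qed

section \<open>Free right modules\<close>

lemma right_module_regular:
  assumes "ring R" shows "right_module R (regular_right_module R)"
proof -
  interpret ring R by fact
  have "abelian_group (regular_right_module R)"
    by (rule abelian_groupI) (auto simp: regular_right_module_def a_ac intro: l_neg)
  then show ?thesis
    by (auto intro!: right_module.intro right_module_axioms.intro assms
        simp: regular_right_module_def l_distr r_distr m_assoc)
qed

section \<open>Products and direct sums of modules\<close>

lemma abelian_group_product:
  assumes "\<And>i. i \<in> I \<Longrightarrow> abelian_group (Q i)"
  shows "abelian_group (product_module I Q)"
proof (rule abelian_groupI)
  let ?P = "product_module I Q"
  have m: "abelian_monoid (Q i)" if "i \<in> I" for i
    using assms that abelian_group.axioms(1) by blast
  have P: "x i \<in> carrier (Q i)" if "x \<in> carrier ?P" "i \<in> I" for x i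
    using that by (auto simp: product_module_def)
  show "\<zero>\<^bsub>?P\<^esub> \<in> carrier ?P"
    by (simp add: product_module_def abelian_monoid.zero_closed[OF m])
  fix x assume x: "x \<in> carrier ?P"
  show "\<zero>\<^bsub>?P\<^esub> \<oplus>\<^bsub>?P\<^esub> x = x"
    using x abelian_monoid.l_zero[OF m P[OF x]] by (auto simp: product_module_def PiE_iff extensional_def)
  have "(\<lambda>i\<in>I. \<ominus>\<^bsub>Q i\<^esub> x i) \<in> carrier ?P"
    by (simp add: product_module_def abelian_group.a_inv_closed[OF assms P[OF x]])
  moreover have "(\<lambda>i\<in>I. \<ominus>\<^bsub>Q i\<^esub> x i) \<oplus>\<^bsub>?P\<^esub> x = \<zero>\<^bsub>?P\<^esub>"
    using abelian_group.l_neg[OF assms P[OF x]] by (simp add: product_module_def cong: restrict_cong)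
  ultimately show "\<exists>y\<in>carrier ?P. y \<oplus>\<^bsub>?P\<^esub> x = \<zero>\<^bsub>?P\<^esub>" by blast
  fix y assume y: "y \<in> carrier ?P"
  show "x \<oplus>\<^bsub>?P\<^esub> y \<in> carrier ?P"
    using abelian_monoid.a_closed[OF m P[OF x] P[OF y]] by (simp add: product_module_def)
  show "x \<oplus>\<^bsub>?P\<^esub> y = y \<oplus>\<^bsub>?P\<^esub> x"
    using abelian_monoid.a_comm[OF m P[OF x] P[OF y]]
    by (simp add: product_module_def cong: restrict_cong)
  fix z assume z: "z \<in> carrier ?P"
  show "x \<oplus>\<^bsub>?P\<^esub> y \<oplus>\<^bsub>?P\<^esub> z = x \<oplus>\<^bsub>?P\<^esub> (y \<oplus>\<^bsub>?P\<^esub> z)"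
    using abelian_monoid.a_assoc[OF m P[OF x] P[OF y] P[OF z]]
    by (simp add: product_module_def cong: restrict_cong)
qed

lemma left_module_product:
  assumes "ring R" and "\<And>i. i \<in> I \<Longrightarrow> left_module R (Q i)"
  shows "left_module R (product_module I Q)"
proof (intro left_module.intro left_module_axioms.intro abelian_group_product)
  note Q = assms(2)
  let ?P = "product_module I Q"
  fix r s x y assume r: "r \<in> carrier R" and s: "s \<in> carrier R"
    and x: "x \<in> carrier ?P" and y: "y \<in> carrier ?P"
  have xi: "x i \<in> carrier (Q i)" "y i \<in> carrier (Q i)" if "i \<in> I" for i
    using x y that by (auto simp: product_module_def)
  show "r \<odot>\<^bsub>?P\<^esub> x \<in> carrier ?P"
    using left_module.smult_closed[OF Q r xi(1)] by (simp add: product_module_def)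
  show "(r \<oplus>\<^bsub>R\<^esub> s) \<odot>\<^bsub>?P\<^esub> x = r \<odot>\<^bsub>?P\<^esub> x \<oplus>\<^bsub>?P\<^esub> s \<odot>\<^bsub>?P\<^esub> x"
    using left_module.smult_l_distr[OF Q r s xi(1)]
    by (simp add: product_module_def cong: restrict_cong)
  show "r \<odot>\<^bsub>?P\<^esub> (x \<oplus>\<^bsub>?P\<^esub> y) = r \<odot>\<^bsub>?P\<^esub> x \<oplus>\<^bsub>?P\<^esub> r \<odot>\<^bsub>?P\<^esub> y"
    using left_module.smult_r_distr[OF Q r xi]
    by (simp add: product_module_def cong: restrict_cong)
  show "(r \<otimes>\<^bsub>R\<^esub> s) \<odot>\<^bsub>?P\<^esub> x = r \<odot>\<^bsub>?P\<^esub> (s \<odot>\<^bsub>?P\<^esub> x)"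
    using left_module.smult_assoc[OF Q r s xi(1)]
    by (simp add: product_module_def cong: restrict_cong)
next
  fix x assume x: "x \<in> carrier (product_module I Q)"
  then have xi: "x i \<in> carrier (Q i)" if "i \<in> I" for i
    using that by (auto simp: product_module_def)
  show "\<one>\<^bsub>R\<^esub> \<odot>\<^bsub>product_module I Q\<^esub> x = x"
    using x left_module.smult_one[OF assms(2) xi]
    by (auto simp: product_module_def PiE_iff extensional_def)
qed (use assms in \<open>auto intro: left_module_abelian_group\<close>)

lemma right_module_product:
  assumes "ring R" and "\<And>i. i \<in> I \<Longrightarrow> right_module R (Q i)"
  shows "right_module R (product_module I Q)"
proof (intro right_module.intro right_module_axioms.intro abelian_group_product)
  note Q = assms(2)
  let ?P = "product_module I Q"
  fix r s x y assume r: "r \<in> carrier R" and s: "s \<in> carrier R"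
    and x: "x \<in> carrier ?P" and y: "y \<in> carrier ?P"
  have xi: "x i \<in> carrier (Q i)" "y i \<in> carrier (Q i)" if "i \<in> I" for i
    using x y that by (auto simp: product_module_def)
  show "r \<odot>\<^bsub>?P\<^esub> x \<in> carrier ?P"
    using right_module.smult_closed[OF Q r xi(1)] by (simp add: product_module_def)
  show "(r \<oplus>\<^bsub>R\<^esub> s) \<odot>\<^bsub>?P\<^esub> x = r \<odot>\<^bsub>?P\<^esub> x \<oplus>\<^bsub>?P\<^esub> s \<odot>\<^bsub>?P\<^esub> x"
    using right_module.smult_l_distr[OF Q r s xi(1)]
    by (simp add: product_module_def cong: restrict_cong)
  show "r \<odot>\<^bsub>?P\<^esub> (x \<oplus>\<^bsub>?P\<^esub> y) = r \<odot>\<^bsub>?P\<^esub> x \<oplus>\<^bsub>?P\<^esub> r \<odot>\<^bsub>?P\<^esub> y"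
    using right_module.smult_r_distr[OF Q r xi]
    by (simp add: product_module_def cong: restrict_cong)
  show "(r \<otimes>\<^bsub>R\<^esub> s) \<odot>\<^bsub>?P\<^esub> x = s \<odot>\<^bsub>?P\<^esub> (r \<odot>\<^bsub>?P\<^esub> x)"
    using right_module.smult_assoc[OF Q r s xi(1)]
    by (simp add: product_module_def cong: restrict_cong)
next
  fix x assume x: "x \<in> carrier (product_module I Q)"
  then have xi: "x i \<in> carrier (Q i)" if "i \<in> I" for i
    using that by (auto simp: product_module_def)
  show "\<one>\<^bsub>R\<^esub> \<odot>\<^bsub>product_module I Q\<^esub> x = x"
    using x right_module.smult_one[OF assms(2) xi]
    by (auto simp: product_module_def PiE_iff extensional_def)
qed (use assms in \<open>auto intro: right_module_abelian_group\<close>)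

text \<open>The record of the product fixes zero and addition only; the additive inverse is derived
  from them and has to be identified before supports of negatives can be compared.\<close>

lemma product_module_minus:
  assumes "\<And>i. i \<in> I \<Longrightarrow> abelian_group (Q i)" "f \<in> carrier (product_module I Q)"
  shows "\<ominus>\<^bsub>product_module I Q\<^esub> f = (\<lambda>i\<in>I. \<ominus>\<^bsub>Q i\<^esub> f i)"
proof -
  interpret abelian_group "product_module I Q" by (rule abelian_group_product) (rule assms)
  have fi: "f i \<in> carrier (Q i)" if "i \<in> I" for i
    using assms(2) that by (auto simp: product_module_def)
  show ?thesis
  proof (rule minus_equality)
    show "(\<lambda>i\<in>I. \<ominus>\<^bsub>Q i\<^esub> f i) \<oplus>\<^bsub>product_module I Q\<^esub> f = \<zero>\<^bsub>product_module I Q\<^esub>"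
      using abelian_group.l_neg[OF assms(1) fi] by (simp add: product_module_def cong: restrict_cong)
    show "(\<lambda>i\<in>I. \<ominus>\<^bsub>Q i\<^esub> f i) \<in> carrier (product_module I Q)"
      by (simp add: product_module_def abelian_group.a_inv_closed[OF assms(1) fi])
  qed (rule assms)
qed

text \<open>A direct sum differs from the product in its carrier only, so it suffices that
  finiteness of the support survives the operations.\<close>

lemma right_module_direct_sum:
  assumes "ring R" and Q: "\<And>i. i \<in> I \<Longrightarrow> right_module R (Q i)"
  shows "right_module R (direct_sum_module I Q)"
proof -
  interpret P: right_module R "product_module I Q" by (rule right_module_product) (use assms in auto)
  have ab: "abelian_group (Q i)" if "i \<in> I" for i
    using Q[OF that] by (rule right_module_abelian_group)
  have "submodule (carrier (direct_sum_module I Q)) R (product_module I Q)"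
  proof (rule P.submoduleI)
    fix f g assume "f \<in> carrier (direct_sum_module I Q)" "g \<in> carrier (direct_sum_module I Q)"
    then have "f \<in> carrier (product_module I Q)" "g \<in> carrier (product_module I Q)"
      and fin: "finite ({i\<in>I. f i \<noteq> \<zero>\<^bsub>Q i\<^esub>} \<union> {i\<in>I. g i \<noteq> \<zero>\<^bsub>Q i\<^esub>})"
      by (auto simp: direct_sum_module_def product_module_def)
    moreover have "finite {i\<in>I. (f \<oplus>\<^bsub>product_module I Q\<^esub> g) i \<noteq> \<zero>\<^bsub>Q i\<^esub>}"
      by (rule finite_subset[OF _ fin])
        (use abelian_monoid.l_zero[OF abelian_group.axioms(1)[OF ab]]
          abelian_monoid.zero_closed[OF abelian_group.axioms(1)[OF ab]]
         in \<open>auto simp: product_module_def\<close>)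
    ultimately show "f \<oplus>\<^bsub>product_module I Q\<^esub> g \<in> carrier (direct_sum_module I Q)"
      using P.M.a_closed[of f g] by (simp add: direct_sum_module_def product_module_def)
  next
    fix f assume "f \<in> carrier (direct_sum_module I Q)"
    then have f: "f \<in> carrier (product_module I Q)" and fin: "finite {i\<in>I. f i \<noteq> \<zero>\<^bsub>Q i\<^esub>}"
      by (auto simp: direct_sum_module_def product_module_def)
    have "finite {i\<in>I. (\<ominus>\<^bsub>product_module I Q\<^esub> f) i \<noteq> \<zero>\<^bsub>Q i\<^esub>}"
      by (rule finite_subset[OF _ fin])
        (use right_module_minus_zero[OF Q] in \<open>auto simp: product_module_minus[OF ab f]\<close>)
    then show "\<ominus>\<^bsub>product_module I Q\<^esub> f \<in> carrier (direct_sum_module I Q)"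
      using P.M.a_inv_closed[OF f] by (simp add: direct_sum_module_def product_module_def)
    fix r assume r: "r \<in> carrier R"
    have "finite {i\<in>I. (r \<odot>\<^bsub>product_module I Q\<^esub> f) i \<noteq> \<zero>\<^bsub>Q i\<^esub>}"
      by (rule finite_subset[OF _ fin])
        (use right_module.smult_zero[OF Q r] in \<open>auto simp: product_module_def\<close>)
    then show "r \<odot>\<^bsub>product_module I Q\<^esub> f \<in> carrier (direct_sum_module I Q)"
      using P.smult_closed[OF r f] by (simp add: direct_sum_module_def product_module_def)
  qed (use P.M.zero_closed in \<open>auto simp: direct_sum_module_def product_module_def\<close>)
  from P.right_module_submodule[OF this] show ?thesis
    by (simp add: direct_sum_module_def)
qed

lemma right_module_free: "ring R \<Longrightarrow> right_module R (free_right_module R Y)"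
  unfolding free_right_module_def by (intro right_module_direct_sum right_module_regular)

lemma carrier_free:
  "carrier (free_right_module R Y) = {f \<in> Y \<rightarrow>\<^sub>E carrier R. finite {y\<in>Y. f y \<noteq> \<zero>\<^bsub>R\<^esub>}}"
  by (simp add: free_right_module_def direct_sum_module_def regular_right_module_def)

lemma add_free: "f \<oplus>\<^bsub>free_right_module R Y\<^esub> g = (\<lambda>y\<in>Y. f y \<oplus>\<^bsub>R\<^esub> g y)"
  by (simp add: free_right_module_def direct_sum_module_def product_module_def regular_right_module_def)

lemma smult_free: "r \<odot>\<^bsub>free_right_module R Y\<^esub> f = (\<lambda>y\<in>Y. f y \<otimes>\<^bsub>R\<^esub> r)"
  by (simp add: free_right_module_def direct_sum_module_def product_module_def regular_right_module_def)

lemma zero_free: "\<zero>\<^bsub>free_right_module R Y\<^esub> = (\<lambda>y\<in>Y. \<zero>\<^bsub>R\<^esub>)"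
  by (simp add: free_right_module_def direct_sum_module_def product_module_def regular_right_module_def)

section \<open>Bases and the universal property of free modules\<close>

definition free_basis :: "('r, 'u) ring_scheme \<Rightarrow> 'x set \<Rightarrow> 'x \<Rightarrow> ('x \<Rightarrow> 'r)"
  where "free_basis R Y y = (\<lambda>z\<in>Y. if z = y then \<one>\<^bsub>R\<^esub> else \<zero>\<^bsub>R\<^esub>)"

text \<open>No membership of y in Y is asked for: outside Y the function is the zero element. This
  allows choices indexed by the whole type later on.\<close>

lemma free_basis_closed:
  assumes "ring R" shows "free_basis R Y y \<in> carrier (free_right_module R Y)"
proof -
  interpret ring R by fact
  have "finite {z\<in>Y. free_basis R Y y z \<noteq> \<zero>\<^bsub>R\<^esub>}"
    by (rule finite_subset[of _ "{y}"]) (auto simp: free_basis_def)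
  then show ?thesis by (auto simp: carrier_free free_basis_def)
qed

text \<open>Extends \<open>free_eval\<close> from the identity to an arbitrary family b, so that the
  resolution maps and all lifts are instances of one construction. \<open>gfinprod\<close> is the
  product over the support, which is what an infinite Y with finitely supported f requires.\<close>

definition free_lift :: "('r, 'm) module \<Rightarrow> 'x set \<Rightarrow> ('x \<Rightarrow> 'm) \<Rightarrow> ('x \<Rightarrow> 'r) \<Rightarrow> 'm"
  where "free_lift M Y b f = gfinprod (add_monoid M) (\<lambda>y. f y \<odot>\<^bsub>M\<^esub> b y) Y"

lemma free_eval_eq_free_lift: "free_eval M U = free_lift M U (\<lambda>u. u)"
  by (simp add: fun_eq_iff free_eval_def free_lift_def)

lemma (in comm_monoid) gfinprod_singleton:
  assumes "f y \<in> carrier G" shows "gfinprod G f {y} = f y"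
  using gfinprod_insert[of "{}" f y] assms by (simp add: gfinprod_def)

text \<open>The homomorphism may send further terms to the unit, so the two sides can have different
  supports. Both are therefore computed over the support of f, where the ordinary finite product
  applies.\<close>

lemma hom_gfinprod:
  assumes G: "comm_group G" and H: "comm_group H" and h: "h \<in> hom G H"
    and f: "f \<in> A \<rightarrow> carrier G" and fin: "finite {x \<in> A. f x \<noteq> \<one>\<^bsub>G\<^esub>}"
  shows "h (gfinprod G f A) = gfinprod H (\<lambda>x. h (f x)) A"
proof -
  interpret G: comm_group G by (rule G)
  interpret H: comm_group H by (rule H)
  interpret h: group_hom G H h using h by unfold_locales
  let ?A = "{x \<in> A. f x \<noteq> \<one>\<^bsub>G\<^esub>}"
  have *: "h (finprod G f B) = finprod H (\<lambda>x. h (f x)) B" if "finite B" "B \<subseteq> A" for B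
    using that
  proof (induction B)
    case (insert b B)
    then have "f \<in> B \<rightarrow> carrier G" "f b \<in> carrier G" using f by auto
    moreover from this have "(\<lambda>x. h (f x)) \<in> B \<rightarrow> carrier H" by (auto intro!: h.hom_closed)
    ultimately show ?case using insert by (simp add: G.finprod_closed)
  qed auto
  have "gfinprod H (\<lambda>x. h (f x)) A = gfinprod H (\<lambda>x. h (f x)) ?A"
    using f by (intro H.gfinprod_mono_neutral_cong_right) (auto intro!: h.hom_closed)
  also have "\<dots> = finprod H (\<lambda>x. h (f x)) ?A"
    using f by (intro H.gfinprod_eq_finprod fin) (auto intro!: h.hom_closed)
  finally show ?thesis using * fin by (simp add: gfinprod_def)
qed

context
  fixes R :: "('r, 'u) ring_scheme" and M :: "('r, 'm) module" and Y :: "'x set" and b :: "'x \<Rightarrow> 'm"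
  assumes M: "right_module R M" and b: "\<And>y. y \<in> Y \<Longrightarrow> b y \<in> carrier M"
begin

interpretation M: right_module R M by (rule M)

lemma free_lift_terms:
  assumes "f \<in> carrier (free_right_module R Y)"
  shows "(\<lambda>y. f y \<odot>\<^bsub>M\<^esub> b y) \<in> Y \<rightarrow> carrier M"
    and "finite {y\<in>Y. f y \<odot>\<^bsub>M\<^esub> b y \<noteq> \<zero>\<^bsub>M\<^esub>}"
proof -
  show "(\<lambda>y. f y \<odot>\<^bsub>M\<^esub> b y) \<in> Y \<rightarrow> carrier M"
    using assms b by (auto simp: carrier_free PiE_iff intro!: M.smult_closed)
  have "finite {y\<in>Y. f y \<noteq> \<zero>\<^bsub>R\<^esub>}" using assms by (simp add: carrier_free)
  then show "finite {y\<in>Y. f y \<odot>\<^bsub>M\<^esub> b y \<noteq> \<zero>\<^bsub>M\<^esub>}"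
    by (rule rev_finite_subset) (use b in auto)
qed

lemma free_lift_hom: "free_lift M Y b \<in> mod_hom R (free_right_module R Y) M"
proof (rule mod_homI)
  fix f assume f: "f \<in> carrier (free_right_module R Y)"
  then show "free_lift M Y b f \<in> carrier M"
    unfolding free_lift_def using M.add.gfinprod_closed[of "\<lambda>y. f y \<odot>\<^bsub>M\<^esub> b y" Y] free_lift_terms by simp
  fix g assume g: "g \<in> carrier (free_right_module R Y)"
  have "free_lift M Y b (f \<oplus>\<^bsub>free_right_module R Y\<^esub> g)
      = gfinprod (add_monoid M) (\<lambda>y. f y \<odot>\<^bsub>M\<^esub> b y \<oplus>\<^bsub>M\<^esub> g y \<odot>\<^bsub>M\<^esub> b y) Y"
    unfolding free_lift_def
    using f g b by (intro M.add.gfinprod_cong)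
      (auto simp: add_free simp_implies_def carrier_free PiE_iff intro!: M.smult_l_distr M.smult_closed)
  also have "\<dots> = free_lift M Y b f \<oplus>\<^bsub>M\<^esub> free_lift M Y b g"
    unfolding free_lift_def
    using M.add.gfinprod_distrib[OF _ _ free_lift_terms(1)[OF f] free_lift_terms(1)[OF g]]
      free_lift_terms(2)[OF f] free_lift_terms(2)[OF g] by simp
  finally show "free_lift M Y b (f \<oplus>\<^bsub>free_right_module R Y\<^esub> g)
      = free_lift M Y b f \<oplus>\<^bsub>M\<^esub> free_lift M Y b g" .
next
  fix r f assume r: "r \<in> carrier R" and f: "f \<in> carrier (free_right_module R Y)"
  \<comment> \<open>For fixed r the scalar action is an additive endomorphism, so it commutes with
    the sum even though it need not be linear over a noncommutative R.\<close>
  have "(\<lambda>x. r \<odot>\<^bsub>M\<^esub> x) \<in> hom (add_monoid M) (add_monoid M)"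
    using r by (auto intro!: homI simp: M.smult_closed M.smult_r_distr)
  then have "r \<odot>\<^bsub>M\<^esub> free_lift M Y b f = gfinprod (add_monoid M) (\<lambda>y. r \<odot>\<^bsub>M\<^esub> (f y \<odot>\<^bsub>M\<^esub> b y)) Y"
    unfolding free_lift_def using hom_gfinprod[OF M.M.a_comm_group M.M.a_comm_group, of "\<lambda>x. r \<odot>\<^bsub>M\<^esub> x"]
       free_lift_terms[OF f] by simp
  \<comment> \<open>The coefficient of r applied to f is f y times r, with r on the right; in a
    right module this acts as f y followed by r.\<close>
  also have "\<dots> = free_lift M Y b (r \<odot>\<^bsub>free_right_module R Y\<^esub> f)"
    unfolding free_lift_def
    using f r b by (intro M.add.gfinprod_cong)
      (auto simp: smult_free simp_implies_def carrier_free PiE_iff M.smult_assoc intro!: M.smult_closed)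
  finally show "free_lift M Y b (r \<odot>\<^bsub>free_right_module R Y\<^esub> f) = r \<odot>\<^bsub>M\<^esub> free_lift M Y b f" by simp
qed

lemma free_lift_basis:
  assumes "y \<in> Y" shows "free_lift M Y b (free_basis R Y y) = b y"
proof -
  have "free_lift M Y b (free_basis R Y y) = gfinprod (add_monoid M) (\<lambda>z. b z) {y}"
    unfolding free_lift_def using assms b
    by (intro M.add.gfinprod_mono_neutral_cong_right)
      (auto simp: free_basis_def M.smult_one intro!: M.smult_closed)
  also have "\<dots> = b y"
    using M.add.gfinprod_singleton[of b y] b assms by simp
  finally show ?thesis .
qed

text \<open>Stands in for uniqueness in the universal property: a map out of a free module is
  computed by pushing it inside a lift, after which only its values on the family b matter.\<close>

lemma free_lift_compose:
  assumes N: "right_module R N" and h: "h \<in> mod_hom R M N"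
    and f: "f \<in> carrier (free_right_module R Y)"
  shows "h (free_lift M Y b f) = free_lift N Y (\<lambda>y. h (b y)) f"
proof -
  interpret N: right_module R N by (rule N)
  have "h \<in> hom (add_monoid M) (add_monoid N)"
    using h by (auto simp: mod_hom_def hom_def)
  then have "h (free_lift M Y b f) = gfinprod (add_monoid N) (\<lambda>y. h (f y \<odot>\<^bsub>M\<^esub> b y)) Y"
    unfolding free_lift_def using hom_gfinprod[OF M.M.a_comm_group N.M.a_comm_group, of h]
       free_lift_terms[OF f] by simp
  also have "\<dots> = free_lift N Y (\<lambda>y. h (b y)) f"
    unfolding free_lift_def
    using f b h by (intro N.add.gfinprod_cong)
      (auto simp: simp_implies_def carrier_free PiE_iff mod_hom_smult intro!: N.smult_closed M.smult_closed mod_hom_closed[OF h])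
  finally show ?thesis .
qed

end

lemma free_lift_cong:
  assumes M: "right_module R M" and f: "f \<in> carrier (free_right_module R Y)"
    and "\<And>y. y \<in> Y \<Longrightarrow> b y = b' y" "\<And>y. y \<in> Y \<Longrightarrow> b' y \<in> carrier M"
  shows "free_lift M Y b f = free_lift M Y b' f"
proof -
  interpret right_module R M by (rule M)
  show ?thesis
    unfolding free_lift_def
    by (rule M.add.gfinprod_cong[OF refl])
      (use f assms(3,4) smult_closed in \<open>auto simp: simp_implies_def carrier_free PiE_iff\<close>)
qed

lemma free_coordinate_hom:
  assumes "y \<in> Y"
  shows "(\<lambda>f. f y) \<in> mod_hom R (free_right_module R Y) (regular_right_module R)"
  using assms by (intro mod_homI) (auto simp: carrier_free add_free smult_free regular_right_module_def)

text \<open>Each coordinate is a homomorphism into the regular module and so passes inside the lift;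
  of the resulting sum only the term at y survives.\<close>

lemma free_lift_free_basis:
  assumes R: "ring R" and f: "f \<in> carrier (free_right_module R Y)"
  shows "free_lift (free_right_module R Y) Y (free_basis R Y) f = f"
proof
  fix y
  interpret R: ring R by (rule R)
  note free = right_module_free[OF R, of Y] and reg = right_module_regular[OF R]
  interpret G: right_module R "regular_right_module R" by (rule reg)
  let ?g = "free_lift (free_right_module R Y) Y (free_basis R Y) f"
  have g: "?g \<in> carrier (free_right_module R Y)"
    by (rule mod_hom_closed[OF free_lift_hom[OF free] f]) (rule free_basis_closed[OF R])
  show "?g y = f y"
  proof (cases "y \<in> Y")
    case True
    have "?g y = free_lift (regular_right_module R) Y (\<lambda>z. free_basis R Y z y) f"
      by (rule free_lift_compose[OF free free_basis_closed[OF R] reg free_coordinate_hom[OF True] f])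
    also have "\<dots> = gfinprod (add_monoid (regular_right_module R)) f {y}"
      unfolding free_lift_def using True f
      by (intro G.add.gfinprod_mono_neutral_cong_right)
        (auto simp: free_basis_def regular_right_module_def carrier_free PiE_iff)
    also have "\<dots> = f y"
      using G.add.gfinprod_singleton[of f y] f True
      by (simp add: carrier_free PiE_iff regular_right_module_def)
    finally show ?thesis .
  next
    case False
    then show ?thesis using f g by (auto simp: carrier_free PiE_iff extensional_def)
  qed
qed

section \<open>Tensor products\<close>

locale tensor_pair = M: right_module R M + Q: left_module R Q
  for R :: "('r, 'u) ring_scheme" and M :: "('r, 'm) module" and Q :: "('r, 'q) module"

lemma tensor_pairI: "right_module R M \<Longrightarrow> left_module R Q \<Longrightarrow> tensor_pair R M Q"
  by (rule tensor_pair.intro)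

context tensor_pair
begin

lemma keys_tensor_relation:
  "c \<in> tensor_relations R M Q \<Longrightarrow> Poly_Mapping.keys c \<subseteq> carrier M \<times> carrier Q"
  by (auto simp: tensor_relations_def M.smult_closed Q.smult_closed dest!: subsetD[OF keys_diff])

lemma tensor_kernel_subgroup:
  "subgroup (tensor_kernel R M Q) (free_Abelian_group (carrier M \<times> carrier Q))"
  unfolding tensor_kernel_def using keys_tensor_relation
  by (intro group.generate_is_subgroup) auto

lemma keys_tensor_kernel: "c \<in> tensor_kernel R M Q \<Longrightarrow> Poly_Mapping.keys c \<subseteq> carrier M \<times> carrier Q"
  using subgroup.mem_carrier[OF tensor_kernel_subgroup] by simp

lemma tensor_kernel_zero: "0 \<in> tensor_kernel R M Q"
  using subgroup.one_closed[OF tensor_kernel_subgroup] by simp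

lemma tensor_kernel_add:
  "a \<in> tensor_kernel R M Q \<Longrightarrow> b \<in> tensor_kernel R M Q \<Longrightarrow> a + b \<in> tensor_kernel R M Q"
  using subgroup.m_closed[OF tensor_kernel_subgroup] by simp

lemma tensor_kernel_minus: "a \<in> tensor_kernel R M Q \<Longrightarrow> - a \<in> tensor_kernel R M Q"
  using subgroup.m_inv_closed[OF tensor_kernel_subgroup] keys_tensor_kernel by fastforce

lemma tensor_kernel_diff:
  "a \<in> tensor_kernel R M Q \<Longrightarrow> b \<in> tensor_kernel R M Q \<Longrightarrow> a - b \<in> tensor_kernel R M Q"
  using tensor_kernel_add[OF _ tensor_kernel_minus, of a b] by simp

lemma tensor_kernel_sum:
  "(\<And>i. i \<in> I \<Longrightarrow> a i \<in> tensor_kernel R M Q) \<Longrightarrow> sum a I \<in> tensor_kernel R M Q"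
  by (induction I rule: infinite_finite_induct) (auto simp: tensor_kernel_zero tensor_kernel_add)

lemma tensor_kernel_cong:
  assumes "a - b \<in> tensor_kernel R M Q"
  shows "a \<in> tensor_kernel R M Q \<longleftrightarrow> b \<in> tensor_kernel R M Q"
  using tensor_kernel_add[OF assms, of b] tensor_kernel_diff[OF _ assms, of a] by auto

lemma tensor_kernel_relation: "c \<in> tensor_relations R M Q \<Longrightarrow> c \<in> tensor_kernel R M Q"
  unfolding tensor_kernel_def by (rule generate.incl)

lemma tensor_kernel_add_left:
  assumes "x \<in> carrier M" "x' \<in> carrier M" "q \<in> carrier Q"
  shows "frag_of (x \<oplus>\<^bsub>M\<^esub> x', q) - frag_of (x, q) - frag_of (x', q) \<in> tensor_kernel R M Q"
  by (rule tensor_kernel_relation) (use assms in \<open>auto simp: tensor_relations_def\<close>)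

lemma tensor_kernel_add_right:
  assumes "x \<in> carrier M" "q \<in> carrier Q" "q' \<in> carrier Q"
  shows "frag_of (x, q \<oplus>\<^bsub>Q\<^esub> q') - frag_of (x, q) - frag_of (x, q') \<in> tensor_kernel R M Q"
  by (rule tensor_kernel_relation) (use assms in \<open>auto simp: tensor_relations_def\<close>)

lemma tensor_kernel_smult:
  assumes "r \<in> carrier R" "x \<in> carrier M" "q \<in> carrier Q"
  shows "frag_of (r \<odot>\<^bsub>M\<^esub> x, q) - frag_of (x, r \<odot>\<^bsub>Q\<^esub> q) \<in> tensor_kernel R M Q"
  by (rule tensor_kernel_relation) (use assms in \<open>auto simp: tensor_relations_def\<close>)

lemma tensor_kernel_zero_left:
  assumes "q \<in> carrier Q" shows "frag_of (\<zero>\<^bsub>M\<^esub>, q) \<in> tensor_kernel R M Q"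
  using tensor_kernel_minus[OF tensor_kernel_add_left[OF M.M.zero_closed M.M.zero_closed assms]] by simp

lemma tensor_kernel_zero_right:
  assumes "x \<in> carrier M" shows "frag_of (x, \<zero>\<^bsub>Q\<^esub>) \<in> tensor_kernel R M Q"
  using tensor_kernel_minus[OF tensor_kernel_add_right[OF assms Q.M.zero_closed Q.M.zero_closed]] by simp

lemma tensor_kernel_diff_left:
  assumes "x \<in> carrier M" "x' \<in> carrier M" "q \<in> carrier Q"
  shows "frag_of (x, q) - frag_of (x', q) - frag_of (x \<ominus>\<^bsub>M\<^esub> x', q) \<in> tensor_kernel R M Q"
proof -
  have "(x \<ominus>\<^bsub>M\<^esub> x') \<oplus>\<^bsub>M\<^esub> x' = x"
    using assms by (simp add: a_minus_def M.M.a_assoc M.M.l_neg)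
  then show ?thesis
    using tensor_kernel_add_left[of "x \<ominus>\<^bsub>M\<^esub> x'" x' q] assms by (simp add: algebra_simps)
qed

lemma tensor_kernel_diff_right:
  assumes "x \<in> carrier M" "q \<in> carrier Q" "q' \<in> carrier Q"
  shows "frag_of (x, q) - frag_of (x, q') - frag_of (x, q \<ominus>\<^bsub>Q\<^esub> q') \<in> tensor_kernel R M Q"
proof -
  have "(q \<ominus>\<^bsub>Q\<^esub> q') \<oplus>\<^bsub>Q\<^esub> q' = q"
    using assms by (simp add: a_minus_def Q.M.a_assoc Q.M.l_neg)
  then show ?thesis
    using tensor_kernel_add_right[of x "q \<ominus>\<^bsub>Q\<^esub> q'" q'] assms by (simp add: algebra_simps)
qed

text \<open>Closure under differences replaces the inverse and product rules of
  \<open>generate\<close>, since - a = 0 - a and a + b = a - (- b). The case \<open>diff\<close>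
  also supplies membership in the kernel, which is needed wherever the supports of a and b have to
  be controlled.\<close>

lemma tensor_kernel_induct [consumes 1, case_names zero add_left add_right smult diff]:
  assumes c: "c \<in> tensor_kernel R M Q"
    and zero: "P 0"
    and add_left: "\<And>x x' q. x \<in> carrier M \<Longrightarrow> x' \<in> carrier M \<Longrightarrow> q \<in> carrier Q \<Longrightarrow>
      P (frag_of (x \<oplus>\<^bsub>M\<^esub> x', q) - frag_of (x, q) - frag_of (x', q))"
    and add_right: "\<And>x q q'. x \<in> carrier M \<Longrightarrow> q \<in> carrier Q \<Longrightarrow> q' \<in> carrier Q \<Longrightarrow>
      P (frag_of (x, q \<oplus>\<^bsub>Q\<^esub> q') - frag_of (x, q) - frag_of (x, q'))"
    and smult: "\<And>r x q. r \<in> carrier R \<Longrightarrow> x \<in> carrier M \<Longrightarrow> q \<in> carrier Q \<Longrightarrow>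
      P (frag_of (r \<odot>\<^bsub>M\<^esub> x, q) - frag_of (x, r \<odot>\<^bsub>Q\<^esub> q))"
    and diff: "\<And>a b. a \<in> tensor_kernel R M Q \<Longrightarrow> b \<in> tensor_kernel R M Q \<Longrightarrow> P a \<Longrightarrow> P b \<Longrightarrow> P (a - b)"
  shows "P c"
proof -
  have neg: "P (- a)" if "a \<in> tensor_kernel R M Q" "P a" for a
    using diff[OF tensor_kernel_zero that(1) zero that(2)] by simp
  have rel: "P a" if "a \<in> tensor_relations R M Q" for a
    using that add_left add_right smult by (auto simp: tensor_relations_def)
  \<comment> \<open>The conjunction makes membership available as part of the induction
    hypothesis.\<close>
  have "c \<in> tensor_kernel R M Q \<and> P c"
    using c unfolding tensor_kernel_def
  proof (induction rule: generate.induct)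
    case (inv h)
    then have "h \<in> tensor_kernel R M Q" by (rule tensor_kernel_relation)
    then show ?case
      using neg[of h] rel[OF inv] tensor_kernel_minus keys_tensor_relation[OF inv]
      by (simp flip: tensor_kernel_def)
  next
    case (eng a b)
    then have "a \<in> tensor_kernel R M Q" "b \<in> tensor_kernel R M Q" "P a" "P b"
      by (auto simp flip: tensor_kernel_def)
    then show ?case
      using diff[of a "- b"] neg[of b] tensor_kernel_minus[of b] tensor_kernel_add
      by (simp flip: tensor_kernel_def)
  qed (use zero rel tensor_kernel_zero tensor_kernel_relation in \<open>auto simp flip: tensor_kernel_def\<close>)
  then show ?thesis ..
qed

text \<open>J is any subgroup of formal sums rather than a tensor kernel: for right exactness the
  relations are respected only modulo something larger.\<close>

lemma frag_extend_tensor_kernel: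
  assumes c: "c \<in> tensor_kernel R M Q"
    and J: "0 \<in> J" "\<And>a b. a \<in> J \<Longrightarrow> b \<in> J \<Longrightarrow> a - b \<in> J"
    and add_left: "\<And>x x' q. x \<in> carrier M \<Longrightarrow> x' \<in> carrier M \<Longrightarrow> q \<in> carrier Q \<Longrightarrow>
      F (x \<oplus>\<^bsub>M\<^esub> x', q) - F (x, q) - F (x', q) \<in> J"
    and add_right: "\<And>x q q'. x \<in> carrier M \<Longrightarrow> q \<in> carrier Q \<Longrightarrow> q' \<in> carrier Q \<Longrightarrow>
      F (x, q \<oplus>\<^bsub>Q\<^esub> q') - F (x, q) - F (x, q') \<in> J"
    and smult: "\<And>r x q. r \<in> carrier R \<Longrightarrow> x \<in> carrier M \<Longrightarrow> q \<in> carrier Q \<Longrightarrow>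
      F (r \<odot>\<^bsub>M\<^esub> x, q) - F (x, r \<odot>\<^bsub>Q\<^esub> q) \<in> J"
  shows "frag_extend F c \<in> J"
  using c by (induction rule: tensor_kernel_induct)
    (auto simp: frag_extend_diff J add_left add_right smult)

text \<open>The universal property of the tensor product with values in an abstract abelian group.
  It is what allows coefficients to be read off, since these live in a module and not among formal
  sums.\<close>

lemma balanced_map_vanishes:
  fixes G :: "('g, 'v) monoid_scheme"
  assumes G: "comm_group G"
    and F: "\<And>x q. x \<in> carrier M \<Longrightarrow> q \<in> carrier Q \<Longrightarrow> F x q \<in> carrier G"
    and add_left: "\<And>x x' q. x \<in> carrier M \<Longrightarrow> x' \<in> carrier M \<Longrightarrow> q \<in> carrier Q \<Longrightarrow>
      F (x \<oplus>\<^bsub>M\<^esub> x') q = F x q \<otimes>\<^bsub>G\<^esub> F x' q"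
    and add_right: "\<And>x q q'. x \<in> carrier M \<Longrightarrow> q \<in> carrier Q \<Longrightarrow> q' \<in> carrier Q \<Longrightarrow>
      F x (q \<oplus>\<^bsub>Q\<^esub> q') = F x q \<otimes>\<^bsub>G\<^esub> F x q'"
    and smult: "\<And>r x q. r \<in> carrier R \<Longrightarrow> x \<in> carrier M \<Longrightarrow> q \<in> carrier Q \<Longrightarrow>
      F (r \<odot>\<^bsub>M\<^esub> x) q = F x (r \<odot>\<^bsub>Q\<^esub> q)"
  obtains h where "h \<in> hom (free_Abelian_group (carrier M \<times> carrier Q)) G"
    "\<And>x q. x \<in> carrier M \<Longrightarrow> q \<in> carrier Q \<Longrightarrow> h (frag_of (x, q)) = F x q"
    "\<And>c. c \<in> tensor_kernel R M Q \<Longrightarrow> h c = \<one>\<^bsub>G\<^esub>"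
proof -
  let ?A = "free_Abelian_group (carrier M \<times> carrier Q)"
  interpret G: comm_group G by (rule G)
  have "case_prod F ` (carrier M \<times> carrier Q) \<subseteq> carrier G" using F by auto
  from G.free_Abelian_group_universal[OF this] obtain h where h: "h \<in> hom ?A G" and h_of: "\<And>p. p \<in> carrier M \<times> carrier Q \<Longrightarrow> h (frag_of p) = case_prod F p" by blast
  interpret h: group_hom ?A G h using h by (simp add: group_hom_def group_hom_axioms_def)
  have h_diff: "h (a - b) = h a \<otimes>\<^bsub>G\<^esub> inv\<^bsub>G\<^esub> h b"
    if "Poly_Mapping.keys a \<subseteq> carrier M \<times> carrier Q" "Poly_Mapping.keys b \<subseteq> carrier M \<times> carrier Q" for a b
    using h.hom_mult[of a "- b"] h.hom_inv[of b] that by simp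
  have keys_d: "Poly_Mapping.keys (a - b) \<subseteq> carrier M \<times> carrier Q"
    if "Poly_Mapping.keys a \<subseteq> carrier M \<times> carrier Q" "Poly_Mapping.keys b \<subseteq> carrier M \<times> carrier Q"
    for a b :: "'m \<times> 'q \<Rightarrow>\<^sub>0 int"
    using that keys_diff[of a b] by blast
  have cancel: "a \<otimes>\<^bsub>G\<^esub> b \<otimes>\<^bsub>G\<^esub> inv\<^bsub>G\<^esub> a \<otimes>\<^bsub>G\<^esub> inv\<^bsub>G\<^esub> b = \<one>\<^bsub>G\<^esub>"
    if "a \<in> carrier G" "b \<in> carrier G" for a b
    using that G.r_inv[of "a \<otimes>\<^bsub>G\<^esub> b"] by (simp add: G.inv_mult G.m_assoc)
  have "h c = \<one>\<^bsub>G\<^esub>" if "c \<in> tensor_kernel R M Q" for c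
    using that
  proof (induction rule: tensor_kernel_induct)
    case zero
    then show ?case using h.hom_one by simp
  next
    case (add_left x x' q)
    then show ?case
      by (simp add: h_diff keys_d h_of assms(3) F cancel)
  next
    case (add_right x q q')
    then show ?case
      by (simp add: h_diff keys_d h_of assms(4) F cancel)
  next
    case (smult r x q)
    then show ?case
      by (simp add: h_diff h_of M.smult_closed Q.smult_closed assms(5) F)
  next
    case (diff a b)
    then show ?case by (simp add: h_diff keys_tensor_kernel)
  qed
  with that[of h] h h_of show thesis by simp
qed

text \<open>The bridge between the official quotient group and formal sums; questions about elements
  of the tensor product are turned by it into membership of a difference in the kernel.\<close>

lemma tensor_coset_eq_iff:
  assumes "Poly_Mapping.keys a \<subseteq> carrier M \<times> carrier Q" "Poly_Mapping.keys b \<subseteq> carrier M \<times> carrier Q"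
  shows "tensor_kernel R M Q #>\<^bsub>free_Abelian_group (carrier M \<times> carrier Q)\<^esub> a =
      tensor_kernel R M Q #>\<^bsub>free_Abelian_group (carrier M \<times> carrier Q)\<^esub> b \<longleftrightarrow>
    a - b \<in> tensor_kernel R M Q"
proof -
  have coset: "tensor_kernel R M Q #>\<^bsub>free_Abelian_group (carrier M \<times> carrier Q)\<^esub> a = {c. c - a \<in> tensor_kernel R M Q}" for a
    by (auto simp: r_coset_def intro: bexI[of _ "_ - a"])
  show ?thesis
    unfolding coset
  proof
    assume "{c. c - a \<in> tensor_kernel R M Q} = {c. c - b \<in> tensor_kernel R M Q}"
    moreover have "a \<in> {c. c - a \<in> tensor_kernel R M Q}" by (simp add: tensor_kernel_zero)
    ultimately show "a - b \<in> tensor_kernel R M Q" by blast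
  next
    assume ab: "a - b \<in> tensor_kernel R M Q"
    have "(c - b) - (c - a) \<in> tensor_kernel R M Q" for c
      using ab by simp
    from tensor_kernel_cong[OF this]
    show "{c. c - a \<in> tensor_kernel R M Q} = {c. c - b \<in> tensor_kernel R M Q}"
      by auto
  qed
qed

lemma carrier_tensor:
  "carrier (tensor R M Q) =
    {tensor_kernel R M Q #>\<^bsub>free_Abelian_group (carrier M \<times> carrier Q)\<^esub> c | c.
      Poly_Mapping.keys c \<subseteq> carrier M \<times> carrier Q}"
  by (auto simp: tensor_def FactGroup_def RCOSETS_def)

lemma one_tensor: "\<one>\<^bsub>tensor R M Q\<^esub> = tensor_kernel R M Q #>\<^bsub>free_Abelian_group (carrier M \<times> carrier Q)\<^esub> 0"
  by (simp add: tensor_def FactGroup_def r_coset_def)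

end

section \<open>Functoriality of the tensor product on formal sums\<close>

text \<open>The part of \<open>tensor_map\<close> that acts on representatives. Composition holds
  here as an equality of formal sums, before any quotient is taken.\<close>

definition frag_tensor :: "('m \<Rightarrow> 'm1) \<Rightarrow> ('q \<Rightarrow> 'q1) \<Rightarrow> ('m \<times> 'q \<Rightarrow>\<^sub>0 int) \<Rightarrow> ('m1 \<times> 'q1 \<Rightarrow>\<^sub>0 int)"
  where "frag_tensor f g = frag_extend (\<lambda>(x, q). frag_of (f x, g q))"

lemma frag_tensor_of [simp]: "frag_tensor f g (frag_of (x, q)) = frag_of (f x, g q)"
  by (simp add: frag_tensor_def)

lemma frag_tensor_0 [simp]: "frag_tensor f g 0 = 0"
  by (simp add: frag_tensor_def)

lemma frag_tensor_add: "frag_tensor f g (a + b) = frag_tensor f g a + frag_tensor f g b"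
  by (simp add: frag_tensor_def frag_extend_add)

lemma frag_tensor_diff: "frag_tensor f g (a - b) = frag_tensor f g a - frag_tensor f g b"
  by (simp add: frag_tensor_def frag_extend_diff)

lemma frag_tensor_sum: "finite I \<Longrightarrow> frag_tensor f g (sum a I) = (\<Sum>i\<in>I. frag_tensor f g (a i))"
  by (simp add: frag_tensor_def frag_extend_sum)

lemma frag_tensor_compose:
  "frag_tensor f g (frag_tensor f' g' c) = frag_tensor (\<lambda>x. f (f' x)) (\<lambda>q. g (g' q)) c"
  using subset_UNIV by (induction c rule: frag_induction) (auto simp: frag_tensor_diff)

lemma frag_tensor_id:
  assumes "Poly_Mapping.keys c \<subseteq> A \<times> B" "\<And>x. x \<in> A \<Longrightarrow> f x = x" "\<And>q. q \<in> B \<Longrightarrow> g q = q"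
  shows "frag_tensor f g c = c"
  using assms(1) by (induction c rule: frag_induction) (auto simp: frag_tensor_diff assms)

lemma keys_frag_tensor:
  assumes "Poly_Mapping.keys c \<subseteq> A \<times> B" "f ` A \<subseteq> A'" "g ` B \<subseteq> B'"
  shows "Poly_Mapping.keys (frag_tensor f g c) \<subseteq> A' \<times> B'"
proof
  fix z assume "z \<in> Poly_Mapping.keys (frag_tensor f g c)"
  then obtain p where "p \<in> Poly_Mapping.keys c" "z = (f (fst p), g (snd p))"
    using keys_frag_extend[of "\<lambda>(x, q). frag_of (f x, g q)" c]
    by (auto simp: frag_tensor_def split: prod.splits)
  moreover from this have "p \<in> A \<times> B" using assms(1) by blast
  ultimately show "z \<in> A' \<times> B'" using assms(2,3) by (auto simp: mem_Times_iff)
qed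

context
  fixes R :: "('r, 'u) ring_scheme" and M :: "('r, 'm) module" and Q :: "('r, 'q) module"
    and M' :: "('r, 'm1) module" and Q' :: "('r, 'q1) module" and f g
  assumes pair: "tensor_pair R M Q" and pair': "tensor_pair R M' Q'"
    and f: "f \<in> mod_hom R M M'" and g: "g \<in> mod_hom R Q Q'"
begin

interpretation A: tensor_pair R M Q by (rule pair)
interpretation B: tensor_pair R M' Q' by (rule pair')

lemma frag_tensor_kernel:
  assumes "c \<in> tensor_kernel R M Q" shows "frag_tensor f g c \<in> tensor_kernel R M' Q'"
  unfolding frag_tensor_def using assms
  by (rule A.frag_extend_tensor_kernel)
    (auto simp: B.tensor_kernel_zero B.tensor_kernel_diff mod_hom_add[OF f] mod_hom_add[OF g]
      mod_hom_smult[OF f] mod_hom_smult[OF g] mod_hom_closed[OF f] mod_hom_closed[OF g]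
      intro!: B.tensor_kernel_add_left B.tensor_kernel_add_right B.tensor_kernel_smult)

text \<open>\<open>tensor_map\<close> is defined by \<open>the_elem\<close>, so it has a meaning
  only if all representatives of a coset give the same result. They do, because two of them differ
  by an element of the kernel, which is sent into the kernel of the target.\<close>

lemma tensor_map_coset:
  assumes "Poly_Mapping.keys c \<subseteq> carrier M \<times> carrier Q"
  shows "tensor_map R M' Q' f g (tensor_kernel R M Q #>\<^bsub>free_Abelian_group (carrier M \<times> carrier Q)\<^esub> c)
    = tensor_kernel R M' Q' #>\<^bsub>free_Abelian_group (carrier M' \<times> carrier Q')\<^esub> frag_tensor f g c"
proof -
  have im: "f ` carrier M \<subseteq> carrier M'" "g ` carrier Q \<subseteq> carrier Q'"
    using mod_hom_closed[OF f] mod_hom_closed[OF g] by auto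
  have "tensor_kernel R M' Q' #>\<^bsub>free_Abelian_group (carrier M' \<times> carrier Q')\<^esub> frag_tensor f g d
    = tensor_kernel R M' Q' #>\<^bsub>free_Abelian_group (carrier M' \<times> carrier Q')\<^esub> frag_tensor f g c"
    if d: "d \<in> tensor_kernel R M Q #>\<^bsub>free_Abelian_group (carrier M \<times> carrier Q)\<^esub> c" for d
  proof -
    obtain k where k: "k \<in> tensor_kernel R M Q" "d = k + c"
      using d by (auto simp: r_coset_def)
    have "Poly_Mapping.keys d \<subseteq> carrier M \<times> carrier Q"
      using k A.keys_tensor_kernel assms keys_add[of k c] by blast
    then show ?thesis
      using k frag_tensor_kernel[OF k(1)] frag_tensor_diff[of f g d c] keys_frag_tensor[OF _ im] assms
      by (subst B.tensor_coset_eq_iff) auto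
  qed
  moreover have "c \<in> tensor_kernel R M Q #>\<^bsub>free_Abelian_group (carrier M \<times> carrier Q)\<^esub> c"
    by (auto simp: r_coset_def A.tensor_kernel_zero)
  ultimately have "(\<lambda>d. tensor_kernel R M' Q' #>\<^bsub>free_Abelian_group (carrier M' \<times> carrier Q')\<^esub> frag_tensor f g d) `
      (tensor_kernel R M Q #>\<^bsub>free_Abelian_group (carrier M \<times> carrier Q)\<^esub> c)
    = {tensor_kernel R M' Q' #>\<^bsub>free_Abelian_group (carrier M' \<times> carrier Q')\<^esub> frag_tensor f g c}"
    by blast
  then show ?thesis
    unfolding tensor_map_def frag_tensor_def[symmetric] by simp
qed

end

section \<open>Exactness of the tensor product\<close>

lemma tensor_kernel_mono:
  assumes B: "right_module R B" and A: "submodule A R B" and Q: "left_module R Q"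
    and c: "c \<in> tensor_kernel R (B\<lparr>carrier := A\<rparr>) Q"
  shows "c \<in> tensor_kernel R B Q"
proof -
  have pA: "tensor_pair R (B\<lparr>carrier := A\<rparr>) Q"
    by (intro tensor_pairI right_module.right_module_submodule B A Q)
  have pB: "tensor_pair R B Q" by (intro tensor_pairI B Q)
  have "frag_tensor (\<lambda>x. x) (\<lambda>q. q) c \<in> tensor_kernel R B Q"
    by (rule frag_tensor_kernel[OF pA pB mod_hom_inclusion[OF submodule_subset[OF A]] mod_hom_id c])
  then show ?thesis
    using frag_tensor_id[OF tensor_pair.keys_tensor_kernel[OF pA c], of "\<lambda>x. x" "\<lambda>q. q"] by simp
qed

text \<open>For a submodule A this is injectivity of A \<otimes> Q \<rightarrow> M \<otimes> Q. The
  reverse implication between the two memberships is \<open>tensor_kernel_mono\<close>.\<close>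

definition tensor_injective ::
    "('r, 'u) ring_scheme \<Rightarrow> 'm set \<Rightarrow> ('r, 'm) module \<Rightarrow> ('r, 'q) module \<Rightarrow> bool"
  where "tensor_injective R A M Q \<longleftrightarrow>
    (\<forall>c\<in>tensor_kernel R M Q. Poly_Mapping.keys c \<subseteq> A \<times> carrier Q \<longrightarrow>
      c \<in> tensor_kernel R (M\<lparr>carrier := A\<rparr>) Q)"

lemma tensor_injectiveD:
  "tensor_injective R A M Q \<Longrightarrow> c \<in> tensor_kernel R M Q \<Longrightarrow> Poly_Mapping.keys c \<subseteq> A \<times> carrier Q \<Longrightarrow>
    c \<in> tensor_kernel R (M\<lparr>carrier := A\<rparr>) Q"
  by (simp add: tensor_injective_def)

lemma (in tensor_pair) frag_over_zero:
  assumes "Poly_Mapping.keys c \<subseteq> {\<zero>\<^bsub>M\<^esub>} \<times> carrier Q"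
  shows "c \<in> tensor_kernel R M Q"
  using assms by (induction c rule: frag_induction)
    (auto simp: tensor_kernel_zero tensor_kernel_diff tensor_kernel_zero_left)

lemma tensor_injective_zero:
  assumes "right_module R M" "left_module R Q"
  shows "tensor_injective R {\<zero>\<^bsub>M\<^esub>} M Q"
proof -
  interpret M: right_module R M by fact
  have "submodule {\<zero>\<^bsub>M\<^esub>} R M" by (rule M.submoduleI) (auto intro: right_module_minus_zero assms)
  then have "tensor_pair R (M\<lparr>carrier := {\<zero>\<^bsub>M\<^esub>}\<rparr>) Q"
    by (intro tensor_pairI assms M.right_module_submodule)
  then show ?thesis
    unfolding tensor_injective_def using tensor_pair.frag_over_zero by fastforce
qed

lemma tensor_injective_trans:
  assumes "tensor_injective R A (M\<lparr>carrier := B\<rparr>) Q" "tensor_injective R B M Q" "A \<subseteq> B"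
  shows "tensor_injective R A M Q"
  unfolding tensor_injective_def
proof (intro ballI impI)
  fix c assume c: "c \<in> tensor_kernel R M Q" and k: "Poly_Mapping.keys c \<subseteq> A \<times> carrier Q"
  then have "Poly_Mapping.keys c \<subseteq> B \<times> carrier Q" using assms(3) by auto
  then have "c \<in> tensor_kernel R (M\<lparr>carrier := B\<rparr>) Q" using tensor_injectiveD[OF assms(2) c] by simp
  from tensor_injectiveD[OF assms(1) this k] show "c \<in> tensor_kernel R (M\<lparr>carrier := A\<rparr>) Q" by simp
qed

text \<open>
  The set-theoretic map b \<open>\<mapsto>\<close> (b - phi (s b), s b) splits the surjection from A \<open>\<oplus>\<close> F onto B. It is
  additive modulo the kernel {(- phi k, k)} of that surjection, so it sends the relations defining
  the tensor product with B to the image of that kernel.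
\<close>

lemma tensor_injective_presentation:
  assumes B: "right_module R B" and A: "submodule A R B" and F: "right_module R F"
    and Q: "left_module R Q" and phi: "\<phi> \<in> mod_hom R F B"
    and cover: "\<And>b. b \<in> carrier B \<Longrightarrow> \<exists>f\<in>carrier F. b \<ominus>\<^bsub>B\<^esub> \<phi> f \<in> A"
    and inj: "tensor_injective R {f \<in> carrier F. \<phi> f \<in> A} F Q"
  shows "tensor_injective R A B Q"
proof -
  define K where "K = {f \<in> carrier F. \<phi> f \<in> A}"
  have K: "submodule K R F" unfolding K_def by (rule submodule_vimage[OF phi F B A])
  let ?A = "B\<lparr>carrier := A\<rparr>" and ?K = "F\<lparr>carrier := K\<rparr>"
  have Asub: "A \<subseteq> carrier B" by (rule submodule_subset[OF A])
  interpret B: tensor_pair R B Q by (intro tensor_pairI B Q)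
  interpret F: tensor_pair R F Q by (intro tensor_pairI F Q)
  interpret A: tensor_pair R ?A Q
    by (intro tensor_pairI B.M.right_module_submodule A Q)
  have pK: "tensor_pair R ?K Q"
    by (intro tensor_pairI F.M.right_module_submodule K Q)
  note agB = B.M.M.abelian_group_axioms and agF = F.M.M.abelian_group_axioms
  have phi_hom: "\<phi> \<in> mod_hom R ?K ?A"
    using phi by (auto simp: mod_hom_def K_def)
  \<comment> \<open>The section is normalised to vanish on A. As a consequence the map a below is
    the identity on A, and s turns sums supported on A into sums over zero.\<close>
  have "\<exists>f\<in>carrier F. b \<ominus>\<^bsub>B\<^esub> \<phi> f \<in> A \<and> (b \<in> A \<longrightarrow> f = \<zero>\<^bsub>F\<^esub>)" if b: "b \<in> carrier B" for b
  proof (cases "b \<in> A")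
    case True
    have "b \<ominus>\<^bsub>B\<^esub> \<phi> \<zero>\<^bsub>F\<^esub> = b"
      using b by (simp add: mod_hom_zero[OF phi agF agB] a_minus_def right_module_minus_zero[OF B])
    then show ?thesis using True by (intro bexI[of _ "\<zero>\<^bsub>F\<^esub>"]) auto
  qed (use cover[OF b] in auto)
  then obtain s where s: "\<And>b. b \<in> carrier B \<Longrightarrow> s b \<in> carrier F"
    and sA: "\<And>b. b \<in> carrier B \<Longrightarrow> b \<ominus>\<^bsub>B\<^esub> \<phi> (s b) \<in> A" and s0: "\<And>b. b \<in> A \<Longrightarrow> s b = \<zero>\<^bsub>F\<^esub>"
    using Asub by (metis subsetD)
  define a where "a b = b \<ominus>\<^bsub>B\<^esub> \<phi> (s b)" for b
  have a: "a b \<in> A" if "b \<in> carrier B" for b using sA that by (simp add: a_def)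
  have aB: "a b \<in> carrier B" if "b \<in> carrier B" for b using a that Asub by auto
  note ph = mod_hom_closed[OF phi]
  have phiA: "\<phi> k \<in> A" if "k \<in> K" for k using that by (simp add: K_def)
  \<comment> \<open>Says that the pair (a d, s d) equals (- \<phi> k, k) in the tensor products with
    A and with F, for some k over K. This is the image of K \<otimes> Q in (A \<oplus> F) \<otimes>
    Q.\<close>
  let ?P = "\<lambda>d k. Poly_Mapping.keys k \<subseteq> K \<times> carrier Q \<and>
    frag_tensor a (\<lambda>q. q) d + frag_tensor \<phi> (\<lambda>q. q) k \<in> tensor_kernel R ?A Q \<and>
    frag_tensor s (\<lambda>q. q) d - k \<in> tensor_kernel R F Q"
  have split: "\<exists>k. ?P d k" if "d \<in> tensor_kernel R B Q" for d
    using that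
  proof (induction rule: B.tensor_kernel_induct)
    case zero
    show ?case by (rule exI[of _ 0]) (simp add: A.tensor_kernel_zero F.tensor_kernel_zero)
  next
    case (add_left x y q)
    \<comment> \<open>The failure of s to be additive. Since b = a b + \<phi> (s b), its image under
      \<phi> is the failure of a with opposite sign; that lies in A, so k lies in K.\<close>
    define k where "k = s (x \<oplus>\<^bsub>B\<^esub> y) \<ominus>\<^bsub>F\<^esub> (s x \<oplus>\<^bsub>F\<^esub> s y)"
    have phk: "\<phi> k = \<phi> (s (x \<oplus>\<^bsub>B\<^esub> y)) \<ominus>\<^bsub>B\<^esub> (\<phi> (s x) \<oplus>\<^bsub>B\<^esub> \<phi> (s y))"
      using add_left s by (simp add: k_def mod_hom_diff[OF phi agF agB] mod_hom_add[OF phi])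
    have sum: "a (x \<oplus>\<^bsub>B\<^esub> y) \<oplus>\<^bsub>B\<^esub> \<phi> k = a x \<oplus>\<^bsub>B\<^esub> a y"
      using add_left s ph by (simp add: phk a_def B.M.M.diff_add_diff_cancel B.M.M.diff_add_diff)
    have kF: "k \<in> carrier F" using add_left s by (simp add: k_def)
    have "\<phi> k = (a x \<oplus>\<^bsub>B\<^esub> a y) \<ominus>\<^bsub>B\<^esub> a (x \<oplus>\<^bsub>B\<^esub> y)"
      using sum add_left aB ph[OF kF]
      by (metis B.M.M.add.m_closed B.M.M.add.inv_solve_right' B.M.M.a_comm a_minus_def)
    then have kK: "k \<in> K"
      using kF add_left a by (simp add: K_def submodule_diff[OF A] submodule_add[OF A])
    have 3: "frag_of (a (x \<oplus>\<^bsub>B\<^esub> y) \<oplus>\<^bsub>B\<^esub> \<phi> k, q) - frag_of (a (x \<oplus>\<^bsub>B\<^esub> y), q) - frag_of (\<phi> k, q)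
        \<in> tensor_kernel R ?A Q"
      using A.tensor_kernel_add_left[of "a (x \<oplus>\<^bsub>B\<^esub> y)" "\<phi> k" q] add_left a phiA[OF kK] by simp
    have 4: "frag_of (a x \<oplus>\<^bsub>B\<^esub> a y, q) - frag_of (a x, q) - frag_of (a y, q) \<in> tensor_kernel R ?A Q"
      using A.tensor_kernel_add_left[of "a x" "a y" q] add_left a by simp
    from A.tensor_kernel_diff[OF 4 3] have 1: "frag_tensor a (\<lambda>q. q) (frag_of (x \<oplus>\<^bsub>B\<^esub> y, q) - frag_of (x, q) - frag_of (y, q))
        + frag_tensor \<phi> (\<lambda>q. q) (frag_of (k, q)) \<in> tensor_kernel R ?A Q"
      unfolding sum by (simp add: frag_tensor_diff frag_tensor_add algebra_simps)
    have "frag_of (s (x \<oplus>\<^bsub>B\<^esub> y), q) - frag_of (s x \<oplus>\<^bsub>F\<^esub> s y, q) - frag_of (k, q) \<in> tensor_kernel R F Q"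
      using F.tensor_kernel_diff_left[of "s (x \<oplus>\<^bsub>B\<^esub> y)" "s x \<oplus>\<^bsub>F\<^esub> s y" q] add_left s by (simp add: k_def)
    from F.tensor_kernel_add[OF this F.tensor_kernel_add_left[of "s x" "s y" q]]
    have 2: "frag_tensor s (\<lambda>q. q) (frag_of (x \<oplus>\<^bsub>B\<^esub> y, q) - frag_of (x, q) - frag_of (y, q))
        - frag_of (k, q) \<in> tensor_kernel R F Q"
      using add_left s by (simp add: frag_tensor_diff frag_tensor_add algebra_simps)
    show ?case using 1 2 kK add_left by (intro exI[of _ "frag_of (k, q)"]) simp
  next
    case (add_right x q q')
    \<comment> \<open>Both a and s act on the first entry only, so a relation in the second entry is
      sent to a relation and the correction is 0.\<close>
    show ?case
      using A.tensor_kernel_add_right[of "a x" q q'] F.tensor_kernel_add_right[of "s x" q q'] add_right a s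
      by (intro exI[of _ 0]) (simp add: frag_tensor_diff)
  next
    case (smult r x q)
    \<comment> \<open>The failure of s to commute with the scalar r, again balanced by that of
      a.\<close>
    define k where "k = s (r \<odot>\<^bsub>B\<^esub> x) \<ominus>\<^bsub>F\<^esub> r \<odot>\<^bsub>F\<^esub> s x"
    have rx: "r \<odot>\<^bsub>B\<^esub> x \<in> carrier B" "r \<odot>\<^bsub>F\<^esub> s x \<in> carrier F"
      using smult s by (auto intro: B.M.smult_closed F.M.smult_closed)
    have phk: "\<phi> k = \<phi> (s (r \<odot>\<^bsub>B\<^esub> x)) \<ominus>\<^bsub>B\<^esub> r \<odot>\<^bsub>B\<^esub> \<phi> (s x)"
      using smult s rx by (simp add: k_def mod_hom_diff[OF phi agF agB] mod_hom_smult[OF phi])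
    have rph: "r \<odot>\<^bsub>B\<^esub> \<phi> (s x) \<in> carrier B" using smult s ph by (auto intro: B.M.smult_closed)
    have sum: "a (r \<odot>\<^bsub>B\<^esub> x) \<oplus>\<^bsub>B\<^esub> \<phi> k = r \<odot>\<^bsub>B\<^esub> a x"
      using smult s ph rx rph by (simp add: phk a_def B.M.M.diff_add_diff_cancel B.M.smult_diff)
    have kF: "k \<in> carrier F" using smult s rx by (simp add: k_def)
    have rA: "r \<odot>\<^bsub>B\<^esub> a x \<in> A" using smult a by (simp add: submodule_smult[OF A])
    have "\<phi> k = r \<odot>\<^bsub>B\<^esub> a x \<ominus>\<^bsub>B\<^esub> a (r \<odot>\<^bsub>B\<^esub> x)"
      using sum rx aB[OF rx(1)] ph[OF kF] subsetD[OF Asub rA]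
      by (metis B.M.M.add.inv_solve_right' B.M.M.a_comm a_minus_def)
    then have kK: "k \<in> K"
      using kF rA a[OF rx(1)] by (simp add: K_def submodule_diff[OF A])
    have 3: "frag_of (a (r \<odot>\<^bsub>B\<^esub> x) \<oplus>\<^bsub>B\<^esub> \<phi> k, q) - frag_of (a (r \<odot>\<^bsub>B\<^esub> x), q) - frag_of (\<phi> k, q)
        \<in> tensor_kernel R ?A Q"
      using A.tensor_kernel_add_left[of "a (r \<odot>\<^bsub>B\<^esub> x)" "\<phi> k" q] smult a[OF rx(1)] phiA[OF kK] by simp
    have 4: "frag_of (r \<odot>\<^bsub>B\<^esub> a x, q) - frag_of (a x, r \<odot>\<^bsub>Q\<^esub> q) \<in> tensor_kernel R ?A Q"
      using A.tensor_kernel_smult[of r "a x" q] smult a by simp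
    from A.tensor_kernel_diff[OF 4 3] have 1: "frag_tensor a (\<lambda>q. q) (frag_of (r \<odot>\<^bsub>B\<^esub> x, q) - frag_of (x, r \<odot>\<^bsub>Q\<^esub> q))
        + frag_tensor \<phi> (\<lambda>q. q) (frag_of (k, q)) \<in> tensor_kernel R ?A Q"
      unfolding sum by (simp add: frag_tensor_diff frag_tensor_add algebra_simps)
    have "frag_of (s (r \<odot>\<^bsub>B\<^esub> x), q) - frag_of (r \<odot>\<^bsub>F\<^esub> s x, q) - frag_of (k, q) \<in> tensor_kernel R F Q"
      using F.tensor_kernel_diff_left[of "s (r \<odot>\<^bsub>B\<^esub> x)" "r \<odot>\<^bsub>F\<^esub> s x" q] smult s rx by (simp add: k_def)
    from F.tensor_kernel_add[OF this F.tensor_kernel_smult[of r "s x" q]]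
    have 2: "frag_tensor s (\<lambda>q. q) (frag_of (r \<odot>\<^bsub>B\<^esub> x, q) - frag_of (x, r \<odot>\<^bsub>Q\<^esub> q))
        - frag_of (k, q) \<in> tensor_kernel R F Q"
      using smult s by (simp add: frag_tensor_diff frag_tensor_add algebra_simps)
    show ?case using 1 2 kK smult by (intro exI[of _ "frag_of (k, q)"]) simp
  next
    case (diff c d)
    then obtain k l where "?P c k" "?P d l" by blast
    moreover from this have "Poly_Mapping.keys (k - l) \<subseteq> K \<times> carrier Q"
      using keys_diff[of k l] by blast
    ultimately have "?P (c - d) (k - l)"
      using A.tensor_kernel_diff[of "frag_tensor a (\<lambda>q. q) c + frag_tensor \<phi> (\<lambda>q. q) k" "frag_tensor a (\<lambda>q. q) d + frag_tensor \<phi> (\<lambda>q. q) l"]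
       F.tensor_kernel_diff[of "frag_tensor s (\<lambda>q. q) c - k" "frag_tensor s (\<lambda>q. q) d - l"]
      by (simp add: frag_tensor_diff frag_tensor_add algebra_simps)
    then show ?case by blast
  qed
  show ?thesis
    unfolding tensor_injective_def
  proof (intro ballI impI)
    fix c assume c: "c \<in> tensor_kernel R B Q" and kc: "Poly_Mapping.keys c \<subseteq> A \<times> carrier Q"
    obtain k where k: "?P c k" using split[OF c] by blast
    \<comment> \<open>For c supported on A the s-component is zero, so k vanishes in F \<otimes> Q.
      By \<open>inj\<close> it vanishes already over K, and applying \<phi> shows that a c = c
      vanishes over A.\<close>
    have "frag_tensor s (\<lambda>q. q) c \<in> tensor_kernel R F Q"
      by (intro F.frag_over_zero keys_frag_tensor[OF kc]) (use s0 in auto)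
    then have "k \<in> tensor_kernel R F Q"
      using F.tensor_kernel_cong k by blast
    then have "k \<in> tensor_kernel R ?K Q"
      using tensor_injectiveD[OF inj[folded K_def]] k by blast
    then have "frag_tensor \<phi> (\<lambda>q. q) k \<in> tensor_kernel R ?A Q"
      by (rule frag_tensor_kernel[OF pK A.tensor_pair_axioms phi_hom mod_hom_id])
    then have "frag_tensor a (\<lambda>q. q) c \<in> tensor_kernel R ?A Q"
      using A.tensor_kernel_diff[of "frag_tensor a (\<lambda>q. q) c + frag_tensor \<phi> (\<lambda>q. q) k" "frag_tensor \<phi> (\<lambda>q. q) k"] k by simp
    moreover have "frag_tensor a (\<lambda>q. q) c = c"
    proof (rule frag_tensor_id[OF kc])
      fix x assume "x \<in> A"
      then show "a x = x" using s0 Asub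
        by (auto simp: a_def a_minus_def mod_hom_zero[OF phi agF agB] right_module_minus_zero[OF B])
    qed simp
    ultimately show "c \<in> tensor_kernel R ?A Q" by simp
  qed
qed

text \<open>A set-theoretic section s of g lifts formal sums over B back to E. It is linear only
  modulo the kernel of g, which is exactly the indeterminacy that the conclusion permits.\<close>

lemma tensor_right_exact:
  assumes E: "right_module R E" and B: "right_module R B" and Q: "left_module R Q"
    and g: "g \<in> mod_hom R E B" and surj: "g ` carrier E = carrier B"
    and keys: "Poly_Mapping.keys c \<subseteq> carrier E \<times> carrier Q"
    and c: "frag_tensor g (\<lambda>q. q) c \<in> tensor_kernel R B Q"
  obtains l where "Poly_Mapping.keys l \<subseteq> {e \<in> carrier E. g e = \<zero>\<^bsub>B\<^esub>} \<times> carrier Q"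
    "c - l \<in> tensor_kernel R E Q"
proof -
  interpret B: tensor_pair R B Q by (intro tensor_pairI B Q)
  interpret E: tensor_pair R E Q by (intro tensor_pairI E Q)
  note agB = B.M.M.abelian_group_axioms and agE = E.M.M.abelian_group_axioms
  define L where "L = {e \<in> carrier E. g e = \<zero>\<^bsub>B\<^esub>}"
  \<comment> \<open>The preimage, among formal sums, of the image of L \<otimes> Q in E \<otimes> Q.
    The goal is that c belongs to this subgroup.\<close>
  define J where "J = {c. \<exists>l. Poly_Mapping.keys l \<subseteq> L \<times> carrier Q \<and> c - l \<in> tensor_kernel R E Q}"
  have JI: "c \<in> J" if "Poly_Mapping.keys l \<subseteq> L \<times> carrier Q" "c - l \<in> tensor_kernel R E Q" for c l
    using that by (auto simp: J_def)
  have J0: "0 \<in> J" by (rule JI[of 0]) (simp_all add: E.tensor_kernel_zero)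
  have Jdiff: "a - b \<in> J" if ab: "a \<in> J" "b \<in> J" for a b
  proof -
    obtain k l where kl: "Poly_Mapping.keys k \<subseteq> L \<times> carrier Q" "a - k \<in> tensor_kernel R E Q"
      "Poly_Mapping.keys l \<subseteq> L \<times> carrier Q" "b - l \<in> tensor_kernel R E Q"
      using ab by (auto simp: J_def)
    have "Poly_Mapping.keys (k - l) \<subseteq> L \<times> carrier Q"
      using kl keys_diff[of k l] by blast
    moreover have "(a - b) - (k - l) \<in> tensor_kernel R E Q"
      using E.tensor_kernel_diff[OF kl(2,4)] by (simp add: algebra_simps)
    ultimately show ?thesis by (rule JI)
  qed
  have "\<forall>b\<in>carrier B. \<exists>e\<in>carrier E. g e = b" unfolding surj[symmetric] by blast
  then obtain s where s: "\<And>b. b \<in> carrier B \<Longrightarrow> s b \<in> carrier E"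
    and gs: "\<And>b. b \<in> carrier B \<Longrightarrow> g (s b) = b" by metis
  have Lmem: "x \<ominus>\<^bsub>E\<^esub> y \<in> L" if "x \<in> carrier E" "y \<in> carrier E" "g x = g y" for x y
    using that mod_hom_closed[OF g] by (simp add: L_def mod_hom_diff[OF g agE agB] B.M.M.diff_self)
  have diffJ: "frag_of (x, q) - frag_of (y, q) \<in> J"
    if "x \<in> carrier E" "y \<in> carrier E" "g x = g y" "q \<in> carrier Q" for x y q
    using Lmem[OF that(1-3)] that E.tensor_kernel_diff_left[OF that(1,2,4)]
    by (intro JI[of "frag_of (x \<ominus>\<^bsub>E\<^esub> y, q)"]) auto
  have Jker: "a \<in> J" if "a \<in> tensor_kernel R E Q" for a
    using that by (intro JI[of 0]) auto
  have Jadd: "a + b \<in> J" if "a \<in> J" "b \<in> J" for a b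
    using Jdiff[OF that(1) Jdiff[OF J0 that(2)]] by simp
  \<comment> \<open>Lifting the relations over B along s lands in J, because two elements of E with
    equal image under g differ by an element of L.\<close>
  have "frag_extend (\<lambda>(b, q). frag_of (s b, q)) (frag_tensor g (\<lambda>q. q) c) \<in> J"
    using c
  proof (rule B.frag_extend_tensor_kernel[OF _ J0 Jdiff])
    fix x y q assume h: "x \<in> carrier B" "y \<in> carrier B" "q \<in> carrier Q"
    have "frag_of (s (x \<oplus>\<^bsub>B\<^esub> y), q) - frag_of (s x \<oplus>\<^bsub>E\<^esub> s y, q) \<in> J"
      using h s by (intro diffJ) (auto simp: mod_hom_add[OF g] gs)
    from Jadd[OF this Jker[OF E.tensor_kernel_add_left[of "s x" "s y" q]]] h s
    show "(case (x \<oplus>\<^bsub>B\<^esub> y, q) of (b, q) \<Rightarrow> frag_of (s b, q)) - (case (x, q) of (b, q) \<Rightarrow> frag_of (s b, q))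
        - (case (y, q) of (b, q) \<Rightarrow> frag_of (s b, q)) \<in> J"
      by (simp add: algebra_simps)
  next
    fix x q q' assume "x \<in> carrier B" "q \<in> carrier Q" "q' \<in> carrier Q"
    then show "(case (x, q \<oplus>\<^bsub>Q\<^esub> q') of (b, q) \<Rightarrow> frag_of (s b, q)) - (case (x, q) of (b, q) \<Rightarrow> frag_of (s b, q))
        - (case (x, q') of (b, q) \<Rightarrow> frag_of (s b, q)) \<in> J"
      using Jker[OF E.tensor_kernel_add_right[of "s x" q q']] s by simp
  next
    fix r x q assume h: "r \<in> carrier R" "x \<in> carrier B" "q \<in> carrier Q"
    then have "frag_of (s (r \<odot>\<^bsub>B\<^esub> x), q) - frag_of (r \<odot>\<^bsub>E\<^esub> s x, q) \<in> J"
      using s by (intro diffJ) (auto simp: mod_hom_smult[OF g] gs B.M.smult_closed E.M.smult_closed)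
    from Jadd[OF this Jker[OF E.tensor_kernel_smult[of r "s x" q]]] h s
    show "(case (r \<odot>\<^bsub>B\<^esub> x, q) of (b, q) \<Rightarrow> frag_of (s b, q))
        - (case (x, r \<odot>\<^bsub>Q\<^esub> q) of (b, q) \<Rightarrow> frag_of (s b, q)) \<in> J"
      by (simp add: algebra_simps)
  qed auto
  \<comment> \<open>Going down by g and back by s moves each first entry within its fibre, so c
    changes only by an element of J.\<close>
  moreover have "c - frag_extend (\<lambda>(b, q). frag_of (s b, q)) (frag_tensor g (\<lambda>q. q) c) \<in> J"
    using keys
  proof (induction c rule: frag_induction)
    case (one p)
    then show ?case
      using s gs mod_hom_closed[OF g] by (auto intro!: diffJ)
  next
    case (diff a b)
    then show ?case using Jdiff[OF diff] by (simp add: frag_tensor_diff frag_extend_diff algebra_simps)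
  qed (simp add: J0)
  ultimately have "c \<in> J" using Jadd by fastforce
  then show thesis using that by (auto simp: J_def L_def)
qed

section \<open>Vanishing of Tor\<close>

text \<open>A trivial quotient has the boundaries as its only coset. The class of the cycle v lies
  in its own coset, since the boundaries contain the unit, and is therefore a boundary.\<close>

lemma Tor1_trivial_imp_boundary:
  assumes S: "right_module R S" and Q: "left_module R Y"
    and triv: "trivial_group (Tor1 R S Y)"
    and v: "Poly_Mapping.keys v \<subseteq> carrier (res_F1 R S) \<times> carrier Y"
    and dv: "frag_tensor (res_d1 R S) (\<lambda>y. y) v \<in> tensor_kernel R (res_F0 R S) Y"
    and d1: "res_d1 R S \<in> mod_hom R (res_F1 R S) (res_F0 R S)"
    and d2: "res_d2 R S \<in> mod_hom R (res_F2 R S) (res_F1 R S)"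
  obtains w where "Poly_Mapping.keys w \<subseteq> carrier (res_F2 R S) \<times> carrier Y"
    "v - frag_tensor (res_d2 R S) (\<lambda>y. y) w \<in> tensor_kernel R (res_F1 R S) Y"
proof -
  have R: "ring R" by (rule right_module_ring[OF S])
  have p0: "tensor_pair R (res_F0 R S) Y" and p1: "tensor_pair R (res_F1 R S) Y"
    and p2: "tensor_pair R (res_F2 R S) Y"
    using Q R by (auto simp: res_F0_def res_F1_def res_F2_def intro!: tensor_pairI right_module_free)
  let ?coset = "\<lambda>F c. tensor_kernel R F Y #>\<^bsub>free_Abelian_group (carrier F \<times> carrier Y)\<^esub> c"
  define Z where "Z = kernel (tensor R (res_F1 R S) Y) (tensor R (res_F0 R S) Y)
    (tensor_map R (res_F0 R S) Y (res_d1 R S) (\<lambda>x. x))"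
  define B where "B = tensor_map R (res_F1 R S) Y (res_d2 R S) (\<lambda>x. x) ` carrier (tensor R (res_F2 R S) Y)"
  let ?T = "(tensor R (res_F1 R S) Y)\<lparr>carrier := Z\<rparr>"
  have Tor: "Tor1 R S Y = ?T Mod B" by (simp add: Tor1_def Z_def B_def Let_def)
  have B: "B = {?coset (res_F1 R S) (frag_tensor (res_d2 R S) (\<lambda>y. y) w) | w.
      Poly_Mapping.keys w \<subseteq> carrier (res_F2 R S) \<times> carrier Y}"
    unfolding B_def tensor_pair.carrier_tensor[OF p2]
    using tensor_map_coset[OF p2 p1 d2 mod_hom_id] by (auto simp: image_iff)
  have vZ: "?coset (res_F1 R S) v \<in> Z"
    using v dv tensor_map_coset[OF p1 p0 d1 mod_hom_id v]
      tensor_pair.tensor_coset_eq_iff[OF p0, of "frag_tensor (res_d1 R S) (\<lambda>y. y) v" 0]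
      keys_frag_tensor[OF v, of "res_d1 R S" "carrier (res_F0 R S)" "\<lambda>y. y" "carrier Y"] mod_hom_closed[OF d1]
    by (auto simp: Z_def kernel_def tensor_pair.carrier_tensor[OF p1] tensor_pair.one_tensor[OF p0])
  have one: "\<one>\<^bsub>tensor R (res_F1 R S) Y\<^esub> \<in> B"
    unfolding B tensor_pair.one_tensor[OF p1] by (auto intro!: exI[of _ 0])
  have "group (tensor R (res_F1 R S) Y)"
    unfolding tensor_def
    by (intro normal.factorgroup_is_group abelian_free_Abelian_group
      comm_group.normal_iff_subgroup[THEN iffD2] tensor_pair.tensor_kernel_subgroup p1)
  then interpret T: group "tensor R (res_F1 R S) Y" .
  have vT: "?coset (res_F1 R S) v \<in> carrier (tensor R (res_F1 R S) Y)"
    using v by (auto simp: tensor_pair.carrier_tensor[OF p1])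
  have "B #>\<^bsub>?T\<^esub> ?coset (res_F1 R S) v \<in> carrier (Tor1 R S Y)"
    using vZ by (auto simp: Tor FactGroup_def RCOSETS_def)
  moreover have "carrier (Tor1 R S Y) = {B}"
    using triv by (simp add: trivial_group_def Tor FactGroup_def)
  ultimately have "B #>\<^bsub>?T\<^esub> ?coset (res_F1 R S) v = B" by simp
  moreover have "?coset (res_F1 R S) v \<in> B #>\<^bsub>?T\<^esub> ?coset (res_F1 R S) v"
    using one T.l_one[OF vT] by (force simp: r_coset_def)
  ultimately have "?coset (res_F1 R S) v \<in> B" by simp
  then obtain w where w: "Poly_Mapping.keys w \<subseteq> carrier (res_F2 R S) \<times> carrier Y"
    "?coset (res_F1 R S) v = ?coset (res_F1 R S) (frag_tensor (res_d2 R S) (\<lambda>y. y) w)"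
    unfolding B by blast
  moreover have "Poly_Mapping.keys (frag_tensor (res_d2 R S) (\<lambda>y. y) w) \<subseteq> carrier (res_F1 R S) \<times> carrier Y"
    by (rule keys_frag_tensor[OF w(1)]) (use mod_hom_closed[OF d2] in auto)
  ultimately show thesis
    using that tensor_pair.tensor_coset_eq_iff[OF p1 v] by blast
qed

text \<open>A sum u over K0 that vanishes over F0 lifts to a cycle in F1, which is a boundary.
  Viewing d1 as a map onto K0 and applying it to this boundary gives u = 0 over K0, because d1 after
  d2 is zero.\<close>

lemma Tor1_trivial_imp_injective:
  assumes S: "right_module R S" and Q: "left_module R Y" and triv: "trivial_group (Tor1 R S Y)"
  shows "tensor_injective R (res_K0 R S) (res_F0 R S) Y"
proof -
  have R: "ring R" by (rule right_module_ring[OF S])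
  interpret S: right_module R S by (rule S)
  let ?F0 = "res_F0 R S" and ?F1 = "res_F1 R S" and ?F2 = "res_F2 R S"
  let ?K0 = "res_K0 R S" and ?K1 = "res_K1 R S" and ?d1 = "res_d1 R S" and ?d2 = "res_d2 R S"
  have F0: "right_module R ?F0" and F1: "right_module R ?F1" and F2: "right_module R ?F2"
    using R by (auto simp: res_F0_def res_F1_def res_F2_def intro: right_module_free)
  let ?e = "free_eval S (carrier S)"
  have e: "?e \<in> mod_hom R ?F0 S"
    unfolding res_F0_def free_eval_eq_free_lift by (rule free_lift_hom[OF S])
  have K0: "?K0 = {f \<in> carrier ?F0. ?e f = \<zero>\<^bsub>S\<^esub>}"
    by (simp add: res_K0_def a_kernel_def kernel_def)
  have K1: "?K1 = {f \<in> carrier ?F1. ?d1 f = \<zero>\<^bsub>?F0\<^esub>}"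
    by (simp add: res_K1_def a_kernel_def kernel_def)
  have K0_sub: "submodule ?K0 R ?F0"
  proof -
    have "submodule {\<zero>\<^bsub>S\<^esub>} R S" by (rule S.submoduleI) (auto intro: right_module_minus_zero S)
    from submodule_vimage[OF e F0 S this] show ?thesis by (simp add: K0)
  qed
  have K0F: "k \<in> carrier ?F0" if "k \<in> ?K0" for k using that by (simp add: K0)
  have K1F: "k \<in> carrier ?F1" if "k \<in> ?K1" for k using that by (simp add: K1)
  have d1: "?d1 \<in> mod_hom R ?F1 ?F0"
    unfolding res_d1_def res_F1_def free_eval_eq_free_lift by (rule free_lift_hom[OF F0 K0F])
  have d2: "?d2 \<in> mod_hom R ?F2 ?F1"
    unfolding res_d2_def res_F2_def free_eval_eq_free_lift by (rule free_lift_hom[OF F1 K1F])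
  \<comment> \<open>Both composites of consecutive resolution maps are lifts of a family of zeros:
    each map is evaluated on generators taken from the kernel of the next one.\<close>
  have lift0: "free_lift M U b f = \<zero>\<^bsub>M\<^esub>"
    if "right_module R M" "\<And>u. u \<in> U \<Longrightarrow> b u = \<zero>\<^bsub>M\<^esub>" "f \<in> carrier (free_right_module R U)"
    for M :: "('a, 'z) module" and U :: "'y set" and b f
  proof -
    interpret M: right_module R M by fact
    have "gfinprod (add_monoid M) (\<lambda>u. f u \<odot>\<^bsub>M\<^esub> b u) U = gfinprod (add_monoid M) (\<lambda>u. \<zero>\<^bsub>M\<^esub>) U"
      using that(2,3) by (intro M.add.gfinprod_cong) (auto simp: simp_implies_def carrier_free PiE_iff)
    then show ?thesis
      by (simp add: free_lift_def gfinprod_def comm_monoid.finprod_empty[OF M.M.a_comm_monoid])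
  qed
  have d1K: "?d1 f \<in> ?K0" if f: "f \<in> carrier ?F1" for f
  proof -
    have "?e (?d1 f) = free_lift S ?K0 ?e f"
      unfolding res_d1_def free_eval_eq_free_lift[of ?F0] using f
      by (intro free_lift_compose[OF F0 K0F S e]) (simp_all add: res_F1_def)
    also have "\<dots> = \<zero>\<^bsub>S\<^esub>"
      using f by (intro lift0 S) (auto simp: K0 res_F1_def)
    finally show ?thesis using mod_hom_closed[OF d1 f] by (simp add: K0)
  qed
  have dd: "?d1 (?d2 f) = \<zero>\<^bsub>?F0\<^esub>" if f: "f \<in> carrier ?F2" for f
  proof -
    have "?d1 (?d2 f) = free_lift ?F0 ?K1 ?d1 f"
      unfolding res_d2_def free_eval_eq_free_lift[of ?F1] using f
      by (intro free_lift_compose[OF F1 K1F F0 d1]) (simp_all add: res_F2_def)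
    also have "\<dots> = \<zero>\<^bsub>?F0\<^esub>"
      using f by (intro lift0 F0) (auto simp: K1 res_F2_def)
    finally show ?thesis .
  qed
  have pK: "tensor_pair R (?F0\<lparr>carrier := ?K0\<rparr>) Y"
    by (intro tensor_pairI right_module.right_module_submodule F0 K0_sub Q)
  have p1: "tensor_pair R ?F1 Y" by (intro tensor_pairI F1 Q)
  \<comment> \<open>With F0 as codomain nothing new would follow; restricting the codomain to K0 is
    what yields vanishing in the tensor product with K0.\<close>
  have d1K_hom: "?d1 \<in> mod_hom R ?F1 (?F0\<lparr>carrier := ?K0\<rparr>)"
    by (rule mod_hom_into[OF d1]) (use d1K in auto)
  show ?thesis
    unfolding tensor_injective_def
  proof (intro ballI impI)
    fix u assume u: "u \<in> tensor_kernel R ?F0 Y" and ku: "Poly_Mapping.keys u \<subseteq> ?K0 \<times> carrier Y"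
    \<comment> \<open>F1 has a basis vector for each element of K0, so replacing elements of K0 by
      basis vectors lifts u through d1 exactly, not merely modulo relations.\<close>
    let ?v = "frag_tensor (free_basis R ?K0) (\<lambda>y. y) u"
    have kv: "Poly_Mapping.keys ?v \<subseteq> carrier ?F1 \<times> carrier Y"
      by (rule keys_frag_tensor[OF ku]) (auto simp: res_F1_def intro: free_basis_closed[OF R])
    have d1v: "frag_tensor ?d1 (\<lambda>y. y) ?v = u"
      unfolding frag_tensor_compose
      by (rule frag_tensor_id[OF ku])
        (simp_all add: res_d1_def free_eval_eq_free_lift free_lift_basis[OF F0 K0F])
    obtain w where kw: "Poly_Mapping.keys w \<subseteq> carrier ?F2 \<times> carrier Y"
      and w: "?v - frag_tensor ?d2 (\<lambda>y. y) w \<in> tensor_kernel R ?F1 Y"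
      by (rule Tor1_trivial_imp_boundary[OF S Q triv kv _ d1 d2]) (use u d1v in auto)
    have "u - frag_tensor ?d1 (\<lambda>y. y) (frag_tensor ?d2 (\<lambda>y. y) w) \<in> tensor_kernel R (?F0\<lparr>carrier := ?K0\<rparr>) Y"
      using frag_tensor_kernel[OF p1 pK d1K_hom mod_hom_id w] d1v by (simp add: frag_tensor_diff)
    moreover have "frag_tensor ?d1 (\<lambda>y. y) (frag_tensor ?d2 (\<lambda>y. y) w) \<in> tensor_kernel R (?F0\<lparr>carrier := ?K0\<rparr>) Y"
      unfolding frag_tensor_compose
      by (intro tensor_pair.frag_over_zero[OF pK] keys_frag_tensor[OF kw]) (auto simp: dd)
    ultimately show "u \<in> tensor_kernel R (?F0\<lparr>carrier := ?K0\<rparr>) Y"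
      using tensor_pair.tensor_kernel_cong[OF pK] by blast
  qed
qed

section \<open>Split surjections\<close>

text \<open>p is the projection onto A along B, followed by the inverse of the isomorphism from M to
  A.\<close>

lemma iso_to_direct_summand_retract:
  assumes M: "right_module R M" and F: "right_module R F" and iso: "iso_to_direct_summand R M F"
  obtains s p where "s \<in> mod_hom R M F" "p \<in> mod_hom R F M" "\<And>x. x \<in> carrier M \<Longrightarrow> p (s x) = x"
proof -
  interpret M: right_module R M by (rule M)
  interpret F: right_module R F by (rule F)
  obtain A B s where A: "submodule A R F" and B: "submodule B R F" and AB: "A \<inter> B = {\<zero>\<^bsub>F\<^esub>}"
    and sum: "A <+>\<^bsub>F\<^esub> B = carrier F" and s: "s \<in> mod_hom R M (F\<lparr>carrier := A\<rparr>)"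
    and bij: "bij_betw s (carrier M) A"
    using iso by (auto simp: iso_to_direct_summand_def direct_summand_def mod_iso_def)
  have Asub: "A \<subseteq> carrier F" and Bsub: "B \<subseteq> carrier F" by (rule submodule_subset[OF A], rule submodule_subset[OF B])
  have sF: "s \<in> mod_hom R M F" using s Asub by (auto simp: mod_hom_def)
  have sA: "s x \<in> A" if "x \<in> carrier M" for x using mod_hom_closed[OF s that] by simp
  \<comment> \<open>The difference of the two A-components equals a difference of B-components, so
    it lies in the zero intersection.\<close>
  have unique: "x = y" if "x \<in> carrier M" "y \<in> carrier M" "b \<in> B" "c \<in> B" "s x \<oplus>\<^bsub>F\<^esub> b = s y \<oplus>\<^bsub>F\<^esub> c" for x y b c
  proof -
    have c: "s x \<in> carrier F" "s y \<in> carrier F" "b \<in> carrier F" "c \<in> carrier F"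
      using that Bsub mod_hom_closed[OF sF] by auto
    have "s x \<ominus>\<^bsub>F\<^esub> s y = (s x \<oplus>\<^bsub>F\<^esub> b) \<ominus>\<^bsub>F\<^esub> (s y \<oplus>\<^bsub>F\<^esub> b)"
      using c F.M.diff_add_diff[of "s x" "s y" b b] by (simp add: F.M.diff_self)
    also have "\<dots> = (s y \<oplus>\<^bsub>F\<^esub> c) \<ominus>\<^bsub>F\<^esub> (s y \<oplus>\<^bsub>F\<^esub> b)" using that by simp
    also have "\<dots> = c \<ominus>\<^bsub>F\<^esub> b"
      using c F.M.diff_add_diff[of "s y" "s y" c b] by (simp add: F.M.diff_self)
    finally have *: "s x \<ominus>\<^bsub>F\<^esub> s y = c \<ominus>\<^bsub>F\<^esub> b" .
    have "s x \<ominus>\<^bsub>F\<^esub> s y \<in> A" using that sA by (simp add: submodule_diff[OF A])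
    moreover have "s x \<ominus>\<^bsub>F\<^esub> s y \<in> B" unfolding * using that by (simp add: submodule_diff[OF B])
    ultimately have "s x \<ominus>\<^bsub>F\<^esub> s y = \<zero>\<^bsub>F\<^esub>" using AB by blast
    moreover have "(s x \<ominus>\<^bsub>F\<^esub> s y) \<oplus>\<^bsub>F\<^esub> s y = s x"
      using c by (simp add: a_minus_def F.M.a_assoc F.M.l_neg)
    ultimately have "s x = s y" using c by simp
    then show ?thesis using bij that by (auto simp: bij_betw_def inj_on_def)
  qed
  have "\<exists>x\<in>carrier M. \<exists>b\<in>B. f = s x \<oplus>\<^bsub>F\<^esub> b" if f: "f \<in> carrier F" for f
  proof -
    obtain a b where "a \<in> A" "b \<in> B" "f = a \<oplus>\<^bsub>F\<^esub> b"
      using f unfolding sum[symmetric] set_add_def' by blast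
    moreover from this obtain x where "x \<in> carrier M" "a = s x"
      using bij by (auto simp: bij_betw_def)
    ultimately show ?thesis by blast
  qed
  then obtain p b where p: "\<And>f. f \<in> carrier F \<Longrightarrow> p f \<in> carrier M"
    and b: "\<And>f. f \<in> carrier F \<Longrightarrow> b f \<in> B" and f: "\<And>f. f \<in> carrier F \<Longrightarrow> f = s (p f) \<oplus>\<^bsub>F\<^esub> b f"
    by metis
  \<comment> \<open>Any decomposition of f, not only the chosen one, computes p. Linearity then
    follows by exhibiting decompositions of sums and scalar multiples.\<close>
  have p_eq: "p f = x" if "f = s x \<oplus>\<^bsub>F\<^esub> c" "x \<in> carrier M" "c \<in> B" for f x c
  proof -
    have "f \<in> carrier F" using that Bsub mod_hom_closed[OF sF] by auto
    then show ?thesis using unique[of "p f" x "b f" c] p b f that by auto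
  qed
  have "p \<in> mod_hom R F M"
  proof (rule mod_homI)
    fix x y assume xy: "x \<in> carrier F" "y \<in> carrier F"
    have c: "s (p x) \<in> carrier F" "s (p y) \<in> carrier F" "b x \<in> carrier F" "b y \<in> carrier F"
      using xy p b Bsub mod_hom_closed[OF sF] by auto
    have "x \<oplus>\<^bsub>F\<^esub> y = (s (p x) \<oplus>\<^bsub>F\<^esub> b x) \<oplus>\<^bsub>F\<^esub> (s (p y) \<oplus>\<^bsub>F\<^esub> b y)"
      using f[OF xy(1)] f[OF xy(2)] by simp
    also have "\<dots> = s (p x \<oplus>\<^bsub>M\<^esub> p y) \<oplus>\<^bsub>F\<^esub> (b x \<oplus>\<^bsub>F\<^esub> b y)"
      using c xy p by (simp add: mod_hom_add[OF sF] F.M.a_ac)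
    finally show "p (x \<oplus>\<^bsub>F\<^esub> y) = p x \<oplus>\<^bsub>M\<^esub> p y"
      by (rule p_eq) (use xy p b in \<open>auto intro: submodule_add[OF B]\<close>)
  next
    fix r x assume rx: "r \<in> carrier R" "x \<in> carrier F"
    have c: "s (p x) \<in> carrier F" "b x \<in> carrier F"
      using rx p b Bsub mod_hom_closed[OF sF] by auto
    have "r \<odot>\<^bsub>F\<^esub> x = r \<odot>\<^bsub>F\<^esub> (s (p x) \<oplus>\<^bsub>F\<^esub> b x)" using f[OF rx(2)] by simp
    also have "\<dots> = s (r \<odot>\<^bsub>M\<^esub> p x) \<oplus>\<^bsub>F\<^esub> r \<odot>\<^bsub>F\<^esub> b x"
      using c rx p by (simp add: mod_hom_smult[OF sF] F.smult_r_distr)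
    finally show "p (r \<odot>\<^bsub>F\<^esub> x) = r \<odot>\<^bsub>M\<^esub> p x"
      by (rule p_eq) (use rx p b in \<open>auto intro: submodule_smult[OF B] M.smult_closed\<close>)
  qed (use p in auto)
  moreover have "p (s x) = x" if "x \<in> carrier M" for x
    by (rule p_eq[of _ _ "\<zero>\<^bsub>F\<^esub>"]) (use that mod_hom_closed[OF sF] submodule_zero[OF B] in auto)
  ultimately show thesis using that sF by blast
qed

text \<open>Trades the quotient for a surjection with kernel A, so that cosets do not occur in the
  treatment of extensions.\<close>

lemma quotient_iso_surjection:
  assumes B: "right_module R B" and A: "submodule A R B" and C: "right_module R C"
    and iso: "mod_iso R (quotient_module B A) C"
  obtains g where "g \<in> mod_hom R B C" "g ` carrier B = carrier C"
    "{b \<in> carrier B. g b = \<zero>\<^bsub>C\<^esub>} = A"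
proof -
  interpret B: right_module R B by (rule B)
  have sub: "subgroup A (add_monoid B)" by (rule submodule.axioms[OF A])
  then have normal: "A \<lhd> add_monoid B"
    using B.M.a_comm_group comm_group.normal_iff_subgroup by blast
  obtain f where f: "f \<in> mod_hom R (quotient_module B A) C"
    and bij: "bij_betw f (carrier (quotient_module B A)) (carrier C)"
    using iso by (auto simp: mod_iso_def)
  have car: "carrier (quotient_module B A) = (\<lambda>b. A +>\<^bsub>B\<^esub> b) ` carrier B"
    by (auto simp: quotient_module_def A_RCOSETS_def')
  have add: "(A +>\<^bsub>B\<^esub> x) \<oplus>\<^bsub>quotient_module B A\<^esub> (A +>\<^bsub>B\<^esub> y) = A +>\<^bsub>B\<^esub> (x \<oplus>\<^bsub>B\<^esub> y)"
    if "x \<in> carrier B" "y \<in> carrier B" for x y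
    using normal.rcos_sum[OF normal, of x y] that
    by (simp add: quotient_module_def set_add_def a_r_coset_def)
  have coset_eq: "A +>\<^bsub>B\<^esub> x = A +>\<^bsub>B\<^esub> y" if "x \<in> A +>\<^bsub>B\<^esub> y" "y \<in> carrier B" for x y
    by (rule B.M.a_repr_independence[OF that sub, symmetric])
  have mem: "x \<in> A +>\<^bsub>B\<^esub> x" if "x \<in> carrier B" for x
    using that submodule_zero[OF A] by (auto simp: a_r_coset_def' intro!: bexI[of _ "\<zero>\<^bsub>B\<^esub>"])
  \<comment> \<open>The scalar action on a coset is a union over its members; all the cosets united
    coincide because A is closed under scalars.\<close>
  have smult: "r \<odot>\<^bsub>quotient_module B A\<^esub> (A +>\<^bsub>B\<^esub> x) = A +>\<^bsub>B\<^esub> (r \<odot>\<^bsub>B\<^esub> x)"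
    if r: "r \<in> carrier R" and x: "x \<in> carrier B" for r x
  proof -
    have "A +>\<^bsub>B\<^esub> (r \<odot>\<^bsub>B\<^esub> y) = A +>\<^bsub>B\<^esub> (r \<odot>\<^bsub>B\<^esub> x)" if y: "y \<in> A +>\<^bsub>B\<^esub> x" for y
    proof -
      obtain a where a: "a \<in> A" "y = a \<oplus>\<^bsub>B\<^esub> x" using y unfolding a_r_coset_def' by blast
      have aB: "a \<in> carrier B" using a submodule_subset[OF A] by auto
      have "r \<odot>\<^bsub>B\<^esub> y = r \<odot>\<^bsub>B\<^esub> a \<oplus>\<^bsub>B\<^esub> r \<odot>\<^bsub>B\<^esub> x"
        using a aB r x by (simp add: B.smult_r_distr)
      then have "r \<odot>\<^bsub>B\<^esub> y \<in> A +>\<^bsub>B\<^esub> (r \<odot>\<^bsub>B\<^esub> x)"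
        using submodule_smult[OF A r a(1)] unfolding a_r_coset_def' by blast
      then show ?thesis by (rule coset_eq) (rule B.smult_closed[OF r x])
    qed
    then have "(\<Union>y\<in>A +>\<^bsub>B\<^esub> x. A +>\<^bsub>B\<^esub> (r \<odot>\<^bsub>B\<^esub> y)) = A +>\<^bsub>B\<^esub> (r \<odot>\<^bsub>B\<^esub> x)"
      using mem[OF x] by blast
    then show ?thesis by (simp add: quotient_module_def)
  qed
  define g where "g b = f (A +>\<^bsub>B\<^esub> b)" for b
  have "g \<in> mod_hom R B C"
  proof (rule mod_homI)
    show "g x \<in> carrier C" if "x \<in> carrier B" for x
      using that mod_hom_closed[OF f] by (simp add: g_def car)
    show "g (x \<oplus>\<^bsub>B\<^esub> y) = g x \<oplus>\<^bsub>C\<^esub> g y" if "x \<in> carrier B" "y \<in> carrier B" for x y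
      unfolding g_def add[OF that, symmetric] by (rule mod_hom_add[OF f]) (use that in \<open>simp_all add: car\<close>)
    show "g (r \<odot>\<^bsub>B\<^esub> x) = r \<odot>\<^bsub>C\<^esub> g x" if "r \<in> carrier R" "x \<in> carrier B" for r x
      unfolding g_def smult[OF that, symmetric] by (rule mod_hom_smult[OF f]) (use that in \<open>simp_all add: car\<close>)
  qed
  moreover have "g ` carrier B = carrier C"
    using bij_betw_imp_surj_on[OF bij] by (simp add: g_def car image_image)
  moreover have "{b \<in> carrier B. g b = \<zero>\<^bsub>C\<^esub>} = A"
  proof -
    have A0: "A +>\<^bsub>B\<^esub> \<zero>\<^bsub>B\<^esub> = A"
      using submodule_subset[OF A] by (auto simp: a_r_coset_def' subset_iff) 
    have g0: "g \<zero>\<^bsub>B\<^esub> = \<zero>\<^bsub>C\<^esub>"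
      by (rule mod_hom_zero[OF \<open>g \<in> mod_hom R B C\<close> B.M.abelian_group_axioms right_module_abelian_group[OF C]])
    have "g b = \<zero>\<^bsub>C\<^esub> \<longleftrightarrow> b \<in> A" if b: "b \<in> carrier B" for b
    proof -
      have "g b = \<zero>\<^bsub>C\<^esub> \<longleftrightarrow> A +>\<^bsub>B\<^esub> b = A +>\<^bsub>B\<^esub> \<zero>\<^bsub>B\<^esub>"
        using inj_on_eq_iff[OF bij_betw_imp_inj_on[OF bij], of "A +>\<^bsub>B\<^esub> b" "A +>\<^bsub>B\<^esub> \<zero>\<^bsub>B\<^esub>"] b g0
        by (simp add: g_def car)
      also have "\<dots> \<longleftrightarrow> b \<in> A"
        using A0 mem[OF b] coset_eq[of b "\<zero>\<^bsub>B\<^esub>"] B.M.zero_closed by metis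
      finally show ?thesis .
    qed
    then show ?thesis using submodule_subset[OF A] by auto
  qed
  ultimately show thesis using that by blast
qed

section \<open>Mittag-Leffler modules\<close>

lemma product_projection_hom: "i \<in> I \<Longrightarrow> (\<lambda>q. q i) \<in> mod_hom R (product_module I Q) (Q i)"
  by (intro mod_homI) (auto simp: product_module_def)

text \<open>Trivial kernel of the canonical map for a single family. The family can be kept fixed
  throughout, as every closure property below relates different modules for the same family.\<close>

definition product_injective ::
    "('r, 'u) ring_scheme \<Rightarrow> ('r, 'm) module \<Rightarrow> 'i set \<Rightarrow> ('i \<Rightarrow> ('r, 'q) module) \<Rightarrow> bool"
  where "product_injective R M I Q \<longleftrightarrow>
    (\<forall>c. Poly_Mapping.keys c \<subseteq> carrier M \<times> carrier (product_module I Q) \<longrightarrow>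
      (\<forall>i\<in>I. frag_tensor (\<lambda>x. x) (\<lambda>q. q i) c \<in> tensor_kernel R M (Q i)) \<longrightarrow>
      c \<in> tensor_kernel R M (product_module I Q))"

lemma product_injectiveD:
  assumes "product_injective R M I Q"
    and "Poly_Mapping.keys c \<subseteq> carrier M \<times> carrier (product_module I Q)"
    and "\<And>i. i \<in> I \<Longrightarrow> frag_tensor (\<lambda>x. x) (\<lambda>q. q i) c \<in> tensor_kernel R M (Q i)"
  shows "c \<in> tensor_kernel R M (product_module I Q)"
  using assms by (simp add: product_injective_def)

lemma keys_projection:
  assumes "Poly_Mapping.keys c \<subseteq> A \<times> carrier (product_module I Q)" "i \<in> I"
  shows "Poly_Mapping.keys (frag_tensor (\<lambda>x. x) (\<lambda>q. q i) c) \<subseteq> A \<times> carrier (Q i)"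
  by (rule keys_frag_tensor[OF assms(1)]) (use assms(2) in \<open>auto simp: product_module_def\<close>)

text \<open>The canonical map is computed on representatives, and two of them have the same image
  iff their difference is killed by every projection. Injectivity is thereby reduced to a trivial
  kernel.\<close>

lemma inj_tensor_product_map_iff:
  assumes M: "right_module R M" and Q: "\<And>i. i \<in> I \<Longrightarrow> left_module R (Q i)"
  shows "inj_on (tensor_product_map R M I Q) (carrier (tensor R M (product_module I Q))) \<longleftrightarrow>
    product_injective R M I Q"
proof -
  let ?P = "product_module I Q"
  have P: "left_module R ?P" by (intro left_module_product right_module_ring[OF M] Q)
  interpret P: tensor_pair R M ?P by (intro tensor_pairI M P)
  have pair: "tensor_pair R M (Q i)" if "i \<in> I" for i by (intro tensor_pairI M Q that)
  let ?coset = "\<lambda>Q c. tensor_kernel R M Q #>\<^bsub>free_Abelian_group (carrier M \<times> carrier Q)\<^esub> c"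
  have map: "tensor_product_map R M I Q (?coset ?P c) =
      (\<lambda>i\<in>I. ?coset (Q i) (frag_tensor (\<lambda>x. x) (\<lambda>q. q i) c))"
    if "Poly_Mapping.keys c \<subseteq> carrier M \<times> carrier ?P" for c
    unfolding tensor_product_map_def
    by (intro restrict_ext tensor_map_coset[OF P.tensor_pair_axioms pair mod_hom_id product_projection_hom that])
  have map_eq: "tensor_product_map R M I Q (?coset ?P c) = tensor_product_map R M I Q (?coset ?P d) \<longleftrightarrow>
      (\<forall>i\<in>I. frag_tensor (\<lambda>x. x) (\<lambda>q. q i) (c - d) \<in> tensor_kernel R M (Q i))"
    if c: "Poly_Mapping.keys c \<subseteq> carrier M \<times> carrier ?P" and d: "Poly_Mapping.keys d \<subseteq> carrier M \<times> carrier ?P" for c d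
  proof -
    have "tensor_product_map R M I Q (?coset ?P c) = tensor_product_map R M I Q (?coset ?P d) \<longleftrightarrow>
      (\<forall>i\<in>I. ?coset (Q i) (frag_tensor (\<lambda>x. x) (\<lambda>q. q i) c) = ?coset (Q i) (frag_tensor (\<lambda>x. x) (\<lambda>q. q i) d))"
      unfolding map[OF c] map[OF d] by (auto simp: restrict_def fun_eq_iff)
    also have "\<dots> \<longleftrightarrow> (\<forall>i\<in>I. frag_tensor (\<lambda>x. x) (\<lambda>q. q i) (c - d) \<in> tensor_kernel R M (Q i))"
      unfolding frag_tensor_diff
      by (intro ball_cong refl tensor_pair.tensor_coset_eq_iff pair keys_projection) (simp_all add: c d)
    finally show ?thesis .
  qed
  show ?thesis
  proof
    assume inj: "inj_on (tensor_product_map R M I Q) (carrier (tensor R M ?P))"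
    show "product_injective R M I Q"
      unfolding product_injective_def
    proof (intro allI impI)
      fix c assume c: "Poly_Mapping.keys c \<subseteq> carrier M \<times> carrier ?P"
        and ci: "\<forall>i\<in>I. frag_tensor (\<lambda>x. x) (\<lambda>q. q i) c \<in> tensor_kernel R M (Q i)"
      have "?coset ?P c = ?coset ?P 0"
      proof (rule inj_onD[OF inj])
        show "tensor_product_map R M I Q (?coset ?P c) = tensor_product_map R M I Q (?coset ?P 0)"
          using ci by (subst map_eq[OF c]) simp_all
        show "?coset ?P c \<in> carrier (tensor R M ?P)" unfolding P.carrier_tensor using c by blast
        show "?coset ?P 0 \<in> carrier (tensor R M ?P)"
          unfolding P.carrier_tensor by (rule CollectI, intro exI[of _ 0] conjI) simp_all
      qed
      then show "c \<in> tensor_kernel R M ?P"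
        using P.tensor_coset_eq_iff[OF c, of 0] by simp
    qed
  next
    assume prod: "product_injective R M I Q"
    show "inj_on (tensor_product_map R M I Q) (carrier (tensor R M ?P))"
    proof (rule inj_onI)
      fix t u assume "t \<in> carrier (tensor R M ?P)" "u \<in> carrier (tensor R M ?P)"
        and eq: "tensor_product_map R M I Q t = tensor_product_map R M I Q u"
      then obtain c d where c: "Poly_Mapping.keys c \<subseteq> carrier M \<times> carrier ?P" "t = ?coset ?P c"
        and d: "Poly_Mapping.keys d \<subseteq> carrier M \<times> carrier ?P" "u = ?coset ?P d"
        unfolding P.carrier_tensor by blast
      have "Poly_Mapping.keys (c - d) \<subseteq> carrier M \<times> carrier ?P"
        using c d keys_diff[of c d] by blast
      then have "c - d \<in> tensor_kernel R M ?P"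
        using eq map_eq[OF c(1) d(1)] c d by (intro product_injectiveD[OF prod]) auto
      then show "t = u" using P.tensor_coset_eq_iff[OF c(1) d(1)] c d by simp
    qed
  qed
qed

text \<open>Naturality of the canonical map in the module: c is pushed into F, vanishes there, and
  is recovered unchanged by p.\<close>

lemma product_injective_retract:
  assumes M: "right_module R M" and F: "right_module R F"
    and Q: "\<And>i. i \<in> I \<Longrightarrow> left_module R (Q i)"
    and s: "s \<in> mod_hom R M F" and p: "p \<in> mod_hom R F M" and ps: "\<And>x. x \<in> carrier M \<Longrightarrow> p (s x) = x"
    and inj: "product_injective R F I Q"
  shows "product_injective R M I Q"
  unfolding product_injective_def
proof (intro allI impI)
  let ?P = "product_module I Q"
  fix c assume c: "Poly_Mapping.keys c \<subseteq> carrier M \<times> carrier ?P"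
    and ci: "\<forall>i\<in>I. frag_tensor (\<lambda>x. x) (\<lambda>q. q i) c \<in> tensor_kernel R M (Q i)"
  have P: "left_module R ?P" by (intro left_module_product right_module_ring[OF M] Q)
  let ?d = "frag_tensor s (\<lambda>q. q) c"
  have "?d \<in> tensor_kernel R F ?P"
  proof (rule product_injectiveD[OF inj])
    show "Poly_Mapping.keys ?d \<subseteq> carrier F \<times> carrier ?P"
      by (rule keys_frag_tensor[OF c]) (use mod_hom_closed[OF s] in auto)
    fix i assume i: "i \<in> I"
    have "frag_tensor s (\<lambda>q. q) (frag_tensor (\<lambda>x. x) (\<lambda>q. q i) c) \<in> tensor_kernel R F (Q i)"
      by (rule frag_tensor_kernel[OF _ _ s mod_hom_id]) (use ci i in \<open>auto intro!: tensor_pairI M F Q\<close>)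
    then show "frag_tensor (\<lambda>x. x) (\<lambda>q. q i) ?d \<in> tensor_kernel R F (Q i)"
      by (simp add: frag_tensor_compose)
  qed
  then have "frag_tensor p (\<lambda>q. q) ?d \<in> tensor_kernel R M ?P"
    by (rule frag_tensor_kernel[OF _ _ p mod_hom_id, rotated 2]) (intro tensor_pairI M F P)+
  then show "c \<in> tensor_kernel R M ?P"
    using frag_tensor_id[OF c, of "\<lambda>x. p (s x)" "\<lambda>q. q"] ps by (simp add: frag_tensor_compose)
qed

text \<open>Once \<open>tensor_right_exact\<close> has replaced c by a sum l over A, each projection
  of l vanishes over B. Injectivity for the single factor \<open>Q i\<close> brings this down to A,
  and only there is the product formed again, through \<open>injA\<close>.\<close>

lemma product_injective_extension:
  assumes B: "right_module R B" and C: "right_module R C"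
    and Q: "\<And>i. i \<in> I \<Longrightarrow> left_module R (Q i)"
    and g: "g \<in> mod_hom R B C" and surj: "g ` carrier B = carrier C"
    and ker: "{b \<in> carrier B. g b = \<zero>\<^bsub>C\<^esub>} = A" and A: "submodule A R B"
    and tens: "\<And>i. i \<in> I \<Longrightarrow> tensor_injective R A B (Q i)"
    and injA: "product_injective R (B\<lparr>carrier := A\<rparr>) I Q" and injC: "product_injective R C I Q"
  shows "product_injective R B I Q"
  unfolding product_injective_def
proof (intro allI impI)
  let ?P = "product_module I Q" and ?A = "B\<lparr>carrier := A\<rparr>"
  fix c assume c: "Poly_Mapping.keys c \<subseteq> carrier B \<times> carrier ?P"
    and ci: "\<forall>i\<in>I. frag_tensor (\<lambda>x. x) (\<lambda>q. q i) c \<in> tensor_kernel R B (Q i)"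
  have P: "left_module R ?P" by (intro left_module_product right_module_ring[OF B] Q)
  have pB: "tensor_pair R B ?P" by (intro tensor_pairI B P)
  let ?d = "frag_tensor g (\<lambda>q. q) c"
  have "?d \<in> tensor_kernel R C ?P"
  proof (rule product_injectiveD[OF injC])
    show "Poly_Mapping.keys ?d \<subseteq> carrier C \<times> carrier ?P"
      by (rule keys_frag_tensor[OF c]) (use mod_hom_closed[OF g] in auto)
    fix i assume i: "i \<in> I"
    have "frag_tensor g (\<lambda>q. q) (frag_tensor (\<lambda>x. x) (\<lambda>q. q i) c) \<in> tensor_kernel R C (Q i)"
      by (rule frag_tensor_kernel[OF _ _ g mod_hom_id]) (use ci i in \<open>auto intro!: tensor_pairI B C Q\<close>)
    then show "frag_tensor (\<lambda>x. x) (\<lambda>q. q i) ?d \<in> tensor_kernel R C (Q i)"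
      by (simp add: frag_tensor_compose)
  qed
  then obtain l where l: "Poly_Mapping.keys l \<subseteq> A \<times> carrier ?P" and cl: "c - l \<in> tensor_kernel R B ?P"
    by (rule tensor_right_exact[OF B C P g surj c, unfolded ker])
  have "l \<in> tensor_kernel R ?A ?P"
  proof (rule product_injectiveD[OF injA])
    show "Poly_Mapping.keys l \<subseteq> carrier ?A \<times> carrier ?P" using l by simp
    fix i assume i: "i \<in> I"
    have pi: "tensor_pair R B (Q i)" by (intro tensor_pairI B Q i)
    have "frag_tensor (\<lambda>x. x) (\<lambda>q. q i) (c - l) \<in> tensor_kernel R B (Q i)"
      by (rule frag_tensor_kernel[OF pB pi mod_hom_id product_projection_hom[OF i] cl])
    then have "frag_tensor (\<lambda>x. x) (\<lambda>q. q i) l \<in> tensor_kernel R B (Q i)"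
      using ci i tensor_pair.tensor_kernel_cong[OF pi] by (auto simp: frag_tensor_diff)
    then show "frag_tensor (\<lambda>x. x) (\<lambda>q. q i) l \<in> tensor_kernel R ?A (Q i)"
      by (rule tensor_injectiveD[OF tens[OF i]]) (rule keys_projection[OF l i])
  qed
  then have "l \<in> tensor_kernel R B ?P" by (rule tensor_kernel_mono[OF B A P])
  then show "c \<in> tensor_kernel R B ?P"
    using cl tensor_pair.tensor_kernel_cong[OF pB] by blast
qed

lemma product_injective_zero:
  assumes M: "right_module R M" and Q: "\<And>i. i \<in> I \<Longrightarrow> left_module R (Q i)"
    and "carrier M = {\<zero>\<^bsub>M\<^esub>}"
  shows "product_injective R M I Q"
proof -
  have "tensor_pair R M (product_module I Q)"
    by (intro tensor_pairI M left_module_product right_module_ring[OF M] Q)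
  from tensor_pair.frag_over_zero[OF this] show ?thesis
    using assms(3) by (simp add: product_injective_def)
qed

section \<open>Projective modules\<close>

text \<open>f is the sum of its basis vectors times coefficients, and the balancing relation moves
  each coefficient to the other side. The induction removes one coordinate of f at a time.\<close>

lemma frag_of_free_expansion:
  assumes R: "ring R" and P: "left_module R P" and q: "q \<in> carrier P"
    and fin: "finite Z" and Z: "Z \<subseteq> Y" and f: "f \<in> carrier (free_right_module R Y)"
    and supp: "\<And>y. y \<in> Y - Z \<Longrightarrow> f y = \<zero>\<^bsub>R\<^esub>"
  shows "frag_of (f, q) - (\<Sum>y\<in>Z. frag_of (free_basis R Y y, f y \<odot>\<^bsub>P\<^esub> q))
    \<in> tensor_kernel R (free_right_module R Y) P"
  using fin Z f supp
proof (induction Z arbitrary: f)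
  case empty
  interpret tensor_pair R "free_right_module R Y" P by (intro tensor_pairI right_module_free R P)
  have "f = \<zero>\<^bsub>free_right_module R Y\<^esub>"
    using empty by (auto simp: zero_free carrier_free PiE_iff extensional_def)
  then show ?case using tensor_kernel_zero_left[OF q] by simp
next
  case (insert z Z)
  interpret R: ring R by (rule R)
  interpret P: left_module R P by (rule P)
  let ?F = "free_right_module R Y" and ?e = "free_basis R Y"
  interpret tensor_pair R ?F P by (intro tensor_pairI right_module_free R P)
  have fR: "f y \<in> carrier R" if "y \<in> Y" for y using insert.prems that by (auto simp: carrier_free)
  have z: "z \<in> Y" using insert.prems by simp
  \<comment> \<open>f with its coordinate at z set to zero, so that its support fits into the
    smaller set.\<close>
  define f' where "f' = (\<lambda>y\<in>Y. if y = z then \<zero>\<^bsub>R\<^esub> else f y)"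
  have "finite {y\<in>Y. f y \<noteq> \<zero>\<^bsub>R\<^esub>}" using insert.prems by (simp add: carrier_free)
  then have "finite {y\<in>Y. f' y \<noteq> \<zero>\<^bsub>R\<^esub>}"
    by (rule rev_finite_subset) (auto simp: f'_def)
  then have f': "f' \<in> carrier ?F" using fR by (auto simp: carrier_free f'_def)
  have e: "?e z \<in> carrier ?F" by (rule free_basis_closed[OF R])
  have ez: "f z \<odot>\<^bsub>?F\<^esub> ?e z \<in> carrier ?F" by (rule M.smult_closed[OF fR[OF z] e])
  have split: "f = f' \<oplus>\<^bsub>?F\<^esub> f z \<odot>\<^bsub>?F\<^esub> ?e z"
  proof
    fix y
    show "f y = (f' \<oplus>\<^bsub>?F\<^esub> f z \<odot>\<^bsub>?F\<^esub> ?e z) y"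
      using fR z insert.prems(2)
      by (cases "y \<in> Y") (auto simp: add_free smult_free f'_def free_basis_def carrier_free PiE_iff extensional_def)
  qed
  have "frag_of (f', q) - (\<Sum>y\<in>Z. frag_of (?e y, f' y \<odot>\<^bsub>P\<^esub> q)) \<in> tensor_kernel R ?F P"
    by (rule insert.IH[OF _ f']) (use insert.prems in \<open>auto simp: f'_def\<close>)
  moreover have "(\<Sum>y\<in>Z. frag_of (?e y, f' y \<odot>\<^bsub>P\<^esub> q)) = (\<Sum>y\<in>Z. frag_of (?e y, f y \<odot>\<^bsub>P\<^esub> q))"
    using insert.hyps insert.prems by (intro sum.cong) (auto simp: f'_def)
  ultimately have 1: "frag_of (f', q) - (\<Sum>y\<in>Z. frag_of (?e y, f y \<odot>\<^bsub>P\<^esub> q)) \<in> tensor_kernel R ?F P"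
    by simp
  have 2: "frag_of (f, q) - frag_of (f', q) - frag_of (f z \<odot>\<^bsub>?F\<^esub> ?e z, q) \<in> tensor_kernel R ?F P"
    using tensor_kernel_add_left[OF f' ez q] by (simp flip: split)
  have 3: "frag_of (f z \<odot>\<^bsub>?F\<^esub> ?e z, q) - frag_of (?e z, f z \<odot>\<^bsub>P\<^esub> q) \<in> tensor_kernel R ?F P"
    by (rule tensor_kernel_smult[OF fR[OF z] e q])
  show ?case
    using tensor_kernel_add[OF tensor_kernel_add[OF 1 2] 3] insert.hyps by (simp add: algebra_simps)
qed

text \<open>Existence of coordinates. The finite set Z is fixed in advance as a common bound for all
  supports, which lets the expansions of two sums be subtracted coefficient by coefficient.\<close>

lemma tensor_free_expansion:
  assumes R: "ring R" and P: "left_module R P" and fin: "finite Z" and Z: "Z \<subseteq> Y"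
    and c: "Poly_Mapping.keys c \<subseteq>
      {f \<in> carrier (free_right_module R Y). \<forall>y\<in>Y - Z. f y = \<zero>\<^bsub>R\<^esub>} \<times> carrier P"
  shows "\<exists>p. p \<in> Z \<rightarrow> carrier P \<and>
    c - (\<Sum>y\<in>Z. frag_of (free_basis R Y y, p y)) \<in> tensor_kernel R (free_right_module R Y) P"
proof -
  let ?F = "free_right_module R Y" and ?e = "free_basis R Y"
  interpret tensor_pair R ?F P by (intro tensor_pairI right_module_free R P)
  show ?thesis
    using c
  proof (induction c rule: frag_induction)
    case zero
    show ?case
      by (intro exI[of _ "\<lambda>_. \<zero>\<^bsub>P\<^esub>"])
        (auto intro!: tensor_kernel_minus tensor_kernel_sum tensor_kernel_zero_right free_basis_closed[OF R])
  next
    case (one x)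
    then obtain f q where "x = (f, q)" "f \<in> carrier ?F" "\<forall>y\<in>Y - Z. f y = \<zero>\<^bsub>R\<^esub>" "q \<in> carrier P" by auto
    moreover from this have "(\<lambda>y. f y \<odot>\<^bsub>P\<^esub> q) \<in> Z \<rightarrow> carrier P"
      using Z by (auto simp: carrier_free intro!: Q.smult_closed)
    ultimately show ?case
      using frag_of_free_expansion[OF R P _ fin Z, of q f] by blast
  next
    case (diff a b)
    then obtain p p' where p: "p \<in> Z \<rightarrow> carrier P" "p' \<in> Z \<rightarrow> carrier P"
      and a: "a - (\<Sum>y\<in>Z. frag_of (?e y, p y)) \<in> tensor_kernel R ?F P"
      and b: "b - (\<Sum>y\<in>Z. frag_of (?e y, p' y)) \<in> tensor_kernel R ?F P" by blast
    have "(\<Sum>y\<in>Z. frag_of (?e y, p y) - frag_of (?e y, p' y) - frag_of (?e y, p y \<ominus>\<^bsub>P\<^esub> p' y))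
        \<in> tensor_kernel R ?F P"
      by (intro tensor_kernel_sum tensor_kernel_diff_right) (use p in \<open>auto intro: free_basis_closed[OF R]\<close>)
    from tensor_kernel_add[OF tensor_kernel_diff[OF a b] this]
    have "a - b - (\<Sum>y\<in>Z. frag_of (?e y, p y \<ominus>\<^bsub>P\<^esub> p' y)) \<in> tensor_kernel R ?F P"
      by (simp add: sum_subtractf sum.distrib algebra_simps)
    moreover have "(\<lambda>y. p y \<ominus>\<^bsub>P\<^esub> p' y) \<in> Z \<rightarrow> carrier P" using p by auto
    ultimately show ?case by blast
  qed
qed

text \<open>Uniqueness of coordinates: sending f \<otimes> q to the product of f y and q is
  balanced, and it picks out p y from the expansion.\<close>

lemma tensor_free_coefficient:
  assumes R: "ring R" and Q: "left_module R Q" and fin: "finite Z" and Z: "Z \<subseteq> Y"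
    and p: "p \<in> Z \<rightarrow> carrier Q"
    and ker: "(\<Sum>y\<in>Z. frag_of (free_basis R Y y, p y)) \<in> tensor_kernel R (free_right_module R Y) Q"
    and y: "y \<in> Z"
  shows "p y = \<zero>\<^bsub>Q\<^esub>"
proof -
  interpret R: ring R by (rule R)
  let ?F = "free_right_module R Y" and ?e = "free_basis R Y"
  interpret tensor_pair R ?F Q by (intro tensor_pairI right_module_free R Q)
  have yY: "y \<in> Y" using y Z by auto
  have fR: "f y \<in> carrier R" if "f \<in> carrier ?F" for f using that yY by (auto simp: carrier_free)
  let ?A = "free_Abelian_group (carrier ?F \<times> carrier Q)"
  obtain h where h: "h \<in> hom ?A (add_monoid Q)"
    and h_of: "\<And>f q. f \<in> carrier ?F \<Longrightarrow> q \<in> carrier Q \<Longrightarrow> h (frag_of (f, q)) = f y \<odot>\<^bsub>Q\<^esub> q"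
    and h_ker: "\<And>c. c \<in> tensor_kernel R ?F Q \<Longrightarrow> h c = \<one>\<^bsub>add_monoid Q\<^esub>"
  proof (rule balanced_map_vanishes[of "add_monoid Q" "\<lambda>f q. f y \<odot>\<^bsub>Q\<^esub> q"])
    show "comm_group (add_monoid Q)" by (rule Q.M.a_comm_group)
  qed (use fR yY in \<open>auto simp: add_free smult_free Q.smult_closed Q.smult_l_distr Q.smult_r_distr Q.smult_assoc\<close>)
  have h_add: "h (a + b) = h a \<oplus>\<^bsub>Q\<^esub> h b"
    if "Poly_Mapping.keys a \<subseteq> carrier ?F \<times> carrier Q" "Poly_Mapping.keys b \<subseteq> carrier ?F \<times> carrier Q" for a b
    using hom_mult[OF h, of a b] that by simp
  have e: "?e x \<in> carrier ?F" for x by (rule free_basis_closed[OF R])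
  have keys: "Poly_Mapping.keys (\<Sum>x\<in>T. frag_of (?e x, p x)) \<subseteq> carrier ?F \<times> carrier Q" if "T \<subseteq> Z" for T
    using sum_closed_free_Abelian_group[of T "\<lambda>x. frag_of (?e x, p x)" "carrier ?F \<times> carrier Q"] e p that by auto
  have rest: "h (\<Sum>x\<in>T. frag_of (?e x, p x)) = \<zero>\<^bsub>Q\<^esub>" if "finite T" "T \<subseteq> Z - {y}" for T
    using that
  proof (induction T)
    case empty
    then show ?case using h_ker[OF tensor_kernel_zero] by simp
  next
    case (insert x T)
    have "h (frag_of (?e x, p x)) = \<zero>\<^bsub>Q\<^esub>"
      using insert.prems p e yY by (auto simp: h_of free_basis_def Pi_iff)
    moreover have "T \<subseteq> Z" using insert.prems by auto
    ultimately show ?case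
      using insert e p by (auto simp: h_add keys Pi_iff)
  qed
  have "\<zero>\<^bsub>Q\<^esub> = h (\<Sum>x\<in>Z. frag_of (?e x, p x))" using h_ker[OF ker] by simp
  also have "\<dots> = h (frag_of (?e y, p y) + (\<Sum>x\<in>Z - {y}. frag_of (?e x, p x)))"
    using fin y by (simp add: sum.remove)
  also have "\<dots> = p y"
  proof -
    have py: "p y \<in> carrier Q" using p y by auto
    have "Poly_Mapping.keys (frag_of (?e y, p y)) \<subseteq> carrier ?F \<times> carrier Q" using py e by simp
    then have "h (frag_of (?e y, p y) + (\<Sum>x\<in>Z - {y}. frag_of (?e x, p x))) = h (frag_of (?e y, p y)) \<oplus>\<^bsub>Q\<^esub> \<zero>\<^bsub>Q\<^esub>"
      using fin by (simp add: h_add keys rest)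
    also have "h (frag_of (?e y, p y)) = p y"
      using h_of[OF e py] py yY by (simp add: free_basis_def Q.smult_one)
    finally show ?thesis using py by simp
  qed
  finally show ?thesis by simp
qed

lemma product_injective_free:
  assumes R: "ring R" and Q: "\<And>i. i \<in> I \<Longrightarrow> left_module R (Q i)"
  shows "product_injective R (free_right_module R Y) I Q"
  unfolding product_injective_def
proof (intro allI impI)
  let ?P = "product_module I Q" and ?F = "free_right_module R Y" and ?e = "free_basis R Y"
  fix c assume c: "Poly_Mapping.keys c \<subseteq> carrier ?F \<times> carrier ?P"
    and ci: "\<forall>i\<in>I. frag_tensor (\<lambda>x. x) (\<lambda>q. q i) c \<in> tensor_kernel R ?F (Q i)"
  have P: "left_module R ?P" by (intro left_module_product R Q)
  interpret tensor_pair R ?F ?P by (intro tensor_pairI right_module_free R P)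
  \<comment> \<open>The union of the finitely many finite supports of the functions that occur in
    c.\<close>
  define Z where "Z = (\<Union>(f, q)\<in>Poly_Mapping.keys c. {y\<in>Y. f y \<noteq> \<zero>\<^bsub>R\<^esub>})"
  have fin: "finite Z" unfolding Z_def using c by (auto simp: carrier_free)
  have Z: "Z \<subseteq> Y" by (auto simp: Z_def)
  have "Poly_Mapping.keys c \<subseteq> {f \<in> carrier ?F. \<forall>y\<in>Y - Z. f y = \<zero>\<^bsub>R\<^esub>} \<times> carrier ?P"
    using c by (fastforce simp: Z_def)
  from tensor_free_expansion[OF R P fin Z this] obtain p where p: "p \<in> Z \<rightarrow> carrier ?P"
    and cp: "c - (\<Sum>y\<in>Z. frag_of (?e y, p y)) \<in> tensor_kernel R ?F ?P" by blast
  \<comment> \<open>The i-th entries of the coefficients of c are the coefficients of its i-th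
    projection, which vanishes by assumption.\<close>
  have "p y i = \<zero>\<^bsub>Q i\<^esub>" if i: "i \<in> I" and y: "y \<in> Z" for i y
  proof -
    have pi: "tensor_pair R ?F (Q i)" by (intro tensor_pairI right_module_free R Q i)
    have "frag_tensor (\<lambda>x. x) (\<lambda>q. q i) (c - (\<Sum>y\<in>Z. frag_of (?e y, p y))) \<in> tensor_kernel R ?F (Q i)"
      by (rule frag_tensor_kernel[OF tensor_pair_axioms pi mod_hom_id product_projection_hom[OF i] cp])
    then have "frag_tensor (\<lambda>x. x) (\<lambda>q. q i) c - (\<Sum>y\<in>Z. frag_of (?e y, p y i)) \<in> tensor_kernel R ?F (Q i)"
      using fin by (simp add: frag_tensor_diff frag_tensor_sum)
    then have "(\<Sum>y\<in>Z. frag_of (?e y, p y i)) \<in> tensor_kernel R ?F (Q i)"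
      using ci i tensor_pair.tensor_kernel_cong[OF pi] by blast
    then show ?thesis
      by (rule tensor_free_coefficient[OF R Q[OF i] fin Z _ _ y, rotated])
        (use p i in \<open>auto simp: product_module_def\<close>)
  qed
  then have "p y = \<zero>\<^bsub>?P\<^esub>" if "y \<in> Z" for y
    using p that by (auto simp: product_module_def PiE_iff extensional_def fun_eq_iff)
  then have "(\<Sum>y\<in>Z. frag_of (?e y, p y)) \<in> tensor_kernel R ?F ?P"
    by (auto intro!: tensor_kernel_sum tensor_kernel_zero_right free_basis_closed[OF R])
  then show "c \<in> tensor_kernel R ?F ?P" using tensor_kernel_cong[OF cp] by blast
qed

section \<open>Extensions that remain exact after tensoring\<close>

text \<open>The presentation criterion restated over C: a map F \<rightarrow> B whose composite with
  g is onto C covers B modulo A, and the pullback of A is the kernel of that composite. F is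
  \<open>res_F0\<close> in the Tor case and C itself in the projective case.\<close>

lemma tensor_injective_lift:
  assumes B: "right_module R B" and C: "right_module R C" and F: "right_module R F"
    and Q: "left_module R Q"
    and g: "g \<in> mod_hom R B C" and surj: "g ` carrier B = carrier C"
    and ker: "{b \<in> carrier B. g b = \<zero>\<^bsub>C\<^esub>} = A" and A: "submodule A R B"
    and phi: "\<phi> \<in> mod_hom R F B" and onto: "\<And>c. c \<in> carrier C \<Longrightarrow> \<exists>f\<in>carrier F. g (\<phi> f) = c"
    and inj: "tensor_injective R {f \<in> carrier F. g (\<phi> f) = \<zero>\<^bsub>C\<^esub>} F Q"
  shows "tensor_injective R A B Q"
proof (rule tensor_injective_presentation[OF B A F Q phi])
  interpret B: right_module R B by (rule B)
  interpret C: right_module R C by (rule C)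
  note ph = mod_hom_closed[OF phi]
  fix b assume b: "b \<in> carrier B"
  obtain f where f: "f \<in> carrier F" "g (\<phi> f) = g b" using onto[OF mod_hom_closed[OF g b]] by blast
  have "g (b \<ominus>\<^bsub>B\<^esub> \<phi> f) = \<zero>\<^bsub>C\<^esub>"
    using b f ph[OF f(1)] mod_hom_closed[OF g b]
    by (simp add: mod_hom_diff[OF g B.M.abelian_group_axioms C.M.abelian_group_axioms] C.M.diff_self)
  then show "\<exists>f\<in>carrier F. b \<ominus>\<^bsub>B\<^esub> \<phi> f \<in> A"
    using b f ph[OF f(1)] by (auto simp flip: ker intro!: bexI[of _ f])
next
  have "{f \<in> carrier F. \<phi> f \<in> A} = {f \<in> carrier F. g (\<phi> f) = \<zero>\<^bsub>C\<^esub>}"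
    using mod_hom_closed[OF phi] by (auto simp flip: ker)
  with inj show "tensor_injective R {f \<in> carrier F. \<phi> f \<in> A} F Q" by simp
qed

text \<open>Sending each basis vector x to a preimage of x under g makes the composite with g equal
  to the augmentation of the standard resolution, so its kernel is \<open>res_K0\<close> on the
  nose.\<close>

lemma tensor_injective_Tor1:
  assumes B: "right_module R B" and C: "right_module R C" and Q: "left_module R Q"
    and g: "g \<in> mod_hom R B C" and surj: "g ` carrier B = carrier C"
    and ker: "{b \<in> carrier B. g b = \<zero>\<^bsub>C\<^esub>} = A" and A: "submodule A R B"
    and triv: "trivial_group (Tor1 R C Q)"
  shows "tensor_injective R A B Q"
proof -
  have R: "ring R" by (rule right_module_ring[OF B])
  have F: "right_module R (res_F0 R C)" unfolding res_F0_def by (rule right_module_free[OF R])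
  have "\<forall>x\<in>carrier C. \<exists>b\<in>carrier B. g b = x" unfolding surj[symmetric] by blast
  then obtain b where b: "\<And>x. x \<in> carrier C \<Longrightarrow> b x \<in> carrier B" "\<And>x. x \<in> carrier C \<Longrightarrow> g (b x) = x"
    by metis
  let ?\<phi> = "free_lift B (carrier C) b"
  have phi: "?\<phi> \<in> mod_hom R (res_F0 R C) B"
    unfolding res_F0_def by (rule free_lift_hom[OF B b(1)])
  have gphi: "g (?\<phi> f) = free_eval C (carrier C) f" if "f \<in> carrier (res_F0 R C)" for f
  proof -
    have f: "f \<in> carrier (free_right_module R (carrier C))" using that by (simp add: res_F0_def)
    have "g (?\<phi> f) = free_lift C (carrier C) (\<lambda>x. g (b x)) f"
      by (rule free_lift_compose[OF B b(1) C g f])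
    also have "\<dots> = free_eval C (carrier C) f"
      unfolding free_eval_eq_free_lift by (rule free_lift_cong[OF C f]) (use b(2) in auto)
    finally show ?thesis .
  qed
  show ?thesis
  proof (rule tensor_injective_lift[OF B C F Q g surj ker A phi])
    fix x assume x: "x \<in> carrier C"
    have "g (?\<phi> (free_basis R (carrier C) x)) = x"
      using free_lift_basis[OF B b(1) x] b(2)[OF x] by simp
    then show "\<exists>f\<in>carrier (res_F0 R C). g (?\<phi> f) = x"
      by (rule bexI[where x = "free_basis R (carrier C) x"]) (unfold res_F0_def, rule free_basis_closed[OF R])
  next
    have "{f \<in> carrier (res_F0 R C). g (?\<phi> f) = \<zero>\<^bsub>C\<^esub>} = res_K0 R C"
      by (auto simp: res_K0_def a_kernel_def kernel_def gphi)
    then show "tensor_injective R {f \<in> carrier (res_F0 R C). g (?\<phi> f) = \<zero>\<^bsub>C\<^esub>} (res_F0 R C) Q"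
      using Tor1_trivial_imp_injective[OF C Q triv] by simp
  qed
qed

text \<open>Embedding C in a free module by s and lifting p on the basis gives a section of g.
  Presenting C by itself through this section leaves a zero kernel.\<close>

lemma tensor_injective_projective:
  assumes B: "right_module R B" and C: "C \<in> Add_class TYPE('x) R" and Q: "left_module R Q"
    and g: "g \<in> mod_hom R B C" and surj: "g ` carrier B = carrier C"
    and ker: "{b \<in> carrier B. g b = \<zero>\<^bsub>C\<^esub>} = A" and A: "submodule A R B"
  shows "tensor_injective R A B Q"
proof -
  have R: "ring R" by (rule right_module_ring[OF B])
  have CM: "right_module R C" using C by (simp add: Add_class_def)
  obtain Y :: "'x set" where "iso_to_direct_summand R C (free_right_module R Y)"
    using C by (auto simp: Add_class_def)
  from iso_to_direct_summand_retract[OF CM right_module_free[OF R] this]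
  obtain s p where s: "s \<in> mod_hom R C (free_right_module R Y)" and p: "p \<in> mod_hom R (free_right_module R Y) C"
    and ps: "\<And>x. x \<in> carrier C \<Longrightarrow> p (s x) = x" by blast
  have pe: "p (free_basis R Y y) \<in> carrier C" for y
    by (rule mod_hom_closed[OF p free_basis_closed[OF R]])
  \<comment> \<open>Preimages are chosen for every y of the index type; outside Y the basis function
    is zero, so it too has an image in C.\<close>
  have "\<forall>y. \<exists>b\<in>carrier B. g b = p (free_basis R Y y)" using pe unfolding surj[symmetric] by (metis imageE)
  then obtain b where b: "\<And>y. b y \<in> carrier B" "\<And>y. g (b y) = p (free_basis R Y y)"
    by metis
  let ?\<phi> = "\<lambda>x. free_lift B Y b (s x)"
  have phi: "?\<phi> \<in> mod_hom R C B"
    by (rule mod_hom_compose[OF s free_lift_hom[OF B]]) (rule b)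
  have gphi: "g (?\<phi> x) = x" if x: "x \<in> carrier C" for x
  proof -
    have sx: "s x \<in> carrier (free_right_module R Y)" by (rule mod_hom_closed[OF s x])
    have "g (?\<phi> x) = free_lift C Y (\<lambda>y. p (free_basis R Y y)) (s x)"
      using free_lift_compose[OF B b(1) CM g sx] b(2) by simp
    also have "\<dots> = p (s x)"
      using free_lift_compose[OF right_module_free[OF R], where b = "free_basis R Y", OF free_basis_closed[OF R] CM p sx]
        free_lift_free_basis[OF R sx] by simp
    finally show ?thesis using ps x by simp
  qed
  show ?thesis
  proof (rule tensor_injective_lift[OF B CM CM Q g surj ker A phi])
    have "\<zero>\<^bsub>C\<^esub> \<in> carrier C"
      by (rule abelian_monoid.zero_closed[OF abelian_group.axioms(1)[OF right_module_abelian_group[OF CM]]])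
    then have "{x \<in> carrier C. g (?\<phi> x) = \<zero>\<^bsub>C\<^esub>} = {\<zero>\<^bsub>C\<^esub>}" using gphi by auto
    then show "tensor_injective R {x \<in> carrier C. g (?\<phi> x) = \<zero>\<^bsub>C\<^esub>} C Q"
      using tensor_injective_zero[OF CM Q] by simp
  qed (use gphi in blast)
qed

lemma product_injective_projective:
  assumes R: "ring R" and C: "C \<in> Add_class TYPE('x) R" and Q: "\<And>i. i \<in> I \<Longrightarrow> left_module R (Q i)"
  shows "product_injective R C I Q"
proof -
  have CM: "right_module R C" using C by (simp add: Add_class_def)
  obtain Y :: "'x set" where "iso_to_direct_summand R C (free_right_module R Y)"
    using C by (auto simp: Add_class_def)
  from iso_to_direct_summand_retract[OF CM right_module_free[OF R] this]
  obtain s p where sp: "s \<in> mod_hom R C (free_right_module R Y)" "p \<in> mod_hom R (free_right_module R Y) C"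
    "\<And>x. x \<in> carrier C \<Longrightarrow> p (s x) = x" by blast
  show ?thesis
    by (rule product_injective_retract[OF CM right_module_free[OF R] Q sp product_injective_free[OF R Q]])
qed

section \<open>Filtrations\<close>

text \<open>At a greatest element \<open>ord_succ\<close> would be a least element of the empty set;
  the hypothesis supplies an element above \<beta>.\<close>

lemma ord_succ_greater: "\<beta> < \<alpha> \<Longrightarrow> \<beta> < ord_succ \<beta>"
  unfolding ord_succ_def by (rule LeastI)

lemma ord_succ_le: "\<beta> < \<alpha> \<Longrightarrow> ord_succ \<beta> \<le> \<alpha>"
  unfolding ord_succ_def by (rule Least_le)

lemma less_ord_succ: "\<gamma> < ord_succ \<beta> \<Longrightarrow> \<gamma> \<le> \<beta>"
  unfolding ord_succ_def using not_less_Least leI by blast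

text \<open>If \<alpha> is neither least nor a limit, some \<beta> below it has a successor that is
  not below \<alpha>; by \<open>ord_succ_le\<close> this successor is \<alpha>.\<close>

lemma ordinal_cases:
  fixes \<alpha> :: "'o :: wellorder"
  obtains (zero) "\<alpha> = (LEAST \<beta>. True)" | (succ) \<gamma> where "\<gamma> < \<alpha>" "ord_succ \<gamma> = \<alpha>" | (limit) "ord_limit \<alpha>"
proof (cases "\<exists>\<beta>. \<beta> < \<alpha>")
  case True
  then show thesis using ord_succ_le that(2,3) unfolding ord_limit_def by (metis order.not_eq_order_implies_strict)
next
  case False
  then have "\<alpha> = (LEAST \<beta>. True)"
    by (metis (mono_tags, lifting) Least_le not_le_imp_less order.antisym)
  then show thesis by (rule that(1))
qed

text \<open>A formal sum has finite support, and finitely many elements of a chain lie in a common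
  member. The element \<delta> provides a stage for the empty sum.\<close>

lemma keys_chain_union:
  fixes N :: "'o :: linorder \<Rightarrow> 'm set" and c :: "'m \<times> 'q \<Rightarrow>\<^sub>0 int"
  assumes ne: "\<delta> < \<alpha>" and mono: "\<And>\<beta> \<gamma>. \<beta> \<le> \<gamma> \<Longrightarrow> \<gamma> < \<alpha> \<Longrightarrow> N \<beta> \<subseteq> N \<gamma>"
    and c: "Poly_Mapping.keys c \<subseteq> (\<Union>\<beta>\<in>{..<\<alpha>}. N \<beta>) \<times> S"
  shows "\<exists>\<beta><\<alpha>. Poly_Mapping.keys c \<subseteq> N \<beta> \<times> S"
  using c
proof (induction c rule: frag_induction)
  case zero
  then show ?case using ne by auto
next
  case (one x)
  then show ?case by auto
next
  case (diff a b)
  then obtain \<beta> \<gamma> where "\<beta> < \<alpha>" "Poly_Mapping.keys a \<subseteq> N \<beta> \<times> S" "\<gamma> < \<alpha>" "Poly_Mapping.keys b \<subseteq> N \<gamma> \<times> S"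
    by blast
  moreover from this have "N \<beta> \<subseteq> N (max \<beta> \<gamma>)" "N \<gamma> \<subseteq> N (max \<beta> \<gamma>)" "max \<beta> \<gamma> < \<alpha>"
    using mono[OF max.cobounded1, of \<beta> \<gamma>] mono[OF max.cobounded2, of \<beta> \<gamma>] by simp_all
  ultimately have "Poly_Mapping.keys (a - b) \<subseteq> N (max \<beta> \<gamma>) \<times> S \<and> max \<beta> \<gamma> < \<alpha>"
    using keys_diff[of a b] by blast
  then show ?case by blast
qed

section \<open>Transfinite induction along a filtration\<close>

text \<open>Only the chain is recorded. The successive quotients act through the hypotheses on
  single steps in the two induction lemmas, so the class they come from does not appear
  here.\<close>

locale filtration =
  fixes R :: "('r, 'u) ring_scheme" and F :: "('r, 'm) module" and N :: "'o :: wellorder \<Rightarrow> 'm set" and \<tau> :: 'o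
  assumes F: "right_module R F"
    and sub: "\<And>\<alpha>. \<alpha> \<le> \<tau> \<Longrightarrow> submodule (N \<alpha>) R F"
    and mono: "\<And>\<alpha> \<beta>. \<alpha> \<le> \<beta> \<Longrightarrow> \<beta> \<le> \<tau> \<Longrightarrow> N \<alpha> \<subseteq> N \<beta>"
    and zero: "N (LEAST \<alpha>. True) = {\<zero>\<^bsub>F\<^esub>}"
    and limit: "\<And>\<alpha>. \<alpha> \<le> \<tau> \<Longrightarrow> ord_limit \<alpha> \<Longrightarrow> N \<alpha> = (\<Union>\<beta>\<in>{..<\<alpha>}. N \<beta>)"
begin

abbreviation stage :: "'o \<Rightarrow> ('r, 'm) module"
  where "stage \<alpha> \<equiv> F\<lparr>carrier := N \<alpha>\<rparr>"

lemma right_module_stage: "\<alpha> \<le> \<tau> \<Longrightarrow> right_module R (stage \<alpha>)"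
  using right_module.right_module_submodule[OF F sub] .

lemma submodule_stage:
  assumes "\<alpha> \<le> \<beta>" "\<beta> \<le> \<tau>" shows "submodule (N \<alpha>) R (stage \<beta>)"
proof -
  have sA: "submodule (N \<alpha>) R F" using sub assms by auto
  interpret S: right_module R "stage \<beta>" by (rule right_module_stage[OF assms(2)])
  interpret F: right_module R F by (rule F)
  show ?thesis
  proof (rule S.submoduleI)
    fix a assume a: "a \<in> N \<alpha>"
    have aF: "a \<in> carrier F" "\<ominus>\<^bsub>F\<^esub> a \<in> N \<alpha>" using a submodule_subset[OF sA] submodule_minus[OF sA] by auto
    then have "\<ominus>\<^bsub>stage \<beta>\<^esub> a = \<ominus>\<^bsub>F\<^esub> a"
      using a mono[OF assms] by (intro S.M.minus_equality) (auto simp: F.M.l_neg)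
    then show "\<ominus>\<^bsub>stage \<beta>\<^esub> a \<in> N \<alpha>" using aF by simp
  qed (use mono[OF assms] submodule_zero[OF sA] submodule_add[OF sA] submodule_smult[OF sA] in auto)
qed

lemma tensor_kernel_stage_mono:
  assumes "\<beta> \<le> \<gamma>" "\<gamma> \<le> \<tau>" "left_module R Q" "c \<in> tensor_kernel R (stage \<beta>) Q"
  shows "c \<in> tensor_kernel R (stage \<gamma>) Q"
  using tensor_kernel_mono[OF right_module_stage[OF assms(2)] submodule_stage[OF assms(1,2)] assms(3)] assms(4)
  by simp

text \<open>Membership in the kernel is witnessed by finitely many relations, and each of them
  involves at most two independent elements of the union; the maximum of the stages concerned
  suffices.\<close>

lemma tensor_kernel_limit:
  assumes \<alpha>: "\<alpha> \<le> \<tau>" "ord_limit \<alpha>" and Q: "left_module R Q"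
    and c: "c \<in> tensor_kernel R (stage \<alpha>) Q"
  shows "\<exists>\<gamma><\<alpha>. c \<in> tensor_kernel R (stage \<gamma>) Q"
proof -
  interpret A: tensor_pair R "stage \<alpha>" Q
    by (intro tensor_pairI right_module_stage \<alpha> Q)
  have pair: "tensor_pair R (stage \<gamma>) Q" if "\<gamma> < \<alpha>" for \<gamma>
    using that \<alpha> by (intro tensor_pairI right_module_stage Q) auto
  have mem: "\<exists>\<gamma><\<alpha>. x \<in> N \<gamma>" if "x \<in> N \<alpha>" for x
    using that limit[OF \<alpha>] by auto
  have up: "x \<in> N (max \<beta> \<gamma>)" if "x \<in> N \<beta>" "\<beta> < \<alpha>" "\<gamma> < \<alpha>" for x \<beta> \<gamma>
    by (rule subsetD[OF mono, OF max.cobounded1 _ that(1)]) (use that \<alpha> in auto)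
  show ?thesis
    using c
  proof (induction rule: A.tensor_kernel_induct)
    case zero
    then show ?case using \<alpha>(2) tensor_pair.tensor_kernel_zero[OF pair] by (auto simp: ord_limit_def)
  next
    case (add_left x y q)
    then obtain \<beta> \<gamma> where "\<beta> < \<alpha>" "x \<in> N \<beta>" "\<gamma> < \<alpha>" "y \<in> N \<gamma>" using mem[of x] mem[of y] by auto
    then have "max \<beta> \<gamma> < \<alpha>" "x \<in> N (max \<beta> \<gamma>)" "y \<in> N (max \<beta> \<gamma>)"
      using up[of x \<beta> \<gamma>] up[of y \<gamma> \<beta>] by (auto simp: max.commute)
    then obtain \<delta> where "\<delta> < \<alpha>" "x \<in> N \<delta>" "y \<in> N \<delta>" by blast
    then show ?case
      using tensor_pair.tensor_kernel_add_left[OF pair, of \<delta> x y q] add_left by auto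
  next
    case (add_right x q q')
    then obtain \<beta> where "\<beta> < \<alpha>" "x \<in> N \<beta>" using mem[of x] by auto
    then show ?case
      using tensor_pair.tensor_kernel_add_right[OF pair, of \<beta> x q q'] add_right by auto
  next
    case (smult r x q)
    then obtain \<beta> where "\<beta> < \<alpha>" "x \<in> N \<beta>" using mem[of x] by auto
    then show ?case
      using tensor_pair.tensor_kernel_smult[OF pair, of \<beta> r x q] smult by auto
  next
    case (diff a b)
    then obtain \<beta> \<gamma> where *: "\<beta> < \<alpha>" "a \<in> tensor_kernel R (stage \<beta>) Q" "\<gamma> < \<alpha>" "b \<in> tensor_kernel R (stage \<gamma>) Q"
      by blast
    then have m: "max \<beta> \<gamma> < \<alpha>" "max \<beta> \<gamma> \<le> \<tau>" using \<alpha> by auto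
    have "a \<in> tensor_kernel R (stage (max \<beta> \<gamma>)) Q" "b \<in> tensor_kernel R (stage (max \<beta> \<gamma>)) Q"
      by (rule tensor_kernel_stage_mono[OF max.cobounded1 m(2) Q *(2)],
          rule tensor_kernel_stage_mono[OF max.cobounded2 m(2) Q *(4)])
    then show ?case using tensor_pair.tensor_kernel_diff[OF pair[OF m(1)]] m(1) by blast
  qed
qed

lemma tensor_injective_refl: "tensor_injective R (N \<alpha>) (stage \<alpha>) Q"
  by (simp add: tensor_injective_def)

text \<open>Induction on the upper index with the lower one arbitrary: a successor is reached by
  transitivity through its predecessor, and at a limit a vanishing sum already vanishes at an
  earlier stage, where the hypothesis for smaller indices applies.\<close>

lemma tensor_injective_stages:
  assumes Q: "left_module R Q"
    and step: "\<And>\<alpha>. \<alpha> < \<tau> \<Longrightarrow> tensor_injective R (N \<alpha>) (stage (ord_succ \<alpha>)) Q"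
  shows "\<beta> \<le> \<alpha> \<Longrightarrow> \<alpha> \<le> \<tau> \<Longrightarrow> tensor_injective R (N \<beta>) (stage \<alpha>) Q"
proof (induction \<alpha> arbitrary: \<beta> rule: less_induct)
  case (less \<alpha>)
  show ?case
  proof (cases "\<beta> = \<alpha>")
    case True
    then show ?thesis by (simp add: tensor_injective_refl)
  next
    case False
    then have \<beta>: "\<beta> < \<alpha>" using less.prems by simp
    show ?thesis
    proof (cases \<alpha> rule: ordinal_cases)
      case zero
      then show ?thesis using \<beta> not_less_Least[of \<beta> "\<lambda>_. True"] by simp
    next
      case (succ \<gamma>)
      then have \<beta>\<gamma>: "\<beta> \<le> \<gamma>" using \<beta> less_ord_succ by auto
      have \<gamma>: "\<gamma> < \<tau>" using succ less.prems by auto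
      have "tensor_injective R (N \<beta>) (stage \<gamma>) Q"
        using less.IH[OF succ(1) \<beta>\<gamma>] \<gamma> by simp
      moreover have "tensor_injective R (N \<gamma>) (stage \<alpha>) Q"
        using step[OF \<gamma>] succ by simp
      moreover have "N \<beta> \<subseteq> N \<gamma>" by (rule mono[OF \<beta>\<gamma>]) (use \<gamma> in simp)
      ultimately show ?thesis using tensor_injective_trans[where M = "stage \<alpha>" and B = "N \<gamma>"] by simp
    next
      case limit
      show ?thesis
        unfolding tensor_injective_def
      proof (intro ballI impI)
        fix c assume c: "c \<in> tensor_kernel R (stage \<alpha>) Q" and k: "Poly_Mapping.keys c \<subseteq> N \<beta> \<times> carrier Q"
        obtain \<gamma> where \<gamma>: "\<gamma> < \<alpha>" "c \<in> tensor_kernel R (stage \<gamma>) Q"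
          using tensor_kernel_limit[OF less.prems(2) limit Q c] by blast
        \<comment> \<open>The stage \<gamma> at which c vanishes may lie below \<beta>; passing to
          the maximum gives a stage that contains N \<beta> and is still below \<alpha>.\<close>
        have m: "max \<beta> \<gamma> < \<alpha>" "max \<beta> \<gamma> \<le> \<tau>" using \<beta> \<gamma> less.prems by auto
        have "c \<in> tensor_kernel R (stage (max \<beta> \<gamma>)) Q"
          by (rule tensor_kernel_stage_mono[OF _ m(2) Q \<gamma>(2)]) simp
        from tensor_injectiveD[OF less.IH[OF m(1) _ m(2)] this k]
        show "c \<in> tensor_kernel R (stage \<alpha>\<lparr>carrier := N \<beta>\<rparr>) Q" by simp
      qed
    qed
  qed
qed

lemma product_injective_stages:
  assumes Q: "\<And>i. i \<in> I \<Longrightarrow> left_module R (Q i)"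
    and step: "\<And>i \<alpha>. i \<in> I \<Longrightarrow> \<alpha> < \<tau> \<Longrightarrow> tensor_injective R (N \<alpha>) (stage (ord_succ \<alpha>)) (Q i)"
    and extension: "\<And>\<alpha>. \<alpha> < \<tau> \<Longrightarrow> product_injective R (stage \<alpha>) I Q \<Longrightarrow>
      product_injective R (stage (ord_succ \<alpha>)) I Q"
  shows "\<alpha> \<le> \<tau> \<Longrightarrow> product_injective R (stage \<alpha>) I Q"
proof (induction \<alpha> rule: less_induct)
  case (less \<alpha>)
  have P: "left_module R (product_module I Q)"
    by (intro left_module_product right_module_ring[OF F] Q)
  show ?case
  proof (cases \<alpha> rule: ordinal_cases)
    case zero
    then show ?thesis
      using filtration.zero[OF filtration_axioms] less.prems
      by (intro product_injective_zero right_module_stage Q) auto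
  next
    case (succ \<gamma>)
    then show ?thesis using extension[of \<gamma>] less.IH[of \<gamma>] less.prems by auto
  next
    case limit
    have N\<alpha>: "N \<alpha> = (\<Union>\<beta>\<in>{..<\<alpha>}. N \<beta>)"
      by (rule filtration.limit[OF filtration_axioms less.prems limit])
    obtain \<delta> where \<delta>: "\<delta> < \<alpha>" using limit by (auto simp: ord_limit_def)
    show ?thesis
      unfolding product_injective_def
    proof (intro allI impI)
      fix c assume "Poly_Mapping.keys c \<subseteq> carrier (stage \<alpha>) \<times> carrier (product_module I Q)"
        and ci: "\<forall>i\<in>I. frag_tensor (\<lambda>x. x) (\<lambda>q. q i) c \<in> tensor_kernel R (stage \<alpha>) (Q i)"
      then have "Poly_Mapping.keys c \<subseteq> (\<Union>\<beta>\<in>{..<\<alpha>}. N \<beta>) \<times> carrier (product_module I Q)"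
        using N\<alpha> by simp
      from keys_chain_union[OF \<delta> _ this] obtain \<beta> where \<beta>: "\<beta> < \<alpha>"
        and k: "Poly_Mapping.keys c \<subseteq> N \<beta> \<times> carrier (product_module I Q)"
        using mono less.prems by (meson less_le_trans less_imp_le)
      have "c \<in> tensor_kernel R (stage \<beta>) (product_module I Q)"
      proof (rule product_injectiveD[OF less.IH[OF \<beta>]])
        show "\<beta> \<le> \<tau>" using \<beta> less.prems by auto
        show "Poly_Mapping.keys c \<subseteq> carrier (stage \<beta>) \<times> carrier (product_module I Q)" using k by simp
        fix i assume i: "i \<in> I"
        \<comment> \<open>The sum c lives over N \<beta>, but its projections are known to vanish
          only over the limit stage. Injectivity across the whole interval from \<beta> to \<alpha>
          pulls the vanishing back.\<close>
        have "tensor_injective R (N \<beta>) (stage \<alpha>) (Q i)"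
          using tensor_injective_stages[OF Q[OF i] step[OF i]] \<beta> less.prems by auto
        from tensor_injectiveD[OF this _ keys_projection[OF k i]] ci i
        show "frag_tensor (\<lambda>x. x) (\<lambda>q. q i) c \<in> tensor_kernel R (stage \<beta>) (Q i)" by simp
      qed
      then show "c \<in> tensor_kernel R (stage \<alpha>) (product_module I Q)"
        by (rule tensor_kernel_stage_mono[OF less_imp_le[OF \<beta>] less.prems P])
    qed
  qed
qed

end

text \<open>The family is fixed at the outset and stays the same along the filtration, so the index
  type \<open>'i\<close> of the conclusion is the one at which the Mittag-Leffler property of the
  members of \<open>\<S>\<close> is applied.\<close>

theorem proposition1p9:
  fixes R :: "('r, 'u) ring_scheme"
    and \<S> :: "('r, 's) module set"
    and \<Q> :: "('r, 'q) module set"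
    and F :: "('r, 'm) module"
    and M :: "('r, 'n) module"
  assumes "ring R"
    and "\<forall>S\<in>\<S>. right_module R S"
    and "\<forall>S\<in>\<S>. mittag_leffler TYPE('i) R \<Q> S"
    and "\<Q> \<subseteq> Tor1_perp R \<S>"
    and "filtered TYPE('o :: wellorder) R (\<S> \<union> Add_class TYPE('x) R) F"
    and "right_module R M"
    and "iso_to_direct_summand R M F"
  shows "mittag_leffler TYPE('i) R \<Q> M"
  unfolding mittag_leffler_def
proof (intro conjI allI impI)
  fix I :: "'i set" and Q :: "'i \<Rightarrow> ('r, 'q) module"
  assume Q\<Q>: "\<forall>i\<in>I. Q i \<in> \<Q>"
  have R: "ring R" by (rule assms)
  have Q: "left_module R (Q i)" if "i \<in> I" for i
    using Q\<Q> that assms(4) by (auto simp: Tor1_perp_def)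
  have F: "right_module R F" using assms(5) by (simp add: filtered_def)
  obtain \<tau> :: 'o and N where N_sub: "\<forall>\<alpha>\<le>\<tau>. submodule (N \<alpha>) R F"
    and N_mono: "\<forall>\<alpha> \<beta>. \<alpha> \<le> \<beta> \<and> \<beta> \<le> \<tau> \<longrightarrow> N \<alpha> \<subseteq> N \<beta>"
    and N_zero: "N (LEAST \<alpha>. True) = {\<zero>\<^bsub>F\<^esub>}" and N_top: "N \<tau> = carrier F"
    and N_limit: "\<forall>\<alpha>\<le>\<tau>. ord_limit \<alpha> \<longrightarrow> N \<alpha> = (\<Union>\<beta>\<in>{..<\<alpha>}. N \<beta>)"
    and N_succ: "\<forall>\<alpha><\<tau>. \<exists>C\<in>\<S> \<union> Add_class TYPE('x) R.
      mod_iso R (quotient_module (F\<lparr>carrier := N (ord_succ \<alpha>)\<rparr>) (N \<alpha>)) C"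
    using assms(5) unfolding filtered_def by (elim conjE exE) (rule that)
  have fil: "filtration R F N \<tau>"
    using F N_sub N_mono N_zero N_limit by (simp add: filtration_def)
  interpret filtration R F N \<tau> by (rule fil)
  \<comment> \<open>Injectivity and the passage of the Mittag-Leffler property are proved together,
    since both rest on the same surjection of the successor stage onto C.\<close>
  have step: "(\<forall>i\<in>I. tensor_injective R (N \<alpha>) (stage (ord_succ \<alpha>)) (Q i)) \<and>
      (product_injective R (stage \<alpha>) I Q \<longrightarrow> product_injective R (stage (ord_succ \<alpha>)) I Q)"
    if \<alpha>: "\<alpha> < \<tau>" for \<alpha>
  proof -
    have s: "\<alpha> \<le> ord_succ \<alpha>" "ord_succ \<alpha> \<le> \<tau>"
      using ord_succ_greater[OF \<alpha>] ord_succ_le[OF \<alpha>] by auto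
    note B = right_module_stage[OF s(2)] and A = submodule_stage[OF s]
    obtain C where C: "C \<in> \<S> \<union> Add_class TYPE('x) R"
      and iso: "mod_iso R (quotient_module (stage (ord_succ \<alpha>)) (N \<alpha>)) C"
      using N_succ[rule_format, OF \<alpha>] by (elim bexE) (rule that)
    have CM: "right_module R C" using C assms(2) by (auto simp: Add_class_def)
    obtain g where g: "g \<in> mod_hom R (stage (ord_succ \<alpha>)) C" "g ` carrier (stage (ord_succ \<alpha>)) = carrier C"
      and ker: "{b \<in> carrier (stage (ord_succ \<alpha>)). g b = \<zero>\<^bsub>C\<^esub>} = N \<alpha>"
      by (rule quotient_iso_surjection[OF B A CM iso])
    \<comment> \<open>The two kinds of quotient differ in the source of injectivity: a vanishing Tor
      group for members of \<open>\<S>\<close>, a section for projectives.\<close>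
    have tens: "tensor_injective R (N \<alpha>) (stage (ord_succ \<alpha>)) (Q i)" if i: "i \<in> I" for i
    proof (cases "C \<in> \<S>")
      case True
      then have "trivial_group (Tor1 R C (Q i))"
        using Q\<Q> i assms(4) by (auto simp: Tor1_perp_def)
      then show ?thesis by (rule tensor_injective_Tor1[OF B CM Q[OF i] g ker A])
    next
      case False
      then have "C \<in> Add_class TYPE('x) R" using C by blast
      then show ?thesis by (rule tensor_injective_projective[OF B _ Q[OF i] g ker A])
    qed
    have "product_injective R C I Q"
    proof (cases "C \<in> \<S>")
      case True
      then have "mittag_leffler TYPE('i) R \<Q> C" using assms(3) by blast
      then have "inj_on (tensor_product_map R C I Q) (carrier (tensor R C (product_module I Q)))"
        using Q\<Q> by (simp add: mittag_leffler_def)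
      then show ?thesis by (subst (asm) inj_tensor_product_map_iff[OF CM Q])
    next
      case False
      then have "C \<in> Add_class TYPE('x) R" using C by blast
      then show ?thesis by (rule product_injective_projective[OF R _ Q])
    qed
    then have "product_injective R (stage (ord_succ \<alpha>)) I Q" if "product_injective R (stage \<alpha>) I Q"
      using that by (intro product_injective_extension[OF B CM Q g ker A tens]) simp_all
    with tens show ?thesis by blast
  qed
  have "product_injective R (stage \<tau>) I Q"
    by (rule product_injective_stages[OF Q]) (use step in auto)
  then have "product_injective R F I Q" by (simp add: N_top)
  obtain s p where sp: "s \<in> mod_hom R M F" "p \<in> mod_hom R F M" "\<And>x. x \<in> carrier M \<Longrightarrow> p (s x) = x"
    by (rule iso_to_direct_summand_retract[OF assms(6) F assms(7)]) (rule that)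
  have "product_injective R M I Q"
    by (rule product_injective_retract[OF assms(6) F Q sp \<open>product_injective R F I Q\<close>])
  then show "inj_on (tensor_product_map R M I Q) (carrier (tensor R M (product_module I Q)))"
    by (subst inj_tensor_product_map_iff[OF assms(6) Q])
qed (rule assms(6))

end
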